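(* Let $w$ be a word of length $2n$ in even integers, all of whose letters lie in $\{0,2,\dots,2N\}$. For $k=1,\dots,N+1$ let $n_{2k}$ be the number of letters of $w$ equal to $2k$, and let $m_{2k-1}=\sum_{j\ge0}(-1)^j\,\#\{i: a_i=2k-2-2j\}$, where $w=(a_1,\dots,a_{2n})$. Then the number $h_{\mathrm{char}}(w)$ of composition factors of $w$ isomorphic to the trivial module is $$h_{\mathrm{char}}(w)=\prod_{k=1}^{N+1}\binom{n_{2k}}{m_{2k-1}}.$$ Here by convention $\binom{0}{a}=\delta_{a,0}$ and $\binom{a}{b}=0$ if $b<0$.
   Context: Fix $q\in\mathbb C^\times$ not a root of unity. $U=U_q\widehat{\mathfrak{sl}}_2$ (level zero) is the unital associative $\mathbb C$-algebra with generators $e_0,e_1,f_0,f_1,K^{\pm1}$ and relations $KK^{-1}=K^{-1}K=1$, $Ke_1K^{-1}=q^2e_1$, $Kf_1K^{-1}=q^{-2}f_1$, $Ke_0K^{-1}=q^{-2}e_0$, $Kf_0K^{-1}=q^{2}f_0$, $[e_1,f_1]=-[e_0,f_0]=\frac{K-K^{-1}}{q-q^{-1}}$, $[e_1,f_0]=[e_0,f_1]=0$, and for $i\neq j$ in $\{0,1\}$: $e_i^3e_j-(q^2+1+q^{-2})e_i^2e_je_i+(q^2+1+q^{-2})e_ie_je_i^2-e_je_i^3=0$ and the same relation with $e$ replaced by $f$. Tensor products of $U$-modules are formed with the coproduct $\Delta(K^{\pm1})=K^{\pm1}\otimes K^{\pm1}$, $\Delta(e_0)=e_0\otimes K^{-1}+1\otimes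 e_0$, $\Delta(f_0)=f_0\otimes 1+K\otimes f_0$, $\Delta(e_1)=e_1\otimes K+1\otimes e_1$, $\Delta(f_1)=f_1\otimes 1+K^{-1}\otimes f_1$. The trivial module $\mathbb C$ has $e_i,f_i$ acting by $0$ and $K$ by $1$. For $a\in 2\mathbb Z$ the two-dimensional evaluation module, denoted simply $a$, has basis $v_+,v_-$ with $Kv_\pm=q^{\pm1}v_\pm$, $e_1v_-=v_+$, $e_1v_+=0$, $f_1v_+=v_-$, $f_1v_-=0$, and $e_0,f_0$ acting as $q^{a}f_1$, $q^{-a}e_1$ respectively. A word $w=(a_1,\dots,a_k)$ is a sequence of even integers, also regarded as the $U$-module $a_1\otimes\cdots\otimes a_k$. $h_{\mathrm{char}}(w)$ denotes the multiplicity of the trivial module $\mathbb C$ in a Jordan–Hölder series of the $U$-module $w$. *)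

theory Defs
  imports "Jordan_Normal_Form.VS_Connect" "HOL-Algebra.AbelCoset"
begin

section \<open>Modules over $U = U_q\widehat{\mathfrak{sl}}_2$ at level zero\<close>

text \<open>
  Since \<open>U\<close> is presented by generators and relations, a \<open>U\<close>-module is a complex vector space
  with one linear operator for each generator, such that the operators satisfy the defining
  relations (\<open>K_inv\<close> stands for $K^{-1}$). Submodules, homomorphisms and quotients are likewise determined by the action of
  the generators. Vector spaces are HOL-Algebra modules over \<open>class_ring :: complex ring\<close>; the
  ring fields \<open>mult\<close> and \<open>one\<close> of the record carry no information.
\<close>

datatype U_gen = E0 | E1 | F0 | F1 | K | K_inv

record 'v U_mod = "(complex, 'v) module" +
  act :: "U_gen \<Rightarrow> 'v \<Rightarrow> 'v"  (infixr \<open>\<rhd>\<index>\<close> 75)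

text \<open>In \<open>serre\<close> the pair \<open>(a, b)\<close> runs over $(e_i,e_j)$ and $(f_i,f_j)$ with $i\neq j$.\<close>

locale U_module =
  fixes q :: complex and M :: "'v U_mod" (structure)
  assumes vector_space: "Module.module (class_ring :: complex ring) M"
    and act_linear: "act M g \<in> LinearCombinations.module_hom (class_ring :: complex ring) M M"
    and K_K_inv: "x \<in> carrier M \<Longrightarrow> K \<rhd> K_inv \<rhd> x = x"
    and K_inv_K: "x \<in> carrier M \<Longrightarrow> K_inv \<rhd> K \<rhd> x = x"
    and K_E1: "x \<in> carrier M \<Longrightarrow> K \<rhd> E1 \<rhd> K_inv \<rhd> x = q\<^sup>2 \<odot> (E1 \<rhd> x)"
    and K_F1: "x \<in> carrier M \<Longrightarrow> K \<rhd> F1 \<rhd> K_inv \<rhd> x = inverse (q\<^sup>2) \<odot> (F1 \<rhd> x)"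
    and K_E0: "x \<in> carrier M \<Longrightarrow> K \<rhd> E0 \<rhd> K_inv \<rhd> x = inverse (q\<^sup>2) \<odot> (E0 \<rhd> x)"
    and K_F0: "x \<in> carrier M \<Longrightarrow> K \<rhd> F0 \<rhd> K_inv \<rhd> x = q\<^sup>2 \<odot> (F0 \<rhd> x)"
    and E1_F1: "x \<in> carrier M \<Longrightarrow>
      (E1 \<rhd> F1 \<rhd> x) \<ominus> (F1 \<rhd> E1 \<rhd> x) = (1 / (q - inverse q)) \<odot> ((K \<rhd> x) \<ominus> (K_inv \<rhd> x))"
    and E0_F0: "x \<in> carrier M \<Longrightarrow>
      \<ominus> ((E0 \<rhd> F0 \<rhd> x) \<ominus> (F0 \<rhd> E0 \<rhd> x)) = (1 / (q - inverse q)) \<odot> ((K \<rhd> x) \<ominus> (K_inv \<rhd> x))"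
    and E1_F0: "x \<in> carrier M \<Longrightarrow> (E1 \<rhd> F0 \<rhd> x) \<ominus> (F0 \<rhd> E1 \<rhd> x) = \<zero>"
    and E0_F1: "x \<in> carrier M \<Longrightarrow> (E0 \<rhd> F1 \<rhd> x) \<ominus> (F1 \<rhd> E0 \<rhd> x) = \<zero>"
    and serre: "x \<in> carrier M \<Longrightarrow> (a, b) \<in> {(E0, E1), (E1, E0), (F0, F1), (F1, F0)} \<Longrightarrow>
      (a \<rhd> a \<rhd> a \<rhd> b \<rhd> x)
        \<ominus> (q\<^sup>2 + 1 + inverse (q\<^sup>2)) \<odot> (a \<rhd> a \<rhd> b \<rhd> a \<rhd> x)
        \<oplus> (q\<^sup>2 + 1 + inverse (q\<^sup>2)) \<odot> (a \<rhd> b \<rhd> a \<rhd> a \<rhd> x)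
        \<ominus> (b \<rhd> a \<rhd> a \<rhd> a \<rhd> x) = \<zero>"

definition U_submodule :: "'v set \<Rightarrow> 'v U_mod \<Rightarrow> bool" where
  "U_submodule W M \<longleftrightarrow> LinearCombinations.submodule (class_ring :: complex ring) W M \<and>
    (\<forall>g. \<forall>x\<in>W. g \<rhd>\<^bsub>M\<^esub> x \<in> W)"

definition U_simple :: "'v U_mod \<Rightarrow> bool" where
  "U_simple M \<longleftrightarrow> carrier M \<noteq> {\<zero>\<^bsub>M\<^esub>} \<and>
    (\<forall>W. U_submodule W M \<longrightarrow> W = {\<zero>\<^bsub>M\<^esub>} \<or> W = carrier M)"

definition U_isomorphic :: "'v U_mod \<Rightarrow> 'w U_mod \<Rightarrow> bool" where
  "U_isomorphic M N \<longleftrightarrow> (\<exists>h \<in> LinearCombinations.module_hom (class_ring :: complex ring) M N.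
    bij_betw h (carrier M) (carrier N) \<and>
    (\<forall>g. \<forall>x \<in> carrier M. h (g \<rhd>\<^bsub>M\<^esub> x) = g \<rhd>\<^bsub>N\<^esub> h x))"

text \<open>
  The quotient module on the additive cosets of \<open>W\<close>. For a submodule \<open>W\<close> and a coset \<open>X\<close> of
  \<open>W\<close>, the unions below are unions of equal cosets (compare \<open>rcoset_mult\<close> in
  \<open>HOL-Algebra.QuotRing\<close>).
\<close>

definition U_quotient :: "'v U_mod \<Rightarrow> 'v set \<Rightarrow> 'v set U_mod" where
  "U_quotient M W = \<lparr>carrier = a_rcosets\<^bsub>M\<^esub> W, mult = undefined, one = undefined,
    zero = W, add = set_add M,
    smult = (\<lambda>c X. \<Union>x\<in>X. W +>\<^bsub>M\<^esub> (c \<odot>\<^bsub>M\<^esub> x)),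
    act = (\<lambda>g X. \<Union>x\<in>X. W +>\<^bsub>M\<^esub> (g \<rhd>\<^bsub>M\<^esub> x))\<rparr>"

definition U_subquotient :: "'v U_mod \<Rightarrow> 'v set \<Rightarrow> 'v set \<Rightarrow> 'v set U_mod" where
  "U_subquotient M W' W = U_quotient (M\<lparr>carrier := W'\<rparr>) W"

definition composition_series :: "complex \<Rightarrow> 'v U_mod \<Rightarrow> 'v set list \<Rightarrow> bool" where
  "composition_series q M Ws \<longleftrightarrow> U_module q M \<and>
    Ws \<noteq> [] \<and> hd Ws = {\<zero>\<^bsub>M\<^esub>} \<and> last Ws = carrier M \<and>
    (\<forall>W \<in> set Ws. U_submodule W M) \<and>
    (\<forall>i. Suc i < length Ws \<longrightarrow>
      Ws ! i \<subseteq> Ws ! Suc i \<and> U_simple (U_subquotient M (Ws ! Suc i) (Ws ! i)))"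

text \<open>
  The multiplicity of \<open>S\<close> in a composition series of \<open>M\<close>; for a module of finite length it is
  independent of the series by the Jordan--Hoelder theorem.
\<close>

definition JH_multiplicity :: "complex \<Rightarrow> 'v U_mod \<Rightarrow> 's U_mod \<Rightarrow> nat" where
  "JH_multiplicity q M S = (THE m. \<exists>Ws. composition_series q M Ws \<and>
    m = card {i. Suc i < length Ws \<and> U_isomorphic (U_subquotient M (Ws ! Suc i) (Ws ! i)) S})"


section \<open>Evaluation modules and their tensor products\<close>

text \<open>Finite-dimensional modules with a chosen basis are given by matrices acting on column
  vectors.\<close>

record U_rep =
  rep_dim :: nat
  rep_mat :: "U_gen \<Rightarrow> complex mat"

definition U_mod_of_rep :: "U_rep \<Rightarrow> complex vec U_mod" where
  "U_mod_of_rep R = \<lparr>carrier = carrier_vec (rep_dim R), mult = undefined, one = undefined,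
    zero = 0\<^sub>v (rep_dim R), add = (+), smult = (\<cdot>\<^sub>v), act = (\<lambda>g x. rep_mat R g *\<^sub>v x)\<rparr>"

definition trivial_rep :: U_rep where
  "trivial_rep = \<lparr>rep_dim = 1,
    rep_mat = (\<lambda>g. if g = K \<or> g = K_inv then 1\<^sub>m 1 else 0\<^sub>m 1 1)\<rparr>"

text \<open>The basis vectors $v_+$, $v_-$ have index 0 and 1, respectively.\<close>

definition eval_rep :: "complex \<Rightarrow> int \<Rightarrow> U_rep" where
  "eval_rep q a = (let
      e = mat_of_rows_list 2 [[0, 1], [0, 0]];
      f = mat_of_rows_list 2 [[0, 0], [1, 0]]
    in \<lparr>rep_dim = 2, rep_mat = (\<lambda>g. case g of
        E1 \<Rightarrow> e
      | F1 \<Rightarrow> f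
      | E0 \<Rightarrow> (q powi a) \<cdot>\<^sub>m f
      | F0 \<Rightarrow> (q powi (- a)) \<cdot>\<^sub>m e
      | K \<Rightarrow> mat_of_rows_list 2 [[q, 0], [0, inverse q]]
      | K_inv \<Rightarrow> mat_of_rows_list 2 [[inverse q, 0], [0, q]])\<rparr>)"

text \<open>The matrix of a tensor product of operators, where $v_i \otimes w_j$ has index
  $i \cdot \dim W + j$.\<close>

definition kronecker :: "complex mat \<Rightarrow> complex mat \<Rightarrow> complex mat" (infixl \<open>\<otimes>\<^sub>m\<close> 70) where
  "A \<otimes>\<^sub>m B = mat (dim_row A * dim_row B) (dim_col A * dim_col B)
    (\<lambda>(i, j). A $$ (i div dim_row B, j div dim_col B) * B $$ (i mod dim_row B, j mod dim_col B))"

text \<open>Each generator \<open>g\<close> acts on the tensor product through its coproduct $\Delta(g)$.\<close>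

definition tensor_rep :: "U_rep \<Rightarrow> U_rep \<Rightarrow> U_rep" where
  "tensor_rep R S = (let \<rho> = rep_mat R; \<sigma> = rep_mat S;
      I = 1\<^sub>m (rep_dim R); J = 1\<^sub>m (rep_dim S)
    in \<lparr>rep_dim = rep_dim R * rep_dim S, rep_mat = (\<lambda>g. case g of
        K \<Rightarrow> \<rho> K \<otimes>\<^sub>m \<sigma> K
      | K_inv \<Rightarrow> \<rho> K_inv \<otimes>\<^sub>m \<sigma> K_inv
      | E0 \<Rightarrow> \<rho> E0 \<otimes>\<^sub>m \<sigma> K_inv + I \<otimes>\<^sub>m \<sigma> E0
      | F0 \<Rightarrow> \<rho> F0 \<otimes>\<^sub>m J + \<rho> K \<otimes>\<^sub>m \<sigma> F0
      | E1 \<Rightarrow> \<rho> E1 \<otimes>\<^sub>m \<sigma> K + I \<otimes>\<^sub>m \<sigma> E1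
      | F1 \<Rightarrow> \<rho> F1 \<otimes>\<^sub>m J + \<rho> K_inv \<otimes>\<^sub>m \<sigma> F1)\<rparr>)"

text \<open>The empty word is the empty tensor product, i.e. the trivial module.\<close>

fun word_rep :: "complex \<Rightarrow> int list \<Rightarrow> U_rep" where
  "word_rep q [] = trivial_rep"
| "word_rep q (a # w) = tensor_rep (eval_rep q a) (word_rep q w)"

definition h_char :: "complex \<Rightarrow> int list \<Rightarrow> nat" where
  "h_char q w = JH_multiplicity q (U_mod_of_rep (word_rep q w)) (U_mod_of_rep trivial_rep)"


section \<open>The combinatorial side\<close>

text \<open>$m_r = \sum_{j\ge 0} (-1)^j\,\#\{i : a_i = r - 1 - 2j\}$, summed over its finite support.\<close>

definition m_num :: "int list \<Rightarrow> int \<Rightarrow> int" where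
  "m_num w r = (\<Sum>j | count_list w (r - 1 - 2 * int j) \<noteq> 0.
    (- 1) ^ j * int (count_list w (r - 1 - 2 * int j)))"

text \<open>Binomial coefficients vanish for a negative lower index.\<close>

definition binom :: "nat \<Rightarrow> int \<Rightarrow> nat" where
  "binom a b = (if b < 0 then 0 else a choose nat b)"

end

theory Submission
  imports Defs
begin

text \<open>
  In a composition series of a word the steps with trivial factor are counted by a sandwich, whose
  middle term is the number of sign sequences \<open>\<epsilon>\<close> such that for every \<open>c\<close> the letters \<open>c\<close> with sign
  \<open>+\<close> are as many as the letters \<open>c - 2\<close> with sign \<open>-\<close>; equivalently, the product of the factors
  $Y_a$ (sign \<open>+\<close>) and $Y_{a+2}^{-1}$ (sign \<open>-\<close>) of the $q$-character is $1$.

  Upper bound: let $A(z), B(z), C(z), D(z)$ be the entries of the monodromy matrix, i.e. of the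
  intertwiner from $V_z \otimes w$ to $w \otimes V_z$. The intertwining relations and the quantum determinant express
  the coefficients of $A(z)$ recursively by $U$, so that they preserve all submodules and act on
  trivial factors by the solution \<open>\<alpha>\<close> of $\alpha(z)\alpha(q^2z) = \mathrm{qdet}(z)$. Since $A(z)$ is
  triangular with explicit diagonal entries indexed by sign sequences, there are at most as many
  trivial factors as diagonal entries equal to \<open>\<alpha>\<close>, and these are the sequences above.

  Lower bound: exchanging letters does not change the composition factors, and for the evaluation
  module $I_{a,k}$ of the string $a, a+2, \dots, a+2(k-1)$ there is an exact sequence
  $0 \to I_{a,k-1} \to I_{a,k} \otimes V_{a+2k} \to I_{a,k+1} \to 0$. Starting with the smallest letter,
  this is applied until no letter $a+2k$ is left. The number of sign sequences completing the
  lowest monomial of $I_{a,k}$ to $1$ satisfies the same recursion, and it is $0$ if $k > 0$ and no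
  letter $a+2k$ is left.
\<close>

section \<open>Chains of invariant subspaces\<close>

text \<open>Both bounds hold for every simple series. Their agreement therefore also shows that all
  series give the same count, which is what the definite description in
  \<open>JH_multiplicity\<close> requires.

  Balanced signs arise as follows. On a trivial factor the off-diagonal entries of the monodromy
  matrix act by 0 and D(z) acts as A(z), so the quantum determinant, A(z) D(q^2 z) minus the product
  of the off-diagonal entries, becomes alpha(z) alpha(q^2 z). A diagonal entry of A(z) is a product
  of linear factors, one for each letter. If it equals alpha, unique factorisation gives an identity
  of multisets of exponents, and this identity says only that the defect of the balance at c has
  period 2 in c. Finitely many letters force the defect to be 0.

  The smallest letter a comes first because a sign + there would have to be matched by a sign - at a
  letter a - 2. Hence only - contributes, and it opens a string. From then on the signs + and - at a
  letter a + 2k shorten and lengthen the string by one, exactly as the two ends of the exact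
  sequence do.\<close>

definition subsp :: "('i \<Rightarrow> complex) set \<Rightarrow> bool" where
  "subsp S \<longleftrightarrow> (\<lambda>_. 0) \<in> S \<and> (\<forall>f\<in>S. \<forall>g\<in>S. (\<lambda>i. f i + g i) \<in> S) \<and> (\<forall>c. \<forall>f\<in>S. (\<lambda>i. c * f i) \<in> S)"

definition linear_op :: "(('i \<Rightarrow> complex) \<Rightarrow> 'j \<Rightarrow> complex) \<Rightarrow> bool" where
  "linear_op T \<longleftrightarrow> (\<forall>f g. T (\<lambda>i. f i + g i) = (\<lambda>i. T f i + T g i)) \<and> (\<forall>c f. T (\<lambda>i. c * f i) = (\<lambda>i. c * T f i))"

text \<open>The index type of the operators is left open because these notions are applied both to
  the generators of U and to the family of coefficients of A(z).\<close>

definition inv_subsp :: "('g \<Rightarrow> ('i \<Rightarrow> complex) \<Rightarrow> 'i \<Rightarrow> complex) \<Rightarrow> ('i \<Rightarrow> complex) set \<Rightarrow> bool" where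
  "inv_subsp \<rho> S \<longleftrightarrow> subsp S \<and> (\<forall>g. \<forall>f\<in>S. \<rho> g f \<in> S)"

text \<open>The quotient S'/S may have any positive dimension. Images and preimages of such a step
  under a homomorphism are then again such steps as soon as they are strict.\<close>

definition char_step ::
    "('g \<Rightarrow> ('i \<Rightarrow> complex) \<Rightarrow> 'i \<Rightarrow> complex) \<Rightarrow> ('g \<Rightarrow> complex) \<Rightarrow> ('i \<Rightarrow> complex) set \<Rightarrow> ('i \<Rightarrow> complex) set \<Rightarrow> bool" where
  "char_step \<rho> \<epsilon> S S' \<longleftrightarrow> S \<subset> S' \<and> (\<forall>g. \<forall>f\<in>S'. (\<lambda>i. \<rho> g f i - \<epsilon> g * f i) \<in> S)"

definition simple_step ::
    "('g \<Rightarrow> ('i \<Rightarrow> complex) \<Rightarrow> 'i \<Rightarrow> complex) \<Rightarrow> ('i \<Rightarrow> complex) set \<Rightarrow> ('i \<Rightarrow> complex) set \<Rightarrow> bool" where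
  "simple_step \<rho> S S' \<longleftrightarrow> S \<subset> S' \<and> (\<forall>R. inv_subsp \<rho> R \<and> S \<subseteq> R \<and> R \<subseteq> S' \<longrightarrow> R = S \<or> R = S')"

text \<open>A chain of invariant subspaces with t marked steps on which the operators act by the
  character \<epsilon>; all other inclusions are unrestricted. Such chains can be concatenated and
  moved along homomorphisms without refining them to simple series.\<close>

inductive reach ::
    "('g \<Rightarrow> ('i \<Rightarrow> complex) \<Rightarrow> 'i \<Rightarrow> complex) \<Rightarrow> ('g \<Rightarrow> complex) \<Rightarrow> ('i \<Rightarrow> complex) set \<Rightarrow> ('i \<Rightarrow> complex) set \<Rightarrow> nat \<Rightarrow> bool"
  for \<rho> \<epsilon> S\<^sub>0 where
  start: "inv_subsp \<rho> S\<^sub>0 \<Longrightarrow> reach \<rho> \<epsilon> S\<^sub>0 S\<^sub>0 0"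
| widen: "reach \<rho> \<epsilon> S\<^sub>0 S t \<Longrightarrow> inv_subsp \<rho> S' \<Longrightarrow> S \<subseteq> S' \<Longrightarrow> reach \<rho> \<epsilon> S\<^sub>0 S' t"
| step: "reach \<rho> \<epsilon> S\<^sub>0 S t \<Longrightarrow> inv_subsp \<rho> S' \<Longrightarrow> char_step \<rho> \<epsilon> S S' \<Longrightarrow> reach \<rho> \<epsilon> S\<^sub>0 S' (Suc t)"

lemma subsp_zero: "subsp S \<Longrightarrow> (\<lambda>_. 0) \<in> S"
  and subsp_add: "subsp S \<Longrightarrow> f \<in> S \<Longrightarrow> g \<in> S \<Longrightarrow> (\<lambda>i. f i + g i) \<in> S"
  and subsp_scale: "subsp S \<Longrightarrow> f \<in> S \<Longrightarrow> (\<lambda>i. c * f i) \<in> S"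
  by (auto simp: subsp_def)

lemma subsp_diff: "subsp S \<Longrightarrow> f \<in> S \<Longrightarrow> g \<in> S \<Longrightarrow> (\<lambda>i. f i - g i) \<in> S"
  using subsp_add[of S f "\<lambda>i. (-1) * g i"] subsp_scale[of S g "-1"] by simp

lemma subsp_diff_scale: "subsp S \<Longrightarrow> f \<in> S \<Longrightarrow> g \<in> S \<Longrightarrow> (\<lambda>i. f i - c * g i) \<in> S"
  by (intro subsp_diff subsp_scale)

lemma linear_op_add: "linear_op T \<Longrightarrow> T (\<lambda>i. f i + g i) = (\<lambda>i. T f i + T g i)"
  and linear_op_scale: "linear_op T \<Longrightarrow> T (\<lambda>i. c * f i) = (\<lambda>i. c * T f i)"
  by (auto simp: linear_op_def)

lemma linear_op_zero: "linear_op T \<Longrightarrow> T (\<lambda>_. 0) = (\<lambda>_. 0)"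
  using linear_op_scale[of T 0 "\<lambda>_. 0"] by simp

lemma linear_op_diff: "linear_op T \<Longrightarrow> T (\<lambda>i. f i - g i) = (\<lambda>i. T f i - T g i)"
  using linear_op_add[of T f "\<lambda>i. (-1) * g i"] linear_op_scale[of T "-1" g] by simp

lemma inv_subsp_subsp: "inv_subsp \<rho> S \<Longrightarrow> subsp S"
  and inv_subsp_act: "inv_subsp \<rho> S \<Longrightarrow> f \<in> S \<Longrightarrow> \<rho> g f \<in> S"
  by (auto simp: inv_subsp_def)

lemma inv_subsp_Int: "inv_subsp \<rho> S \<Longrightarrow> inv_subsp \<rho> T \<Longrightarrow> inv_subsp \<rho> (S \<inter> T)"
  by (auto simp: inv_subsp_def subsp_def)

definition ssum :: "('i \<Rightarrow> complex) set \<Rightarrow> ('i \<Rightarrow> complex) set \<Rightarrow> ('i \<Rightarrow> complex) set" where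
  "ssum S T = {(\<lambda>i. f i + g i) | f g. f \<in> S \<and> g \<in> T}"

lemma ssumI: "f \<in> S \<Longrightarrow> g \<in> T \<Longrightarrow> h = (\<lambda>i. f i + g i) \<Longrightarrow> h \<in> ssum S T"
  by (auto simp: ssum_def)

lemma ssumE:
  assumes "h \<in> ssum S T" obtains f g where "h = (\<lambda>i. f i + g i)" "f \<in> S" "g \<in> T"
  using assms by (auto simp: ssum_def)

lemma inv_subsp_ssum:
  assumes S: "inv_subsp \<rho> S" and T: "inv_subsp \<rho> T" and lin: "\<And>g. linear_op (\<rho> g)"
  shows "inv_subsp \<rho> (ssum S T)"
  unfolding inv_subsp_def subsp_def
proof (intro conjI allI ballI)
  note s = inv_subsp_subsp[OF S] inv_subsp_subsp[OF T]
  show "(\<lambda>_. 0) \<in> ssum S T"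
    by (rule ssumI[OF s[THEN subsp_zero]]) simp
  fix f assume "f \<in> ssum S T"
  then obtain a b where f: "f = (\<lambda>i. a i + b i)" "a \<in> S" "b \<in> T" by (rule ssumE)
  show "(\<lambda>i. c * f i) \<in> ssum S T" for c
    by (rule ssumI[OF subsp_scale[OF s(1) f(2), of c] subsp_scale[OF s(2) f(3), of c]])
      (simp add: f algebra_simps)
  show "\<rho> g f \<in> ssum S T" for g
    by (rule ssumI[OF inv_subsp_act[OF S f(2)] inv_subsp_act[OF T f(3)]]) (simp add: f linear_op_add[OF lin])
  fix g assume "g \<in> ssum S T"
  then obtain c d where g: "g = (\<lambda>i. c i + d i)" "c \<in> S" "d \<in> T" by (rule ssumE)
  show "(\<lambda>i. f i + g i) \<in> ssum S T"
    by (rule ssumI[OF subsp_add[OF s(1) f(2) g(2)] subsp_add[OF s(2) f(3) g(3)]]) (simp add: f g add_ac)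
qed

lemma ssum_upper1: "subsp T \<Longrightarrow> S \<subseteq> ssum S T"
  by (force simp: ssum_def dest: subsp_zero intro: exI[of _ "\<lambda>_. 0"])

lemma ssum_upper2: "subsp S \<Longrightarrow> T \<subseteq> ssum S T"
  by (force simp: ssum_def dest: subsp_zero intro: exI[of _ "\<lambda>_. 0"])

lemma ssum_least: "subsp R \<Longrightarrow> S \<subseteq> R \<Longrightarrow> T \<subseteq> R \<Longrightarrow> ssum S T \<subseteq> R"
  unfolding ssum_def by (auto intro!: subsp_add)

lemma reach_inv_subsp: "reach \<rho> \<epsilon> S\<^sub>0 S t \<Longrightarrow> inv_subsp \<rho> S"
  by (induction rule: reach.induct) auto

lemma reach_trans: "reach \<rho> \<epsilon> S\<^sub>1 S\<^sub>2 u \<Longrightarrow> reach \<rho> \<epsilon> S\<^sub>0 S\<^sub>1 t \<Longrightarrow> reach \<rho> \<epsilon> S\<^sub>0 S\<^sub>2 (t + u)"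
  by (induction rule: reach.induct) (auto intro: reach.intros)

lemma subsp_zero_singleton: "subsp {\<lambda>_. 0}"
  by (auto simp: subsp_def)

text \<open>Zassenhaus' argument: a character step of one chain is reflected in exactly one step of the
  other chain, which by simplicity is a step with the same character.\<close>

lemma reach_le_simple_series:
  assumes lin: "\<And>g. linear_op (\<rho> g)"
    and D0: "D 0 = {\<lambda>_. 0}"
    and stab: "\<And>i. i \<le> r \<Longrightarrow> inv_subsp \<rho> (D i)"
    and simp: "\<And>i. i < r \<Longrightarrow> simple_step \<rho> (D i) (D (Suc i))"
    and reach: "reach \<rho> \<epsilon> {\<lambda>_. 0} S t" and "S \<subseteq> D r"
  shows "t \<le> card {i. i < r \<and> char_step \<rho> \<epsilon> (D i) (D (Suc i))}"
proof -
  \<comment> \<open>The factors D (Suc i) / D i with the required character to which S contributes.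
    It suffices that each marked step of the chain adds an index to this set.\<close>
  define P where "P S = {i. i < r \<and> char_step \<rho> \<epsilon> (D i) (D (Suc i)) \<and> \<not> S \<inter> D (Suc i) \<subseteq> D i}" for S
  have fin: "finite (P S)" for S by (auto simp: P_def)
  have "t \<le> card (P S)" using reach \<open>S \<subseteq> D r\<close>
  proof (induction rule: reach.induct)
    case start
    then show ?case by simp
  next
    case (widen S t S')
    have "P S \<subseteq> P S'" using widen(3) by (auto simp: P_def)
    then have "card (P S) \<le> card (P S')" by (rule card_mono[OF fin])
    then show ?case using widen.IH widen.hyps(3) widen.prems by (meson order_trans)
  next
    case (step S t S')
    have S: "inv_subsp \<rho> S" "inv_subsp \<rho> S'" and SS: "S \<subset> S'"
      using reach_inv_subsp[OF step(1)] step(2,3) by (auto simp: char_step_def)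
    have "S' \<inter> D r \<subseteq> S'" "\<not> S' \<inter> D r \<subseteq> S" using SS step.prems by auto
    \<comment> \<open>The first member of the series that meets S' outside S. Below it S' has
      nothing beyond S, so the new contribution appears at i = j - 1.\<close>
    define j where "j = (LEAST j. \<not> S' \<inter> D j \<subseteq> S)"
    have j: "\<not> S' \<inter> D j \<subseteq> S" unfolding j_def by (rule LeastI[of _ r]) fact
    have "j \<le> r" unfolding j_def by (rule Least_le) fact
    have "j \<noteq> 0" using j D0 subsp_zero[OF inv_subsp_subsp[OF S(1)]] by (metis Int_lower2 empty_subsetI insert_subset subset_trans)
    then obtain i where i: "j = Suc i" by (cases j) auto
    have "i < r" using \<open>j \<le> r\<close> i by simp
    have small: "S' \<inter> D i \<subseteq> S"
      using not_less_Least[of i "\<lambda>j. \<not> S' \<inter> D j \<subseteq> S"] i j_def by auto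
    obtain x where x: "x \<in> S'" "x \<in> D (Suc i)" "x \<notin> S" using j i by auto
    have st: "inv_subsp \<rho> (D i)" "inv_subsp \<rho> (D (Suc i))" using stab \<open>i < r\<close> by auto
    have sp: "simple_step \<rho> (D i) (D (Suc i))" by (rule simp[OF \<open>i < r\<close>])
    then have sub: "D i \<subset> D (Suc i)" by (simp add: simple_step_def)
    \<comment> \<open>By simplicity D i plus the trace of an invariant T can only be one of the two
      ends. For T = S it will be the lower one, for T = S' the upper one.\<close>
    have A: "R = D i \<or> R = D (Suc i)" if "R = ssum (D i) (T \<inter> D (Suc i))" "inv_subsp \<rho> T" for T R
    proof -
      have "inv_subsp \<rho> R" unfolding that(1)
        by (intro inv_subsp_ssum inv_subsp_Int st that lin)
      moreover have "D i \<subseteq> R" unfolding that(1)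
        by (intro ssum_upper1 inv_subsp_subsp[OF inv_subsp_Int[OF that(2) st(2)]])
      moreover have "R \<subseteq> D (Suc i)" unfolding that(1)
        using sub by (intro ssum_least) (auto intro: inv_subsp_subsp st)
      ultimately show ?thesis using sp by (auto simp: simple_step_def)
    qed
    have "x \<notin> ssum (D i) (S \<inter> D (Suc i))"
    proof
      assume "x \<in> ssum (D i) (S \<inter> D (Suc i))"
      then obtain d w where dw: "x = (\<lambda>i. d i + w i)" "d \<in> D i" "w \<in> S" by (auto simp: ssum_def)
      have "d = (\<lambda>i. x i - w i)" by (simp add: dw)
      also have "\<dots> \<in> S'" using x dw SS by (intro subsp_diff inv_subsp_subsp[OF S(2)]) auto
      finally have "d \<in> S" using small dw by auto
      then have "x \<in> S" unfolding dw(1) using dw by (intro subsp_add inv_subsp_subsp[OF S(1)]) auto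
      then show False using x by simp
    qed
    then have "ssum (D i) (S \<inter> D (Suc i)) = D i" using A[OF refl S(1)] x by auto
    then have low: "S \<inter> D (Suc i) \<subseteq> D i" using ssum_upper2[OF inv_subsp_subsp[OF st(1)]] by blast
    have "x \<notin> D i" using small x by auto
    moreover have "x \<in> ssum (D i) (S' \<inter> D (Suc i))"
      using ssum_upper2[OF inv_subsp_subsp[OF st(1)], of "S' \<inter> D (Suc i)"] x by auto
    ultimately have top: "ssum (D i) (S' \<inter> D (Suc i)) = D (Suc i)" using A[OF refl S(2)] by auto
    have "char_step \<rho> \<epsilon> (D i) (D (Suc i))" unfolding char_step_def
    proof (intro conjI allI ballI sub)
      fix g f assume "f \<in> D (Suc i)"
      then have "f \<in> ssum (D i) (S' \<inter> D (Suc i))" by (simp only: top)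
      then obtain d w where dw: "f = (\<lambda>i. d i + w i)" "d \<in> D i" "w \<in> S'" "w \<in> D (Suc i)"
        by (auto simp: ssum_def)
      \<comment> \<open>This element lies in S and in D (Suc i), hence in D i by \<open>low\<close>;
        the summand d stays in D i by invariance.\<close>
      have "(\<lambda>i. \<rho> g w i - \<epsilon> g * w i) \<in> S" using step(3) dw by (auto simp: char_step_def)
      moreover have "(\<lambda>i. \<rho> g w i - \<epsilon> g * w i) \<in> D (Suc i)"
        by (rule subsp_diff_scale[OF inv_subsp_subsp[OF st(2)] inv_subsp_act[OF st(2) dw(4)] dw(4)])
      ultimately have w: "(\<lambda>i. \<rho> g w i - \<epsilon> g * w i) \<in> D i" using low by auto
      have d: "(\<lambda>i. \<rho> g d i - \<epsilon> g * d i) \<in> D i"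
        by (rule subsp_diff_scale[OF inv_subsp_subsp[OF st(1)] inv_subsp_act[OF st(1) dw(2)] dw(2)])
      have "(\<lambda>i. \<rho> g f i - \<epsilon> g * f i) = (\<lambda>i. (\<rho> g d i - \<epsilon> g * d i) + (\<rho> g w i - \<epsilon> g * w i))"
        by (auto simp: dw(1) linear_op_add[OF lin] algebra_simps)
      then show "(\<lambda>i. \<rho> g f i - \<epsilon> g * f i) \<in> D i"
        using subsp_add[OF inv_subsp_subsp[OF st(1)] d w] by simp
    qed
    then have "i \<in> P S'" using x \<open>i < r\<close> \<open>x \<notin> D i\<close> by (auto simp: P_def)
    moreover have "i \<notin> P S" using low by (auto simp: P_def)
    moreover have "P S \<subseteq> P S'" using SS by (auto simp: P_def)
    ultimately have "card (P S) < card (P S')" by (intro psubset_card_mono fin) auto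
    moreover have "t \<le> card (P S)" using step.IH step.prems SS by auto
    ultimately show ?case by simp
  qed
  also have "\<dots> \<le> card {i. i < r \<and> char_step \<rho> \<epsilon> (D i) (D (Suc i))}"
    by (rule card_mono) (auto simp: P_def)
  finally show ?thesis .
qed

text \<open>A series is itself a chain: its character steps are marked, the others enter through
  \<open>widen\<close>. In this form a composition series is fed into the upper bound.\<close>

lemma reach_of_series:
  assumes "D 0 = {\<lambda>_. 0}" and "\<And>i. i \<le> r \<Longrightarrow> inv_subsp \<rho> (D i)"
    and "\<And>i. i < r \<Longrightarrow> D i \<subseteq> D (Suc i)"
  shows "reach \<rho> \<epsilon> {\<lambda>_. 0} (D r) (card {i. i < r \<and> char_step \<rho> \<epsilon> (D i) (D (Suc i))})"
  using assms
proof (induction r)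
  case 0
  moreover have "inv_subsp \<rho> (D 0)" using 0(2) by blast
  ultimately show ?case using reach.start[of \<rho> "D 0" \<epsilon>] by simp
next
  case (Suc r)
  let ?P = "\<lambda>i. char_step \<rho> \<epsilon> (D i) (D (Suc i))"
  have IH: "reach \<rho> \<epsilon> {\<lambda>_. 0} (D r) (card {i. i < r \<and> ?P i})" using Suc by simp
  show ?case
  proof (cases "?P r")
    case True
    then have "{i. i < Suc r \<and> ?P i} = insert r {i. i < r \<and> ?P i}" by (auto simp: less_Suc_eq)
    then show ?thesis using reach.step[OF IH _ True] Suc.prems by simp
  next
    case False
    then have "{i. i < Suc r \<and> ?P i} = {i. i < r \<and> ?P i}" by (auto simp: less_Suc_eq)
    then show ?thesis using reach.widen[OF IH] Suc.prems by simp
  qed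
qed

section \<open>Coordinate flags and the existence of simple series\<close>

definition flag :: "('i \<Rightarrow> nat) \<Rightarrow> 'i set \<Rightarrow> nat \<Rightarrow> ('i \<Rightarrow> complex) set" where
  "flag idx I j = {f. \<forall>i. f i \<noteq> 0 \<longrightarrow> i \<in> I \<and> idx i < j}"

lemma subsp_flag: "subsp (flag idx I j)"
  unfolding subsp_def
proof (intro conjI ballI allI)
  fix f g assume fg: "f \<in> flag idx I j" "g \<in> flag idx I j"
  show "(\<lambda>i. f i + g i) \<in> flag idx I j" unfolding flag_def mem_Collect_eq
  proof (intro allI impI)
    fix i assume "f i + g i \<noteq> 0"
    then have "f i \<noteq> 0 \<or> g i \<noteq> 0" by auto
    then show "i \<in> I \<and> idx i < j" using fg by (auto simp: flag_def)
  qed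
qed (auto simp: flag_def)

lemma flag_mono: "j \<le> k \<Longrightarrow> flag idx I j \<subseteq> flag idx I k"
  by (fastforce simp: flag_def)

lemma flag_0: "flag idx I 0 = {\<lambda>_. 0}"
  by (auto simp: flag_def)

lemma flag_codim1:
  assumes idx: "bij_betw idx I {..<N}" and "j < N"
    and f: "f \<in> flag idx I (Suc j)" "f \<notin> flag idx I j" and g: "g \<in> flag idx I (Suc j)"
  obtains c where "(\<lambda>i. g i - c * f i) \<in> flag idx I j"
proof -
  obtain k where k: "f k \<noteq> 0" "k \<in> I" "idx k = j"
    using f by (auto simp: flag_def less_Suc_eq)
  have uniq: "i = k" if "i \<in> I" "idx i = j" for i
    using idx k that by (auto simp: bij_betw_def inj_on_def)
  have "(\<lambda>i. g i - g k / f k * f i) \<in> flag idx I j"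
    unfolding flag_def mem_Collect_eq
  proof (intro allI impI)
    fix i assume i: "g i - g k / f k * f i \<noteq> 0"
    then have "f i \<noteq> 0 \<or> g i \<noteq> 0" by auto
    then have "i \<in> I" "idx i < Suc j" using f(1) g by (auto simp: flag_def)
    moreover have "i \<noteq> k" using i k by auto
    ultimately show "i \<in> I \<and> idx i < j" using uniq by (auto simp: less_Suc_eq)
  qed
  then show ?thesis by (rule that)
qed

text \<open>A step of codimension one admits no subspace strictly in between. The coordinate flag
  can thus serve as a simple series for the coefficients of A(z).\<close>

lemma flag_simple_step:
  assumes idx: "bij_betw idx I {..<N}" and "j < N"
  shows "simple_step \<rho> (flag idx I j) (flag idx I (Suc j))"
  unfolding simple_step_def
proof (intro conjI allI impI)
  obtain k where k: "k \<in> I" "idx k = j" using assms by (metis bij_betw_iff_bijections lessThan_iff)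
  have "(\<lambda>i. if i = k then 1 else 0) \<in> flag idx I (Suc j)" "(\<lambda>i. if i = k then 1 else 0) \<notin> flag idx I j"
    using k by (auto simp: flag_def)
  then show "flag idx I j \<subset> flag idx I (Suc j)" using flag_mono[of j "Suc j" idx I] by auto
  fix R assume R: "inv_subsp \<rho> R \<and> flag idx I j \<subseteq> R \<and> R \<subseteq> flag idx I (Suc j)"
  show "R = flag idx I j \<or> R = flag idx I (Suc j)"
  proof (cases "R \<subseteq> flag idx I j")
    case False
    then obtain f where f: "f \<in> R" "f \<notin> flag idx I j" by auto
    have "flag idx I (Suc j) \<subseteq> R"
    proof
      fix g assume g: "g \<in> flag idx I (Suc j)"
      obtain c where "(\<lambda>i. g i - c * f i) \<in> flag idx I j"
        by (rule flag_codim1[OF idx \<open>j < N\<close> _ _ g, of f]) (use f R in auto)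
      then have "(\<lambda>i. (g i - c * f i) + c * f i) \<in> R"
        using R f by (intro subsp_add subsp_scale) (auto simp: inv_subsp_def)
      then show "g \<in> R" by simp
    qed
    then show ?thesis using R by auto
  qed (use R in auto)
qed

text \<open>Leading positions of the elements of S, as in an echelon form. For S inside the flag
  their number is the dimension of S; it is used only through its strict growth in S.\<close>

definition pivots :: "('i \<Rightarrow> nat) \<Rightarrow> 'i set \<Rightarrow> nat \<Rightarrow> ('i \<Rightarrow> complex) set \<Rightarrow> nat set" where
  "pivots idx I N S = {j. j < N \<and> \<not> S \<inter> flag idx I (Suc j) \<subseteq> flag idx I j}"

text \<open>If S and S' had the same pivots, every element of S' could be reduced to 0 by
  subtracting multiples of elements of S with the same leading position, so S' would be contained in
  S.\<close>

lemma card_pivots_less: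
  assumes idx: "bij_betw idx I {..<N}" and S: "subsp S" "subsp S'" "S \<subset> S'" "S' \<subseteq> flag idx I N"
  shows "card (pivots idx I N S) < card (pivots idx I N S')"
proof (intro psubset_card_mono psubsetI)
  show "finite (pivots idx I N S')" by (simp add: pivots_def)
  show "pivots idx I N S \<subseteq> pivots idx I N S'" using S by (auto simp: pivots_def)
  show "pivots idx I N S \<noteq> pivots idx I N S'"
  proof
    assume eq: "pivots idx I N S = pivots idx I N S'"
    have "j \<le> N \<Longrightarrow> S' \<inter> flag idx I j \<subseteq> S" for j
    proof (induction j)
      case 0
      then show ?case using S subsp_zero by (auto simp: flag_0)
    next
      case (Suc j)
      show ?case
      proof
        fix f assume f: "f \<in> S' \<inter> flag idx I (Suc j)"
        show "f \<in> S"
        proof (cases "f \<in> flag idx I j")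
          case False
          then have "j \<in> pivots idx I N S" unfolding eq using f Suc.prems by (auto simp: pivots_def)
          then obtain s where s: "s \<in> S" "s \<in> flag idx I (Suc j)" "s \<notin> flag idx I j" by (auto simp: pivots_def)
          obtain c where c: "(\<lambda>i. f i - c * s i) \<in> flag idx I j"
            by (rule flag_codim1[OF idx _ s(2,3), of f]) (use f Suc.prems in auto)
          moreover have "(\<lambda>i. f i - c * s i) \<in> S'"
            using S s f by (intro subsp_diff subsp_scale) auto
          ultimately have "(\<lambda>i. f i - c * s i) \<in> S" using Suc by auto
          then have "(\<lambda>i. (f i - c * s i) + c * s i) \<in> S" using S s by (intro subsp_add subsp_scale)
          then show ?thesis by simp
        qed (use f Suc in auto)
      qed
    qed
    from this[of N] S show False by auto
  qed
qed

text \<open>Above S one chooses a strictly larger invariant subspace with the fewest pivots;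
  anything strictly in between would have fewer. The number of pivots still missing bounds the
  recursion.\<close>

lemma simple_series_exists:
  assumes idx: "bij_betw idx I {..<N}" and X: "inv_subsp \<rho> X" "X \<subseteq> flag idx I N"
    and S: "inv_subsp \<rho> S" "S \<subseteq> X"
  shows "\<exists>Ds. Ds \<noteq> [] \<and> hd Ds = S \<and> last Ds = X \<and> (\<forall>D\<in>set Ds. inv_subsp \<rho> D \<and> D \<subseteq> X) \<and>
    (\<forall>i. Suc i < length Ds \<longrightarrow> simple_step \<rho> (Ds ! i) (Ds ! Suc i))"
  using S
proof (induction "card (pivots idx I N X) - card (pivots idx I N S)" arbitrary: S rule: less_induct)
  case less
  show ?case
  proof (cases "S = X")
    case True
    then show ?thesis using less.prems by (intro exI[of _ "[S]"]) auto
  next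
    case False
    let ?\<mu> = "\<lambda>S. card (pivots idx I N S)"
    let ?Q = "\<lambda>R. inv_subsp \<rho> R \<and> S \<subset> R \<and> R \<subseteq> X"
    have "?Q X" using False less.prems X by auto
    then obtain R where R: "?Q R" and min: "\<And>R'. ?Q R' \<Longrightarrow> ?\<mu> R \<le> ?\<mu> R'"
      using ex_has_least_nat[of ?Q X ?\<mu>] by auto
    have lt: "?\<mu> A < ?\<mu> B" if "inv_subsp \<rho> A" "inv_subsp \<rho> B" "A \<subset> B" "B \<subseteq> X" for A B
      using that X by (intro card_pivots_less[OF idx]) (auto intro: inv_subsp_subsp)
    have "simple_step \<rho> S R" unfolding simple_step_def
    proof (intro conjI allI impI)
      show "S \<subset> R" using R by simp
      fix T assume T: "inv_subsp \<rho> T \<and> S \<subseteq> T \<and> T \<subseteq> R"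
      show "T = S \<or> T = R"
      proof (rule ccontr)
        assume "\<not> ?thesis"
        then have "?Q T" "T \<subset> R" using T R by auto
        then show False using min[of T] lt[of T R] R by auto
      qed
    qed
    have l1: "?\<mu> S < ?\<mu> R" using less.prems R by (intro lt) auto
    moreover have "?\<mu> R \<le> ?\<mu> X"
    proof (cases "R = X")
      case False
      then have "?\<mu> R < ?\<mu> X" using R X by (intro lt) auto
      then show ?thesis by simp
    qed simp
    ultimately have "?\<mu> X - ?\<mu> R < ?\<mu> X - ?\<mu> S" by simp
    from less.hyps[OF this] R obtain Ds where Ds: "Ds \<noteq> []" "hd Ds = R" "last Ds = X"
      "\<forall>D\<in>set Ds. inv_subsp \<rho> D \<and> D \<subseteq> X" "\<forall>i. Suc i < length Ds \<longrightarrow> simple_step \<rho> (Ds ! i) (Ds ! Suc i)"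
      by auto
    have "simple_step \<rho> ((S # Ds) ! i) ((S # Ds) ! Suc i)" if "Suc i < length (S # Ds)" for i
      using that Ds \<open>simple_step \<rho> S R\<close> by (cases i) (auto simp: hd_conv_nth)
    then show ?thesis using Ds less.prems by (intro exI[of _ "S # Ds"]) auto
  qed
qed


section \<open>Words as modules\<close>

text \<open>Tensor products are modelled by functions on lists of signs, where \<open>False\<close> stands for $v_+$ and
  \<open>True\<close> for $v_-$. The action is defined on all functions; the module of a word of length
  \<open>n\<close> consists of the functions supported on lists of length \<open>n\<close>.\<close>

definition tens :: "complex \<Rightarrow> complex \<Rightarrow> (U_gen \<Rightarrow> (bool list \<Rightarrow> complex) \<Rightarrow> bool list \<Rightarrow> complex) \<Rightarrow>
    U_gen \<Rightarrow> (bool list \<Rightarrow> complex) \<Rightarrow> bool list \<Rightarrow> complex" where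
  "tens q x \<rho> g f l = (case l of [] \<Rightarrow> if g = K \<or> g = K_inv then f [] else 0
    | b # l \<Rightarrow> (case g of
        K \<Rightarrow> (if b then inverse q else q) * \<rho> K (\<lambda>l. f (b # l)) l
      | K_inv \<Rightarrow> (if b then q else inverse q) * \<rho> K_inv (\<lambda>l. f (b # l)) l
      | E1 \<Rightarrow> \<rho> E1 (\<lambda>l. f (b # l)) l + (if b then 0 else \<rho> K (\<lambda>l. f (True # l)) l)
      | F1 \<Rightarrow> (if b then q else inverse q) * \<rho> F1 (\<lambda>l. f (b # l)) l + (if b then f (False # l) else 0)
      | E0 \<Rightarrow> \<rho> E0 (\<lambda>l. f (b # l)) l + (if b then x * \<rho> K_inv (\<lambda>l. f (False # l)) l else 0)
      | F0 \<Rightarrow> (if b then inverse q else q) * \<rho> F0 (\<lambda>l. f (b # l)) l + (if b then 0 else inverse x * f (True # l))))"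

fun wact :: "complex \<Rightarrow> int list \<Rightarrow> U_gen \<Rightarrow> (bool list \<Rightarrow> complex) \<Rightarrow> bool list \<Rightarrow> complex" where
  "wact q [] g f = (if g = K \<or> g = K_inv then f else (\<lambda>_. 0))"
| "wact q (a # w) g f = tens q (q powi a) (wact q w) g f"

lemma tens_simps:
  "tens q x \<rho> E0 f [] = 0" "tens q x \<rho> E1 f [] = 0" "tens q x \<rho> F0 f [] = 0" "tens q x \<rho> F1 f [] = 0"
  "tens q x \<rho> K f [] = f []" "tens q x \<rho> K_inv f [] = f []"
  "tens q x \<rho> K f (False # l) = q * \<rho> K (\<lambda>l. f (False # l)) l"
  "tens q x \<rho> K f (True # l) = inverse q * \<rho> K (\<lambda>l. f (True # l)) l"
  "tens q x \<rho> K_inv f (False # l) = inverse q * \<rho> K_inv (\<lambda>l. f (False # l)) l"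
  "tens q x \<rho> K_inv f (True # l) = q * \<rho> K_inv (\<lambda>l. f (True # l)) l"
  "tens q x \<rho> E1 f (False # l) = \<rho> E1 (\<lambda>l. f (False # l)) l + \<rho> K (\<lambda>l. f (True # l)) l"
  "tens q x \<rho> E1 f (True # l) = \<rho> E1 (\<lambda>l. f (True # l)) l"
  "tens q x \<rho> F1 f (False # l) = inverse q * \<rho> F1 (\<lambda>l. f (False # l)) l"
  "tens q x \<rho> F1 f (True # l) = q * \<rho> F1 (\<lambda>l. f (True # l)) l + f (False # l)"
  "tens q x \<rho> E0 f (False # l) = \<rho> E0 (\<lambda>l. f (False # l)) l"
  "tens q x \<rho> E0 f (True # l) = \<rho> E0 (\<lambda>l. f (True # l)) l + x * \<rho> K_inv (\<lambda>l. f (False # l)) l"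
  "tens q x \<rho> F0 f (False # l) = q * \<rho> F0 (\<lambda>l. f (False # l)) l + inverse x * f (True # l)"
  "tens q x \<rho> F0 f (True # l) = inverse q * \<rho> F0 (\<lambda>l. f (True # l)) l"
  by (simp_all add: tens_def)

lemma linear_op_tens:
  assumes "\<And>g. linear_op (\<rho> g)"
  shows "linear_op (tens q x \<rho> g)"
  unfolding linear_op_def
proof (intro conjI allI ext)
  fix f h l
  show "tens q x \<rho> g (\<lambda>i. f i + h i) l = tens q x \<rho> g f l + tens q x \<rho> g h l"
    by (cases l; cases g; cases "hd l") (simp_all add: tens_simps linear_op_add[OF assms] algebra_simps)
next
  fix c f l
  show "tens q x \<rho> g (\<lambda>i. c * f i) l = c * tens q x \<rho> g f l"
    by (cases l; cases g; cases "hd l") (simp_all add: tens_simps linear_op_scale[OF assms] algebra_simps)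
qed

lemma linear_op_wact: "linear_op (wact q w g)"
proof (induction w arbitrary: g)
  case Nil
  then show ?case by (auto simp: linear_op_def)
next
  case (Cons a w)
  have "wact q (a # w) g = tens q (q powi a) (wact q w) g" by (rule ext) simp
  then show ?case using linear_op_tens[OF Cons] by simp
qed

text \<open>The relations are oriented as rewrite rules for words in the generators: K and
  \<open>K_inv\<close> move to the left, F moves to the left of E, and the Serre relations eliminate
  \<open>a a a b\<close>.\<close>

definition U_rels :: "complex \<Rightarrow> (U_gen \<Rightarrow> ('i \<Rightarrow> complex) \<Rightarrow> 'i \<Rightarrow> complex) \<Rightarrow> bool" where
  "U_rels q \<rho> \<longleftrightarrow> (\<forall>f. \<rho> K (\<rho> K_inv f) = f \<and> \<rho> K_inv (\<rho> K f) = f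
    \<and> \<rho> E1 (\<rho> K f) = (\<lambda>l. inverse (q^2) * \<rho> K (\<rho> E1 f) l)
    \<and> \<rho> F1 (\<rho> K f) = (\<lambda>l. q^2 * \<rho> K (\<rho> F1 f) l)
    \<and> \<rho> E0 (\<rho> K f) = (\<lambda>l. q^2 * \<rho> K (\<rho> E0 f) l)
    \<and> \<rho> F0 (\<rho> K f) = (\<lambda>l. inverse (q^2) * \<rho> K (\<rho> F0 f) l)
    \<and> \<rho> E1 (\<rho> K_inv f) = (\<lambda>l. q^2 * \<rho> K_inv (\<rho> E1 f) l)
    \<and> \<rho> F1 (\<rho> K_inv f) = (\<lambda>l. inverse (q^2) * \<rho> K_inv (\<rho> F1 f) l)
    \<and> \<rho> E0 (\<rho> K_inv f) = (\<lambda>l. inverse (q^2) * \<rho> K_inv (\<rho> E0 f) l)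
    \<and> \<rho> F0 (\<rho> K_inv f) = (\<lambda>l. q^2 * \<rho> K_inv (\<rho> F0 f) l)
    \<and> \<rho> E1 (\<rho> F1 f) = (\<lambda>l. \<rho> F1 (\<rho> E1 f) l + (1 / (q - inverse q)) * (\<rho> K f l - \<rho> K_inv f l))
    \<and> \<rho> E0 (\<rho> F0 f) = (\<lambda>l. \<rho> F0 (\<rho> E0 f) l - (1 / (q - inverse q)) * (\<rho> K f l - \<rho> K_inv f l))
    \<and> \<rho> E1 (\<rho> F0 f) = \<rho> F0 (\<rho> E1 f)
    \<and> \<rho> E0 (\<rho> F1 f) = \<rho> F1 (\<rho> E0 f)
    \<and> (\<forall>(a, b) \<in> {(E0, E1), (E1, E0), (F0, F1), (F1, F0)}.
        \<rho> a (\<rho> a (\<rho> a (\<rho> b f))) = (\<lambda>l. (q\<^sup>2 + 1 + inverse (q\<^sup>2)) * \<rho> a (\<rho> a (\<rho> b (\<rho> a f))) l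
          - (q\<^sup>2 + 1 + inverse (q\<^sup>2)) * \<rho> a (\<rho> b (\<rho> a (\<rho> a f))) l + \<rho> b (\<rho> a (\<rho> a (\<rho> a f))) l)))"

lemma U_relsD:
  assumes "U_rels q \<rho>"
  shows "\<rho> K (\<rho> K_inv f) = f" "\<rho> K_inv (\<rho> K f) = f"
    "\<rho> E1 (\<rho> K f) = (\<lambda>l. inverse (q^2) * \<rho> K (\<rho> E1 f) l)"
    "\<rho> F1 (\<rho> K f) = (\<lambda>l. q^2 * \<rho> K (\<rho> F1 f) l)"
    "\<rho> E0 (\<rho> K f) = (\<lambda>l. q^2 * \<rho> K (\<rho> E0 f) l)"
    "\<rho> F0 (\<rho> K f) = (\<lambda>l. inverse (q^2) * \<rho> K (\<rho> F0 f) l)"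
    "\<rho> E1 (\<rho> K_inv f) = (\<lambda>l. q^2 * \<rho> K_inv (\<rho> E1 f) l)"
    "\<rho> F1 (\<rho> K_inv f) = (\<lambda>l. inverse (q^2) * \<rho> K_inv (\<rho> F1 f) l)"
    "\<rho> E0 (\<rho> K_inv f) = (\<lambda>l. inverse (q^2) * \<rho> K_inv (\<rho> E0 f) l)"
    "\<rho> F0 (\<rho> K_inv f) = (\<lambda>l. q^2 * \<rho> K_inv (\<rho> F0 f) l)"
    "\<rho> E1 (\<rho> F1 f) = (\<lambda>l. \<rho> F1 (\<rho> E1 f) l + (1 / (q - inverse q)) * (\<rho> K f l - \<rho> K_inv f l))"
    "\<rho> E0 (\<rho> F0 f) = (\<lambda>l. \<rho> F0 (\<rho> E0 f) l - (1 / (q - inverse q)) * (\<rho> K f l - \<rho> K_inv f l))"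
    "\<rho> E1 (\<rho> F0 f) = \<rho> F0 (\<rho> E1 f)"
    "\<rho> E0 (\<rho> F1 f) = \<rho> F1 (\<rho> E0 f)"
    "\<rho> E0 (\<rho> E0 (\<rho> E0 (\<rho> E1 f))) = (\<lambda>l. (q\<^sup>2 + 1 + inverse (q\<^sup>2)) * \<rho> E0 (\<rho> E0 (\<rho> E1 (\<rho> E0 f))) l
          - (q\<^sup>2 + 1 + inverse (q\<^sup>2)) * \<rho> E0 (\<rho> E1 (\<rho> E0 (\<rho> E0 f))) l + \<rho> E1 (\<rho> E0 (\<rho> E0 (\<rho> E0 f))) l)"
    "\<rho> E1 (\<rho> E1 (\<rho> E1 (\<rho> E0 f))) = (\<lambda>l. (q\<^sup>2 + 1 + inverse (q\<^sup>2)) * \<rho> E1 (\<rho> E1 (\<rho> E0 (\<rho> E1 f))) l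
          - (q\<^sup>2 + 1 + inverse (q\<^sup>2)) * \<rho> E1 (\<rho> E0 (\<rho> E1 (\<rho> E1 f))) l + \<rho> E0 (\<rho> E1 (\<rho> E1 (\<rho> E1 f))) l)"
    "\<rho> F0 (\<rho> F0 (\<rho> F0 (\<rho> F1 f))) = (\<lambda>l. (q\<^sup>2 + 1 + inverse (q\<^sup>2)) * \<rho> F0 (\<rho> F0 (\<rho> F1 (\<rho> F0 f))) l
          - (q\<^sup>2 + 1 + inverse (q\<^sup>2)) * \<rho> F0 (\<rho> F1 (\<rho> F0 (\<rho> F0 f))) l + \<rho> F1 (\<rho> F0 (\<rho> F0 (\<rho> F0 f))) l)"
    "\<rho> F1 (\<rho> F1 (\<rho> F1 (\<rho> F0 f))) = (\<lambda>l. (q\<^sup>2 + 1 + inverse (q\<^sup>2)) * \<rho> F1 (\<rho> F1 (\<rho> F0 (\<rho> F1 f))) l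
          - (q\<^sup>2 + 1 + inverse (q\<^sup>2)) * \<rho> F1 (\<rho> F0 (\<rho> F1 (\<rho> F1 f))) l + \<rho> F0 (\<rho> F1 (\<rho> F1 (\<rho> F1 f))) l)"
  using assms unfolding U_rels_def by simp_all

lemma fun_eq_boolI: "f [] = g [] \<Longrightarrow> (\<And>l. f (False # l) = g (False # l)) \<Longrightarrow> (\<And>l. f (True # l) = g (True # l)) \<Longrightarrow> f = g"
proof (rule ext)
  fix l
  assume "f [] = g []" "\<And>l. f (False # l) = g (False # l)" "\<And>l. f (True # l) = g (True # l)"
  then show "f l = g l" by (cases l; cases "hd l") auto
qed

text \<open>The coproduct and the action on $v_+, v_-$ respect the relations of U. Each identity is
  checked at heads \<open>False\<close> and \<open>True\<close> and at \<open>[]\<close>, where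
  \<open>tens\<close> is the trivial module.\<close>

lemma U_rels_tens:
  assumes q: "q \<noteq> 0" "q^2 \<noteq> 1" and x: "x \<noteq> 0" and rels: "U_rels q \<rho>" and lin: "\<And>g. linear_op (\<rho> g)"
  shows "U_rels q (tens q x \<rho>)"
proof -
  note R = U_relsD[OF rels] linear_op_add[OF lin] linear_op_scale[OF lin] linear_op_diff[OF lin] linear_op_zero[OF lin]
  have q2: "q - inverse q \<noteq> 0" using q by (simp add: field_simps power2_eq_square)
  have "q * q \<noteq> 1" using q by (simp add: power2_eq_square)
  show ?thesis unfolding U_rels_def
  proof (intro allI conjI)
    fix f
    show "tens q x \<rho> K (tens q x \<rho> K_inv f) = f" using q
      by (intro fun_eq_boolI) (simp_all add: tens_simps R)
    show "tens q x \<rho> K_inv (tens q x \<rho> K f) = f" using q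
      by (intro fun_eq_boolI) (simp_all add: tens_simps R)
    show "tens q x \<rho> E1 (tens q x \<rho> K f) = (\<lambda>l. inverse (q\<^sup>2) * tens q x \<rho> K (tens q x \<rho> E1 f) l)" using q
      by (intro fun_eq_boolI) (simp_all add: tens_simps R, (simp_all add: field_simps power2_eq_square)?)
    show "tens q x \<rho> F1 (tens q x \<rho> K f) = (\<lambda>l. q\<^sup>2 * tens q x \<rho> K (tens q x \<rho> F1 f) l)" using q
      by (intro fun_eq_boolI) (simp_all add: tens_simps R, (simp_all add: field_simps power2_eq_square)?)
    show "tens q x \<rho> E0 (tens q x \<rho> K f) = (\<lambda>l. q\<^sup>2 * tens q x \<rho> K (tens q x \<rho> E0 f) l)" using q
      by (intro fun_eq_boolI) (simp_all add: tens_simps R, (simp_all add: field_simps power2_eq_square)?)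
    show "tens q x \<rho> F0 (tens q x \<rho> K f) = (\<lambda>l. inverse (q\<^sup>2) * tens q x \<rho> K (tens q x \<rho> F0 f) l)" using q x
      by (intro fun_eq_boolI) (simp_all add: tens_simps R, (simp_all add: field_simps power2_eq_square)?)
    show "tens q x \<rho> E1 (tens q x \<rho> K_inv f) = (\<lambda>l. q\<^sup>2 * tens q x \<rho> K_inv (tens q x \<rho> E1 f) l)" using q
      by (intro fun_eq_boolI) (simp_all add: tens_simps R, (simp_all add: field_simps power2_eq_square)?)
    show "tens q x \<rho> F1 (tens q x \<rho> K_inv f) = (\<lambda>l. inverse (q\<^sup>2) * tens q x \<rho> K_inv (tens q x \<rho> F1 f) l)" using q
      by (intro fun_eq_boolI) (simp_all add: tens_simps R, (simp_all add: field_simps power2_eq_square)?)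
    show "tens q x \<rho> E0 (tens q x \<rho> K_inv f) = (\<lambda>l. inverse (q\<^sup>2) * tens q x \<rho> K_inv (tens q x \<rho> E0 f) l)" using q
      by (intro fun_eq_boolI) (simp_all add: tens_simps R, (simp_all add: field_simps power2_eq_square)?)
    show "tens q x \<rho> F0 (tens q x \<rho> K_inv f) = (\<lambda>l. q\<^sup>2 * tens q x \<rho> K_inv (tens q x \<rho> F0 f) l)" using q x
      by (intro fun_eq_boolI) (simp_all add: tens_simps R, (simp_all add: field_simps power2_eq_square)?)
    show "tens q x \<rho> E1 (tens q x \<rho> F1 f) = (\<lambda>l. tens q x \<rho> F1 (tens q x \<rho> E1 f) l
        + 1 / (q - inverse q) * (tens q x \<rho> K f l - tens q x \<rho> K_inv f l))" using q2 q \<open>q * q \<noteq> 1\<close>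
      by (intro fun_eq_boolI) (simp_all add: tens_simps R, (simp_all add: divide_simps)?, (simp_all add: algebra_simps power2_eq_square)?)
    show "tens q x \<rho> E0 (tens q x \<rho> F0 f) = (\<lambda>l. tens q x \<rho> F0 (tens q x \<rho> E0 f) l
        - 1 / (q - inverse q) * (tens q x \<rho> K f l - tens q x \<rho> K_inv f l))" using q2 q x \<open>q * q \<noteq> 1\<close>
      by (intro fun_eq_boolI) (simp_all add: tens_simps R, (simp_all add: divide_simps)?, (simp_all add: algebra_simps power2_eq_square)?)
    show "tens q x \<rho> E1 (tens q x \<rho> F0 f) = tens q x \<rho> F0 (tens q x \<rho> E1 f)" using q x
      by (intro fun_eq_boolI) (simp_all add: tens_simps R, (simp_all add: field_simps power2_eq_square)?)
    show "tens q x \<rho> E0 (tens q x \<rho> F1 f) = tens q x \<rho> F1 (tens q x \<rho> E0 f)" using q x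
      by (intro fun_eq_boolI) (simp_all add: tens_simps R, (simp_all add: field_simps power2_eq_square)?)
    let ?c = "q\<^sup>2 + 1 + inverse (q\<^sup>2)"
    let ?t = "tens q x \<rho>"
    have 1: "?t E0 (?t E0 (?t E0 (?t E1 f))) = (\<lambda>l. ?c * ?t E0 (?t E0 (?t E1 (?t E0 f))) l
          - ?c * ?t E0 (?t E1 (?t E0 (?t E0 f))) l + ?t E1 (?t E0 (?t E0 (?t E0 f))) l)" using q x
      by (intro fun_eq_boolI) (simp_all add: tens_simps R, (simp_all add: field_simps eval_nat_numeral)?)
    have 2: "?t E1 (?t E1 (?t E1 (?t E0 f))) = (\<lambda>l. ?c * ?t E1 (?t E1 (?t E0 (?t E1 f))) l
          - ?c * ?t E1 (?t E0 (?t E1 (?t E1 f))) l + ?t E0 (?t E1 (?t E1 (?t E1 f))) l)" using q x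
      by (intro fun_eq_boolI) (simp_all add: tens_simps R, (simp_all add: field_simps eval_nat_numeral)?)
    have 3: "?t F0 (?t F0 (?t F0 (?t F1 f))) = (\<lambda>l. ?c * ?t F0 (?t F0 (?t F1 (?t F0 f))) l
          - ?c * ?t F0 (?t F1 (?t F0 (?t F0 f))) l + ?t F1 (?t F0 (?t F0 (?t F0 f))) l)" using q x
      by (intro fun_eq_boolI) (simp_all add: tens_simps R, (simp_all add: field_simps eval_nat_numeral)?)
    have 4: "?t F1 (?t F1 (?t F1 (?t F0 f))) = (\<lambda>l. ?c * ?t F1 (?t F1 (?t F0 (?t F1 f))) l
          - ?c * ?t F1 (?t F0 (?t F1 (?t F1 f))) l + ?t F0 (?t F1 (?t F1 (?t F1 f))) l)" using q x
      by (intro fun_eq_boolI) (simp_all add: tens_simps R, (simp_all add: field_simps eval_nat_numeral)?)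
    show "\<forall>(a, b) \<in> {(E0, E1), (E1, E0), (F0, F1), (F1, F0)}.
        ?t a (?t a (?t a (?t b f))) = (\<lambda>l. ?c * ?t a (?t a (?t b (?t a f))) l
          - ?c * ?t a (?t b (?t a (?t a f))) l + ?t b (?t a (?t a (?t a f))) l)"
      using 1 2 3 4 by simp
  qed
qed

lemma U_rels_wact:
  assumes q: "q \<noteq> 0" "q^2 \<noteq> 1"
  shows "U_rels q (wact q w)"
proof (induction w)
  case Nil
  then show ?case by (auto simp: U_rels_def fun_eq_iff)
next
  case (Cons a w)
  have "wact q (a # w) = tens q (q powi a) (wact q w)" by (intro ext) simp
  then show ?case using U_rels_tens[OF q _ Cons linear_op_wact, of "q powi a"] q by simp
qed


section \<open>The monodromy matrix\<close>

text \<open>The coefficient of $z^k$ of the entry \<open>(i, j)\<close> of the monodromy matrix, multiplied by the inverse of the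
  constant coefficient of the entry $A(z)$ at \<open>(False, False)\<close>; this normalisation removes the square
  root of \<open>K\<close>. Integer indices allow shifts by \<open>z\<close> without case distinctions.\<close>

type_synonym op = "(bool list \<Rightarrow> complex) \<Rightarrow> bool list \<Rightarrow> complex"

definition monodromy_step :: "complex \<Rightarrow> complex \<Rightarrow> (bool \<Rightarrow> bool \<Rightarrow> int \<Rightarrow> op) \<Rightarrow> bool \<Rightarrow> bool \<Rightarrow> int \<Rightarrow> op" where
  "monodromy_step q y \<tau> i j k f l = (case l of [] \<Rightarrow> if i = j \<and> k = 0 then f [] else 0
    | b # l \<Rightarrow>
      (if j then
        if b then q * \<tau> i True k (\<lambda>l. f (True # l)) l - inverse q * y * \<tau> i True (k - 1) (\<lambda>l. f (True # l)) l
                  + (q - inverse q) * \<tau> i False k (\<lambda>l. f (False # l)) l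
        else inverse q * (\<tau> i True k (\<lambda>l. f (False # l)) l - y * \<tau> i True (k - 1) (\<lambda>l. f (False # l)) l)
      else
        if b then \<tau> i False k (\<lambda>l. f (True # l)) l - y * \<tau> i False (k - 1) (\<lambda>l. f (True # l)) l
        else \<tau> i False k (\<lambda>l. f (False # l)) l - inverse (q^2) * y * \<tau> i False (k - 1) (\<lambda>l. f (False # l)) l
                  + (1 - inverse (q^2)) * y * \<tau> i True (k - 1) (\<lambda>l. f (True # l)) l))"

fun monodromy :: "complex \<Rightarrow> int list \<Rightarrow> bool \<Rightarrow> bool \<Rightarrow> int \<Rightarrow> op" where
  "monodromy q [] i j k f = (if i = j \<and> k = 0 then f else (\<lambda>_. 0))"
| "monodromy q (a # w) i j k f = monodromy_step q (inverse (q powi a)) (monodromy q w) i j k f"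

lemma monodromy_step_simps:
  "monodromy_step q y \<tau> i j k f [] = (if i = j \<and> k = 0 then f [] else 0)"
  "monodromy_step q y \<tau> i True k f (True # l) = q * \<tau> i True k (\<lambda>l. f (True # l)) l - inverse q * y * \<tau> i True (k - 1) (\<lambda>l. f (True # l)) l
                  + (q - inverse q) * \<tau> i False k (\<lambda>l. f (False # l)) l"
  "monodromy_step q y \<tau> i True k f (False # l) = inverse q * (\<tau> i True k (\<lambda>l. f (False # l)) l - y * \<tau> i True (k - 1) (\<lambda>l. f (False # l)) l)"
  "monodromy_step q y \<tau> i False k f (True # l) = \<tau> i False k (\<lambda>l. f (True # l)) l - y * \<tau> i False (k - 1) (\<lambda>l. f (True # l)) l"
  "monodromy_step q y \<tau> i False k f (False # l) = \<tau> i False k (\<lambda>l. f (False # l)) l - inverse (q^2) * y * \<tau> i False (k - 1) (\<lambda>l. f (False # l)) l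
                  + (1 - inverse (q^2)) * y * \<tau> i True (k - 1) (\<lambda>l. f (True # l)) l"
  by (simp_all add: monodromy_step_def)

lemma monodromy_Cons: "monodromy q (a # w) = monodromy_step q (inverse (q powi a)) (monodromy q w)"
  by (intro ext) simp

lemma wact_Cons: "wact q (a # w) = tens q (q powi a) (wact q w)"
  by (intro ext) simp

lemma linear_op_monodromy_step:
  assumes "\<And>i j k. linear_op (\<tau> i j k)"
  shows "linear_op (monodromy_step q y \<tau> i j k)"
  unfolding linear_op_def
proof (intro conjI allI ext)
  fix f h l
  show "monodromy_step q y \<tau> i j k (\<lambda>i. f i + h i) l = monodromy_step q y \<tau> i j k f l + monodromy_step q y \<tau> i j k h l"
    by (cases l; cases j; cases "hd l") (simp_all add: monodromy_step_simps linear_op_add[OF assms] algebra_simps)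
next
  fix c f l
  show "monodromy_step q y \<tau> i j k (\<lambda>i. c * f i) l = c * monodromy_step q y \<tau> i j k f l"
    by (cases l; cases j; cases "hd l") (simp_all add: monodromy_step_simps linear_op_scale[OF assms] algebra_simps)
qed

lemma linear_op_monodromy: "linear_op (monodromy q w i j k)"
proof (induction w arbitrary: i j k)
  case Nil
  then show ?case by (auto simp: linear_op_def)
next
  case (Cons a w)
  then show ?case by (simp only: monodromy_Cons linear_op_monodromy_step)
qed

lemma monodromy_neg: "k < 0 \<Longrightarrow> monodromy q w i j k f = (\<lambda>_. 0)"
proof (induction w arbitrary: i j k f)
  case (Cons a w)
  show ?case unfolding monodromy_Cons
    using Cons by (intro fun_eq_boolI; cases j) (simp_all add: monodromy_step_simps)
qed simp

definition monodromy_rels :: "complex \<Rightarrow> (U_gen \<Rightarrow> op) \<Rightarrow> (bool \<Rightarrow> bool \<Rightarrow> int \<Rightarrow> op) \<Rightarrow> bool" where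
  "monodromy_rels q \<rho> \<tau> \<longleftrightarrow> (\<forall>k f.
      \<tau> False False k (\<rho> F1 f) = (\<lambda>l. q * (q * \<rho> F1 (\<tau> False False k f) l - \<tau> False True k f l))
    \<and> \<tau> True False k (\<rho> F1 f) = (\<lambda>l. q * (q * \<rho> F1 (\<tau> True False k f) l + \<rho> K_inv (\<tau> False False k f) l - \<tau> True True k f l))
    \<and> \<tau> False True k (\<rho> F1 f) = \<rho> F1 (\<tau> False True k f)
    \<and> \<tau> True True k (\<rho> F1 f) = (\<lambda>l. \<rho> F1 (\<tau> True True k f) l + inverse q * \<rho> K_inv (\<tau> False True k f) l)
    \<and> \<tau> False False k (\<rho> F0 f) = (\<lambda>l. inverse (q^2) * \<rho> F0 (\<tau> False False k f) l + inverse q * \<rho> K (\<tau> True False (k + 1) f) l)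
    \<and> \<tau> True False k (\<rho> F0 f) = (\<lambda>l. inverse (q^2) * \<rho> F0 (\<tau> True False k f) l)
    \<and> \<tau> False True k (\<rho> F0 f) = (\<lambda>l. \<rho> F0 (\<tau> False True k f) l + q * (\<rho> K (\<tau> True True (k + 1) f) l - \<tau> False False (k + 1) f l))
    \<and> \<tau> True True k (\<rho> F0 f) = (\<lambda>l. \<rho> F0 (\<tau> True True k f) l - q * \<tau> True False (k + 1) f l)
    \<and> \<tau> False False k (\<rho> K f) = \<rho> K (\<tau> False False k f)
    \<and> \<tau> True True k (\<rho> K f) = \<rho> K (\<tau> True True k f)
    \<and> \<tau> True False k (\<rho> K f) = (\<lambda>l. inverse (q^2) * \<rho> K (\<tau> True False k f) l)
    \<and> \<tau> False True k (\<rho> K f) = (\<lambda>l. q^2 * \<rho> K (\<tau> False True k f) l)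
    \<and> \<tau> False False k (\<rho> K_inv f) = \<rho> K_inv (\<tau> False False k f)
    \<and> \<tau> True True k (\<rho> K_inv f) = \<rho> K_inv (\<tau> True True k f)
    \<and> \<tau> True False k (\<rho> K_inv f) = (\<lambda>l. q^2 * \<rho> K_inv (\<tau> True False k f) l)
    \<and> \<tau> False True k (\<rho> K_inv f) = (\<lambda>l. inverse (q^2) * \<rho> K_inv (\<tau> False True k f) l))"

lemma monodromy_relsD:
  assumes "monodromy_rels q \<rho> \<tau>"
  shows "\<tau> False False k (\<rho> F1 f) = (\<lambda>l. q * (q * \<rho> F1 (\<tau> False False k f) l - \<tau> False True k f l))"
    "\<tau> True False k (\<rho> F1 f) = (\<lambda>l. q * (q * \<rho> F1 (\<tau> True False k f) l + \<rho> K_inv (\<tau> False False k f) l - \<tau> True True k f l))"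
    "\<tau> False True k (\<rho> F1 f) = \<rho> F1 (\<tau> False True k f)"
    "\<tau> True True k (\<rho> F1 f) = (\<lambda>l. \<rho> F1 (\<tau> True True k f) l + inverse q * \<rho> K_inv (\<tau> False True k f) l)"
    "\<tau> False False k (\<rho> F0 f) = (\<lambda>l. inverse (q^2) * \<rho> F0 (\<tau> False False k f) l + inverse q * \<rho> K (\<tau> True False (k + 1) f) l)"
    "\<tau> True False k (\<rho> F0 f) = (\<lambda>l. inverse (q^2) * \<rho> F0 (\<tau> True False k f) l)"
    "\<tau> False True k (\<rho> F0 f) = (\<lambda>l. \<rho> F0 (\<tau> False True k f) l + q * (\<rho> K (\<tau> True True (k + 1) f) l - \<tau> False False (k + 1) f l))"
    "\<tau> True True k (\<rho> F0 f) = (\<lambda>l. \<rho> F0 (\<tau> True True k f) l - q * \<tau> True False (k + 1) f l)"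
    "\<tau> False False k (\<rho> K f) = \<rho> K (\<tau> False False k f)"
    "\<tau> True True k (\<rho> K f) = \<rho> K (\<tau> True True k f)"
    "\<tau> True False k (\<rho> K f) = (\<lambda>l. inverse (q^2) * \<rho> K (\<tau> True False k f) l)"
    "\<tau> False True k (\<rho> K f) = (\<lambda>l. q^2 * \<rho> K (\<tau> False True k f) l)"
    "\<tau> False False k (\<rho> K_inv f) = \<rho> K_inv (\<tau> False False k f)"
    "\<tau> True True k (\<rho> K_inv f) = \<rho> K_inv (\<tau> True True k f)"
    "\<tau> True False k (\<rho> K_inv f) = (\<lambda>l. q^2 * \<rho> K_inv (\<tau> True False k f) l)"
    "\<tau> False True k (\<rho> K_inv f) = (\<lambda>l. inverse (q^2) * \<rho> K_inv (\<tau> False True k f) l)"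
  using assms unfolding monodromy_rels_def by simp_all

text \<open>\<open>monodromy_step\<close> composes the monodromy of the shorter word with the
  R-matrix of the new letter, and the latter is an intertwiner as well.\<close>

lemma monodromy_rels_tens:
  assumes q: "q \<noteq> 0" and x: "x \<noteq> 0" and rels: "U_rels q \<rho>" and lin: "\<And>g. linear_op (\<rho> g)"
    and mrels: "monodromy_rels q \<rho> \<tau>" and mlin: "\<And>i j k. linear_op (\<tau> i j k)"
  shows "monodromy_rels q (tens q x \<rho>) (monodromy_step q (inverse x) \<tau>)"
proof -
  note R = monodromy_relsD[OF mrels] U_relsD(1,2)[OF rels]
    linear_op_add[OF lin] linear_op_scale[OF lin] linear_op_diff[OF lin]
    linear_op_add[OF mlin] linear_op_scale[OF mlin] linear_op_diff[OF mlin]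
  show ?thesis unfolding monodromy_rels_def using q x
    by (intro allI conjI; intro fun_eq_boolI)
      (simp_all add: tens_simps monodromy_step_simps R, (simp_all add: field_simps eval_nat_numeral)?)
qed

lemma monodromy_rels_monodromy:
  assumes q: "q \<noteq> 0" "q^2 \<noteq> 1"
  shows "monodromy_rels q (wact q w) (monodromy q w)"
proof (induction w)
  case Nil
  then show ?case by (auto simp: monodromy_rels_def fun_eq_iff)
next
  case (Cons a w)
  have "q powi a \<noteq> 0" using q by simp
  show ?case unfolding monodromy_Cons wact_Cons
    by (rule monodromy_rels_tens[OF q(1) \<open>q powi a \<noteq> 0\<close> U_rels_wact[OF q] linear_op_wact Cons linear_op_monodromy])
qed

section \<open>The quantum determinant\<close>

definition wt :: "complex \<Rightarrow> int \<Rightarrow> complex" where "wt q m = q ^ (2 * nat m)"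

text \<open>The coefficient of z^k in P(z) Q(q^2 z).\<close>

definition conv :: "complex \<Rightarrow> (int \<Rightarrow> op) \<Rightarrow> (int \<Rightarrow> op) \<Rightarrow> int \<Rightarrow> op" where
  "conv q P Q k f l = (\<Sum>j\<in>{0..k}. wt q (k - j) * P j (Q (k - j) f) l)"

lemma wt_left_comm: "wt q m * (c * X) = c * (wt q m * X)"
  by simp

lemma wt_Suc: "m \<ge> 0 \<Longrightarrow> wt q (m + 1) = q^2 * wt q m"
  by (simp add: wt_def nat_add_distrib power_add power2_eq_square)

text \<open>This and the next two lemmas treat multiplication of P, of Q, and of both by z. Since Q
  is taken at q^2 z, each factor z of Q costs a factor q^2.\<close>

lemma conv_shift_left:
  assumes "\<And>k f. k < 0 \<Longrightarrow> P k f = (\<lambda>_. 0)"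
  shows "(\<Sum>j\<in>{0..k}. wt q (k - j) * P (j - 1) (Q (k - j) f) l) = conv q P Q (k - 1) f l"
proof -
  have "(\<Sum>j\<in>{0..k}. wt q (k - j) * P (j - 1) (Q (k - j) f) l) = (\<Sum>j\<in>{1..k}. wt q (k - j) * P (j - 1) (Q (k - j) f) l)"
    by (rule sum.mono_neutral_right) (use assms in auto)
  also have "\<dots> = (\<Sum>j\<in>{0..k - 1}. wt q (k - 1 - j) * P j (Q (k - 1 - j) f) l)"
    by (rule sum.reindex_bij_witness[of _ "\<lambda>j. j + 1" "\<lambda>j. j - 1"]) auto
  finally show ?thesis by (simp add: conv_def)
qed

lemma conv_shift_right:
  assumes "\<And>k f. k < 0 \<Longrightarrow> Q k f = (\<lambda>_. 0)" and "\<And>j. linear_op (P j)"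
  shows "(\<Sum>j\<in>{0..k}. wt q (k - j) * P j (Q (k - j - 1) f) l) = q^2 * conv q P Q (k - 1) f l"
proof -
  have "(\<Sum>j\<in>{0..k}. wt q (k - j) * P j (Q (k - j - 1) f) l) = (\<Sum>j\<in>{0..k - 1}. wt q (k - j) * P j (Q (k - j - 1) f) l)"
    by (rule sum.mono_neutral_right) (use assms(1) linear_op_zero[OF assms(2)] in auto)
  also have "\<dots> = (\<Sum>j\<in>{0..k - 1}. q^2 * (wt q (k - 1 - j) * P j (Q (k - 1 - j) f) l))"
  proof (rule sum.cong[OF HOL.refl])
    fix j assume "j \<in> {0..k - 1}"
    then show "wt q (k - j) * P j (Q (k - j - 1) f) l = q^2 * (wt q (k - 1 - j) * P j (Q (k - 1 - j) f) l)"
      using wt_Suc[of "k - 1 - j" q] by (simp add: algebra_simps)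
  qed
  finally show ?thesis by (simp add: conv_def sum_distrib_left)
qed

lemma conv_shift_both:
  assumes "\<And>k f. k < 0 \<Longrightarrow> P k f = (\<lambda>_. 0)" "\<And>k f. k < 0 \<Longrightarrow> Q k f = (\<lambda>_. 0)" and "\<And>j. linear_op (P j)"
  shows "(\<Sum>j\<in>{0..k}. wt q (k - j) * P (j - 1) (Q (k - j - 1) f) l) = q^2 * conv q P Q (k - 2) f l"
proof -
  have "(\<Sum>j\<in>{0..k}. wt q (k - j) * P (j - 1) (Q (k - j - 1) f) l) = conv q P (\<lambda>m. Q (m - 1)) (k - 1) f l"
    by (rule conv_shift_left[of P q k "\<lambda>m. Q (m - 1)", OF assms(1)])
  also have "\<dots> = q^2 * conv q P Q (k - 1 - 1) f l"
    unfolding conv_def[of q P "\<lambda>m. Q (m - 1)"] by (rule conv_shift_right[OF assms(2,3)])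
  finally show ?thesis by simp
qed

text \<open>The letter a contributes $(1 - q^{2-a} z)(1 - q^{-2-a} z)$.\<close>

fun qdet_coeff :: "complex \<Rightarrow> int list \<Rightarrow> int \<Rightarrow> complex" where
  "qdet_coeff q [] k = (if k = 0 then 1 else 0)"
| "qdet_coeff q (a # w) k = qdet_coeff q w k - (q^2 + inverse (q^2)) * inverse (q powi a) * qdet_coeff q w (k - 1)
     + inverse (q powi a) ^ 2 * qdet_coeff q w (k - 2)"

definition bsign :: "bool \<Rightarrow> bool \<Rightarrow> complex" where
  "bsign i j = (if i = j then 0 else if i then -1 else 1)"

text \<open>The rows i, j stay fixed in the induction, since a letter only recombines the columns.
  Products with equal column indices cancel thanks to the shift by q^2, and the mixed ones acquire
  the factor of the new letter in \<open>qdet_coeff\<close>. Normalising A(z) by its constant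
  coefficient leaves the operator \<open>K_inv\<close> next to the scalar determinant.\<close>

lemma monodromy_qdet:
  assumes q: "q \<noteq> 0"
  shows "length l = length w \<Longrightarrow> conv q (monodromy q w i False) (monodromy q w j True) k f l
    = conv q (monodromy q w i True) (monodromy q w j False) k f l + bsign i j * qdet_coeff q w k * wact q w K_inv f l"
proof (induction w arbitrary: i j k f l)
  case Nil
  show ?case
    by (cases i; cases j) (simp_all add: conv_def bsign_def wt_def if_distrib[of "\<lambda>x. x l"] sum.If_cases cong: if_cong)
next
  case (Cons a w)
  obtain b l' where l: "l = b # l'" "length l' = length w" using Cons.prems by (cases l) auto
  let ?y = "inverse (q powi a)"
  note L = linear_op_add[OF linear_op_monodromy] linear_op_scale[OF linear_op_monodromy] linear_op_diff[OF linear_op_monodromy]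
  note S = conv_shift_left[where P="monodromy q w _ _" and Q="monodromy q w _ _", OF monodromy_neg]
    conv_shift_right[where P="monodromy q w _ _" and Q="monodromy q w _ _", OF monodromy_neg linear_op_monodromy]
    conv_shift_both[where P="monodromy q w _ _" and Q="monodromy q w _ _", OF monodromy_neg monodromy_neg linear_op_monodromy]
    conv_def[of q "monodromy q w _ _" "monodromy q w _ _", symmetric]
  note E = wt_left_comm mult.assoc distrib_left right_diff_distrib sum.distrib sum_subtractf sum_distrib_left[symmetric]
  note IH = Cons.IH[OF l(2)]
  show ?case
  proof (cases b)
    case True
    then have "l = True # l'" using l(1) by simp
    then show ?thesis unfolding conv_def monodromy_Cons wact_Cons
      using q
      by (simp add: monodromy_step_simps tens_simps L E S, simp add: IH, simp add: field_simps eval_nat_numeral)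
  next
    case False
    then have "l = False # l'" using l(1) by simp
    then show ?thesis unfolding conv_def monodromy_Cons wact_Cons
      using q
      by (simp add: monodromy_step_simps tens_simps L E S, simp add: IH, simp add: field_simps eval_nat_numeral)
  qed
qed


section \<open>Action of the monodromy matrix on invariant subspaces\<close>

definition triv :: "U_gen \<Rightarrow> complex" where
  "triv g = (if g = K \<or> g = K_inv then 1 else 0)"

definition supp_len :: "nat \<Rightarrow> (bool list \<Rightarrow> complex) set" where
  "supp_len n = {f. \<forall>l. f l \<noteq> 0 \<longrightarrow> length l = n}"

lemma supp_len_part: "f \<in> supp_len (Suc n) \<Longrightarrow> (\<lambda>l. f (b # l)) \<in> supp_len n"
  by (auto simp: supp_len_def)

lemma supp_lenD: "f \<in> supp_len n \<Longrightarrow> length l \<noteq> n \<Longrightarrow> f l = 0"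
  by (auto simp: supp_len_def)

lemma supp_lenI: "(\<And>l. length l \<noteq> n \<Longrightarrow> f l = 0) \<Longrightarrow> f \<in> supp_len n"
  by (auto simp: supp_len_def)

lemma wact_supp_len: "f \<in> supp_len (length w) \<Longrightarrow> wact q w g f \<in> supp_len (length w)"
proof (induction w arbitrary: g f)
  case Nil
  then show ?case by (auto simp: supp_len_def)
next
  case (Cons a w)
  have part: "(\<lambda>l. f (b # l)) \<in> supp_len (length w)" for b
    using Cons.prems supp_len_part by simp
  have z: "wact q w g (\<lambda>l. f (b # l)) l = 0" if "length l \<noteq> length w" for g b l
    using supp_lenD[OF Cons.IH[OF part]] that by simp
  show ?case unfolding wact_Cons
  proof (rule supp_lenI)
    fix l :: "bool list" assume l: "length l \<noteq> length (a # w)"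
    then show "tens q (q powi a) (wact q w) g f l = 0"
    proof (cases l)
      case Nil
      then show ?thesis using supp_lenD[OF Cons.prems, of "[]"] by (cases g) (simp_all add: tens_simps)
    next
      case (Cons b l')
      then show ?thesis using l z supp_lenD[OF part, of l'] by (cases g; cases b) (simp_all add: tens_simps)
    qed
  qed
qed

lemma monodromy_supp_len: "f \<in> supp_len (length w) \<Longrightarrow> monodromy q w i j k f \<in> supp_len (length w)"
proof (induction w arbitrary: i j k f)
  case Nil
  then show ?case by (auto simp: supp_len_def)
next
  case (Cons a w)
  have z: "monodromy q w i j k (\<lambda>l. f (b # l)) l = 0" if "length l \<noteq> length w" for i j k b l
    using supp_lenD[OF Cons.IH[OF supp_len_part]] Cons.prems that by simp
  show ?case unfolding monodromy_Cons
  proof (rule supp_lenI)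
    fix l :: "bool list" assume l: "length l \<noteq> length (a # w)"
    then show "monodromy_step q (inverse (q powi a)) (monodromy q w) i j k f l = 0"
    proof (cases l)
      case Nil
      then show ?thesis using supp_lenD[OF Cons.prems, of "[]"] by (simp add: monodromy_step_simps)
    next
      case (Cons b l')
      then show ?thesis using l z by (cases j; cases b) (simp_all add: monodromy_step_simps)
    qed
  qed
qed

text \<open>T preserves S and acts on S'/S by the scalar c. For linear T this is compatible with
  sums and products, so for the coefficients of A(z) it is enough to express them by U and by
  earlier coefficients.\<close>

definition tracks :: "('i \<Rightarrow> complex) set \<Rightarrow> ('i \<Rightarrow> complex) set \<Rightarrow> (('i \<Rightarrow> complex) \<Rightarrow> 'i \<Rightarrow> complex) \<Rightarrow> complex \<Rightarrow> bool" where
  "tracks S S' T c \<longleftrightarrow> (\<forall>f\<in>S. T f \<in> S) \<and> (\<forall>f\<in>S'. (\<lambda>i. T f i - c * f i) \<in> S)"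

context
  fixes S S' :: "('i \<Rightarrow> complex) set"
  assumes S: "subsp S"
begin

lemma tracks_id: "tracks S S' (\<lambda>f. f) 1"
  using subsp_zero[OF S] by (auto simp: tracks_def)

lemma tracks_zero: "tracks S S' (\<lambda>f l. 0) 0"
  using subsp_zero[OF S] by (auto simp: tracks_def)

lemma tracks_comp:
  assumes T: "tracks S S' T c" "linear_op T" and U: "tracks S S' U d"
  shows "tracks S S' (\<lambda>f. T (U f)) (c * d)"
  unfolding tracks_def
proof (intro conjI ballI)
  fix f assume f: "f \<in> S'"
  have 1: "(\<lambda>i. d * (T f i - c * f i)) \<in> S"
    using T f by (intro subsp_scale[OF S]) (auto simp: tracks_def)
  have 2: "T (\<lambda>i. U f i - d * f i) \<in> S" using T U f by (auto simp: tracks_def)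
  have "T (\<lambda>i. U f i - d * f i) = (\<lambda>i. T (U f) i - d * T f i)"
    by (simp add: linear_op_diff[OF T(2)] linear_op_scale[OF T(2)])
  then have "(\<lambda>i. T (U f) i - c * d * f i) = (\<lambda>i. d * (T f i - c * f i) + T (\<lambda>i. U f i - d * f i) i)"
    by (auto simp: algebra_simps)
  then show "(\<lambda>i. T (U f) i - c * d * f i) \<in> S"
    using subsp_add[OF S 1 2] by simp
qed (use assms in \<open>auto simp: tracks_def\<close>)

lemma tracks_add:
  assumes T: "tracks S S' T c" and U: "tracks S S' U d"
  shows "tracks S S' (\<lambda>f l. T f l + U f l) (c + d)"
  unfolding tracks_def
proof (intro conjI ballI)
  fix f assume f: "f \<in> S'"
  have "(\<lambda>i. (T f i - c * f i) + (U f i - d * f i)) \<in> S"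
    using T U f by (intro subsp_add[OF S]) (auto simp: tracks_def)
  then show "(\<lambda>i. T f i + U f i - (c + d) * f i) \<in> S" by (simp add: algebra_simps)
qed (use assms subsp_add[OF S] in \<open>auto simp: tracks_def\<close>)

lemma tracks_scale:
  assumes T: "tracks S S' T c"
  shows "tracks S S' (\<lambda>f l. d * T f l) (d * c)"
  unfolding tracks_def
proof (intro conjI ballI)
  fix f assume f: "f \<in> S'"
  have "(\<lambda>i. d * (T f i - c * f i)) \<in> S"
    using T f by (intro subsp_scale[OF S]) (auto simp: tracks_def)
  then show "(\<lambda>i. d * T f i - (d * c) * f i) \<in> S" by (simp add: algebra_simps)
qed (use assms subsp_scale[OF S] in \<open>auto simp: tracks_def\<close>)

lemma tracks_diff:
  assumes T: "tracks S S' T c" and U: "tracks S S' U d"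
  shows "tracks S S' (\<lambda>f l. T f l - U f l) (c - d)"
  using tracks_add[OF T tracks_scale[OF U, of "-1"]] by simp

lemma tracks_sum:
  assumes "\<And>j. j \<in> J \<Longrightarrow> tracks S S' (T j) (c j)"
  shows "tracks S S' (\<lambda>f l. \<Sum>j\<in>J. T j f l) (\<Sum>j\<in>J. c j)"
  using assms
  by (induction J rule: infinite_finite_induct) (auto intro: tracks_zero tracks_add)

lemma tracks_cong:
  assumes "tracks S S' T c" "\<And>f. f \<in> S' \<Longrightarrow> T f = U f" "S \<subseteq> S'"
  shows "tracks S S' U c"
  using assms by (fastforce simp: tracks_def)

end

text \<open>The power series with constant term 1 and alpha(z) alpha(q^2 z) = s(z), when s has
  constant term 1. In the coefficient of z^k the unknown \<open>alpha q s k\<close> occurs twice,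
  with total factor 1 + q^(2k).\<close>

fun alpha :: "complex \<Rightarrow> (nat \<Rightarrow> complex) \<Rightarrow> nat \<Rightarrow> complex" where
  "alpha q s k = (if k = 0 then 1 else
     (s k - (\<Sum>j\<in>{1..<k}. q ^ (2 * (k - j)) * (alpha q s j * alpha q s (k - j)))) / (1 + q ^ (2 * k)))"

declare alpha.simps [simp del]

lemma monodromy_zero_coeff: "q \<noteq> 0 \<Longrightarrow> monodromy q w False False 0 f = f"
proof (induction w arbitrary: f)
  case (Cons a w)
  then show ?case unfolding monodromy_Cons
    by (intro fun_eq_boolI) (simp_all add: monodromy_step_simps monodromy_neg)
qed simp

text \<open>Induction on k. The relations with F1 and F0 express C_j for j < k, and B_j and the
  deviation of D_j from \<open>K_inv\<close> A_j for j \<le> k, by U and the A_j with j < k; where U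
  acts by \<open>triv\<close> all of these have scalar 0. The determinant relation at z^k then
  expresses (1 + q^(2k)) A_k in the same terms.\<close>

lemma monodromy_tracks:
  assumes q: "q \<noteq> 0" "\<And>k::nat. k > 0 \<Longrightarrow> q ^ k \<noteq> 1"
    and S: "inv_subsp (wact q w) S" and SS': "S \<subseteq> S'" "S' \<subseteq> supp_len (length w)"
    and triv: "\<And>g f. f \<in> S' \<Longrightarrow> (\<lambda>l. wact q w g f l - triv g * f l) \<in> S"
  shows "tracks S S' (monodromy q w False False (int k)) (alpha q (\<lambda>k. qdet_coeff q w (int k)) k)"
proof (induction k rule: less_induct)
  case (less k)
  let ?s = "\<lambda>k. qdet_coeff q w (int k)"
  let ?A = "monodromy q w False False" and ?B = "monodromy q w True False" and ?C = "monodromy q w False True" and ?D = "monodromy q w True True"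
  let ?K = "wact q w K" and ?Ki = "wact q w K_inv" and ?F0 = "wact q w F0" and ?F1 = "wact q w F1"
  \<comment> \<open>Extended by 0 in accordance with \<open>monodromy_neg\<close>, so that the index
    j - 1 needs no separate treatment at j = 0.\<close>
  define \<alpha> where "\<alpha> j = (if j < 0 then 0 else alpha q ?s (nat j))" for j :: int
  have q2: "q^2 \<noteq> 1" using q(2)[of 2] by simp
  note R = monodromy_relsD[OF monodromy_rels_monodromy[OF q(1) q2], of w] and RU = U_relsD[OF U_rels_wact[OF q(1) q2], of w]
  note L = linear_op_monodromy linear_op_wact
  note s = inv_subsp_subsp[OF S]
  have tr: "tracks S S' (wact q w g) (triv g)" for g
    using inv_subsp_act[OF S] triv by (auto simp: tracks_def)
  have trK: "tracks S S' ?K 1" "tracks S S' ?Ki 1" "tracks S S' ?F0 0" "tracks S S' ?F1 0"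
    using tr[of K] tr[of K_inv] tr[of F0] tr[of F1] by (simp_all add: triv_def)
  have trA: "tracks S S' (?A j) (\<alpha> j)" if "j < int k" for j
  proof (cases "j < 0")
    case True
    then have "?A j = (\<lambda>f l. 0)" by (intro ext) (simp add: monodromy_neg)
    then show ?thesis using True tracks_zero[OF s] by (simp add: \<alpha>_def)
  next
    case False
    then show ?thesis using less[of "nat j"] that by (simp add: \<alpha>_def)
  qed
  have trC: "tracks S S' (?C j) 0" if "j < int k" for j
  proof -
    have "tracks S S' (\<lambda>f l. q * (q * ?F1 (?A j f) l) - ?A j (?F1 f) l) (q * (q * (0 * \<alpha> j)) - \<alpha> j * 0)"
      by (intro tracks_diff[OF s] tracks_scale[OF s] tracks_comp[OF s] trA trK L that)
    then have 1: "tracks S S' (\<lambda>f l. inverse q * (q * (q * ?F1 (?A j f) l) - ?A j (?F1 f) l)) (inverse q * 0)"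
      by (intro tracks_scale[OF s]) simp
    have 2: "(\<lambda>f l. inverse q * (q * (q * ?F1 (?A j f) l) - ?A j (?F1 f) l)) = ?C j"
      using q(1) by (intro ext) (simp add: R(1) field_simps)
    show ?thesis using 1 unfolding 2 by simp
  qed
  \<comment> \<open>The relation of A with F0 at index j - 1, solved for B. Since B_j depends on
    A_(j-1) only, it is available up to j = k while A is known below k.\<close>
  have Beq: "?B j f = (\<lambda>l. q * ?Ki (?A (j - 1) (?F0 f)) l - inverse q * ?Ki (?F0 (?A (j - 1) f)) l)" for j f
  proof -
    have *: "(\<lambda>l. q * ?A (j - 1) (?F0 f) l - inverse q * ?F0 (?A (j - 1) f) l) = ?K (?B j f)"
      using q(1) by (auto simp: R(5)[of "j - 1"] field_simps eval_nat_numeral)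
    have "?B j f = ?Ki (?K (?B j f))" by (simp add: RU)
    also have "\<dots> = (\<lambda>l. q * ?Ki (?A (j - 1) (?F0 f)) l - inverse q * ?Ki (?F0 (?A (j - 1) f)) l)"
      unfolding *[symmetric] by (simp add: linear_op_diff[OF L(2)] linear_op_scale[OF L(2)])
    finally show ?thesis .
  qed
  have trB: "tracks S S' (?B j) 0" if "j \<le> int k" for j
  proof -
    have 1: "tracks S S' (\<lambda>f l. q * ?Ki (?A (j - 1) (?F0 f)) l - inverse q * ?Ki (?F0 (?A (j - 1) f)) l)
      (q * (1 * (\<alpha> (j - 1) * 0)) - inverse q * (1 * (0 * \<alpha> (j - 1))))"
      by (intro tracks_diff[OF s] tracks_scale[OF s] tracks_comp[OF s] trA trK L) (use that in auto)
    have "?B j = (\<lambda>f l. q * ?Ki (?A (j - 1) (?F0 f)) l - inverse q * ?Ki (?F0 (?A (j - 1) f)) l)"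
      by (rule ext) (rule Beq)
    then show ?thesis using 1 by simp
  qed
  \<comment> \<open>The deviation of D_j from \<open>K_inv\<close> A_j, read off from the relation
    of C with F0; it involves C at index j - 1 only.\<close>
  define E where "E j f = (\<lambda>l. inverse q * ?Ki (?C (j - 1) (?F0 f)) l - inverse q * ?Ki (?F0 (?C (j - 1) f)) l)" for j f
  have Deq: "?D j f = (\<lambda>l. ?Ki (?A j f) l + E j f l)" for j f
  proof -
    have *: "(\<lambda>l. ?A j f l + inverse q * (?C (j - 1) (?F0 f) l - ?F0 (?C (j - 1) f) l)) = ?K (?D j f)"
      using q(1) by (auto simp: R(7)[of "j - 1"] field_simps)
    have "?D j f = ?Ki (?K (?D j f))" by (simp add: RU)
    also have "\<dots> = (\<lambda>l. ?Ki (?A j f) l + E j f l)"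
      unfolding *[symmetric] E_def
      by (simp add: linear_op_add[OF L(2)] linear_op_diff[OF L(2)] linear_op_scale[OF L(2)] algebra_simps)
    finally show ?thesis .
  qed
  have trE: "tracks S S' (E j) 0" if "j \<le> int k" for j
  proof -
    have "tracks S S' (\<lambda>f l. inverse q * ?Ki (?C (j - 1) (?F0 f)) l - inverse q * ?Ki (?F0 (?C (j - 1) f)) l)
      (inverse q * (1 * (0 * 0)) - inverse q * (1 * (0 * 0)))"
      by (intro tracks_diff[OF s] tracks_scale[OF s] tracks_comp[OF s] trC trK L) (use that in auto)
    then show ?thesis by (simp add: E_def[abs_def])
  qed
  show ?case
  proof (cases "k = 0")
    case True
    have "?A 0 = (\<lambda>f. f)" by (rule ext) (rule monodromy_zero_coeff[OF q(1)])
    moreover have "alpha q ?s 0 = 1" by (subst alpha.simps) simp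
    ultimately show ?thesis using True tracks_id[OF s] by simp
  next
    case False
    let ?k = "int k"
    \<comment> \<open>P collects the terms 0 < j < k of A(z) D(q^2 z), with D split into
      \<open>K_inv\<close> A + E, and Q the terms j < k of C(z) B(q^2 z). What the determinant
      relation leaves for (1 + q^(2k)) \<open>K_inv\<close> A_k is R'.\<close>
    define P where "P f = (\<lambda>l. (\<Sum>j\<in>{1..<?k}. wt q (?k - j) * (?A j (?Ki (?A (?k - j) f)) l + ?A j (E (?k - j) f) l)))" for f
    define Q where "Q f = (\<lambda>l. (\<Sum>j\<in>{0..<?k}. wt q (?k - j) * ?C j (?B (?k - j) f) l))" for f
    define R' where "R' f = (\<lambda>l. ?s k * ?Ki f l - wt q ?k * E ?k f l - P f l + Q f l)" for f
    have trP: "tracks S S' P (\<Sum>j\<in>{1..<?k}. wt q (?k - j) * (\<alpha> j * (1 * \<alpha> (?k - j)) + \<alpha> j * 0))"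
      unfolding P_def
      by (intro tracks_sum[OF s] tracks_add[OF s] tracks_scale[OF s] tracks_comp[OF s] trA trE trK L) auto
    have trQ: "tracks S S' Q (\<Sum>j\<in>{0..<?k}. wt q (?k - j) * (0 * 0))"
      unfolding Q_def
      by (intro tracks_sum[OF s] tracks_scale[OF s] tracks_comp[OF s] trC trB L) auto
    have trR: "tracks S S' R' (?s k * 1 - wt q ?k * 0 - (\<Sum>j\<in>{1..<?k}. wt q (?k - j) * (\<alpha> j * (1 * \<alpha> (?k - j)) + \<alpha> j * 0))
        + (\<Sum>j\<in>{0..<?k}. wt q (?k - j) * (0 * 0)))"
      unfolding R'_def
      by (intro tracks_add[OF s] tracks_diff[OF s] tracks_scale[OF s] trP trQ trE trK) auto
    have w0: "wt q 0 = 1" by (simp add: wt_def)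
    \<comment> \<open>Otherwise q^(2k) = -1 and hence q^(4k) = 1.\<close>
    have w1: "1 + wt q ?k \<noteq> 0"
    proof
      assume "1 + wt q ?k = 0"
      then have "q ^ (2 * k) = -1" by (simp add: wt_def eq_neg_iff_add_eq_0 add.commute)
      then have "q ^ (4 * k) = 1"
        by (metis (no_types, opaque_lifting) mult.assoc mult_2_right numeral_Bit0 power2_eq_square power_mult power_minus1_even mult.commute power_one_right mult_2)
      then show False using q(2)[of "4 * k"] False by simp
    qed
    have eq: "?A ?k f = (\<lambda>l. inverse (1 + wt q ?k) * ?K (R' f) l)" if "f \<in> S'" for f
    proof -
      have fX: "f \<in> supp_len (length w)" using that SS' by auto
      have B0: "?B 0 f = (\<lambda>_. 0)" for f using linear_op_zero[OF L(2)] by (subst Beq) (simp add: monodromy_neg)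
      have D0: "?D 0 f = ?Ki f" using linear_op_zero[OF L(2)] by (subst Deq) (simp add: monodromy_neg E_def monodromy_zero_coeff[OF q(1)])
      have E0: "E 0 f = (\<lambda>_. 0)" for f
        using linear_op_zero[OF L(2)] by (simp add: E_def monodromy_neg)
      \<comment> \<open>The determinant relation is available for sign lists of the right length; at
        other lists every term vanishes by support.\<close>
      have qd: "conv q ?A ?D ?k f l = conv q ?C ?B ?k f l + ?s k * ?Ki f l" for l
      proof (cases "length l = length w")
        case True
        from monodromy_qdet[OF q(1) this, of False True ?k f] show ?thesis by (simp add: bsign_def)
      next
        case False
        have sl: "monodromy q w i j m f' l = 0" if "f' \<in> supp_len (length w)" for i j m f'
          using supp_lenD[OF monodromy_supp_len[OF that] False] .
        show ?thesis unfolding conv_def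
          using sl[OF monodromy_supp_len[OF fX]] supp_lenD[OF wact_supp_len[OF fX] False] by simp
      qed
      \<comment> \<open>The extreme terms A_0 D_k and A_k D_0 both contain \<open>K_inv\<close> A_k,
        with weights q^(2k) and 1. The term j = k of C B disappears because B_0 = 0.\<close>
      have I1: "{0..?k} = insert 0 (insert ?k {1..<?k})" and I2: "{0..?k} = insert ?k {0..<?k}" using False by auto
      have "conv q ?A ?D ?k f l = wt q ?k * ?D ?k f l + ?Ki (?A ?k f) l + P f l" for l
        unfolding conv_def I1 P_def using False
        by (simp add: monodromy_zero_coeff[OF q(1)] D0 E0 w0 R Deq[of "?k - _"] Deq[of ?k] linear_op_add[OF L(1)] linear_op_zero[OF L(1)])
      moreover have "conv q ?C ?B ?k f l = Q f l" for l
        unfolding conv_def I2 Q_def using False by (simp add: B0 linear_op_zero[OF L(1)])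
      ultimately have "(1 + wt q ?k) * ?Ki (?A ?k f) l = R' f l" for l
        using qd[of l] by (simp add: R'_def Deq[of ?k] algebra_simps)
      then have "?K (R' f) = ?K (\<lambda>l. (1 + wt q ?k) * ?Ki (?A ?k f) l)" by presburger
      also have "\<dots> = (\<lambda>l. (1 + wt q ?k) * ?A ?k f l)" by (simp only: linear_op_scale[OF L(2)] RU(1))
      finally show ?thesis using w1 by (simp add: fun_eq_iff field_simps)
    qed
    have "tracks S S' (\<lambda>f l. inverse (1 + wt q ?k) * ?K (R' f) l) (inverse (1 + wt q ?k) * (1 * (?s k * 1 - wt q ?k * 0
        - (\<Sum>j\<in>{1..<?k}. wt q (?k - j) * (\<alpha> j * (1 * \<alpha> (?k - j)) + \<alpha> j * 0)) + (\<Sum>j\<in>{0..<?k}. wt q (?k - j) * (0 * 0)))))"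
      by (intro tracks_scale[OF s] tracks_comp[OF s] trK trR L)
    then have 1: "tracks S S' (?A ?k) (inverse (1 + wt q ?k) * (?s k - (\<Sum>j\<in>{1..<?k}. wt q (?k - j) * (\<alpha> j * \<alpha> (?k - j)))))"
      using tracks_cong[OF s _ eq[symmetric] SS'(1)] by simp
    have "(\<Sum>j\<in>{1..<?k}. wt q (?k - j) * (\<alpha> j * \<alpha> (?k - j))) = (\<Sum>j\<in>{1..<k}. q ^ (2 * (k - j)) * (alpha q ?s j * alpha q ?s (k - j)))"
      by (rule sum.reindex_bij_witness[of _ int nat]) (auto simp: \<alpha>_def wt_def nat_diff_distrib)
    then have "inverse (1 + wt q ?k) * (?s k - (\<Sum>j\<in>{1..<?k}. wt q (?k - j) * (\<alpha> j * \<alpha> (?k - j)))) = alpha q ?s k"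
      using False by (subst alpha.simps) (simp add: wt_def field_simps)
    then show ?thesis using 1 by simp
  qed
qed


section \<open>The upper bound\<close>

fun bidx :: "bool list \<Rightarrow> nat" where
  "bidx [] = 0"
| "bidx (b # l) = (if b then 2 ^ length l else 0) + bidx l"

lemma bidx_less: "bidx l < 2 ^ length l"
  by (induction l) auto

lemma bidx_inj: "length l = length l' \<Longrightarrow> bidx l = bidx l' \<Longrightarrow> l = l'"
proof (induction l l' rule: list_induct2)
  case (Cons x xs y ys)
  then show ?case using bidx_less[of xs] bidx_less[of ys] by (cases x; cases y) auto
qed simp

lemma finite_bool_lists: "finite {l :: bool list. length l = n}"
  using finite_lists_length_eq[of "UNIV :: bool set" n] by simp

lemma bij_betw_bidx: "bij_betw bidx {l. length l = n} {..<2 ^ n}"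
proof -
  have inj: "inj_on bidx {l. length l = n}" by (auto intro!: inj_onI bidx_inj)
  have "card {l :: bool list. length l = n} = 2 ^ n"
    using card_lists_length_eq[of "UNIV :: bool set" n] by simp
  then have "card (bidx ` {l. length l = n}) = card {..<(2::nat) ^ n}"
    using card_image[OF inj] by simp
  moreover have "bidx ` {l. length l = n} \<subseteq> {..<2 ^ n}" using bidx_less by auto
  ultimately have "bidx ` {l. length l = n} = {..<2 ^ n}" by (intro card_subset_eq) auto
  then show ?thesis using inj by (simp add: bij_betw_def)
qed

lemma supp_len_flag: "supp_len n = flag bidx {l. length l = n} (2 ^ n)"
  using bidx_less by (auto simp: supp_len_def flag_def)

text \<open>The coefficient of z^k in the diagonal entry of A(z) at l: the letter a contributes $1 -
  q^{-a} z$ with sign \<open>True\<close> and $1 - q^{-a-2} z$ with sign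
  \<open>False\<close>.\<close>

fun diag :: "complex \<Rightarrow> int list \<Rightarrow> bool list \<Rightarrow> int \<Rightarrow> complex" where
  "diag q (a # w) (b # l) k = diag q w l k - q powi (if b then - a else - a - 2) * diag q w l (k - 1)"
| "diag q w l k = (if k = 0 then 1 else 0)"

text \<open>The one off-diagonal term in the recursion of A(z) carries the part with head
  \<open>True\<close> into the part with head \<open>False\<close>, that is, towards smaller
  \<open>bidx\<close>. If f vanishes above l, nothing arrives at l from elsewhere.\<close>

lemma monodromy_triangular:
  assumes q: "q \<noteq> 0"
  shows "length l = length w \<Longrightarrow> f \<in> supp_len (length w) \<Longrightarrow> (\<And>l'. bidx l < bidx l' \<Longrightarrow> f l' = 0)
    \<Longrightarrow> monodromy q w False False k f l = diag q w l k * f l"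
proof (induction w arbitrary: l f k)
  case (Cons a w)
  obtain b l' where l: "l = b # l'" "length l' = length w" using Cons.prems(1) by (cases l) auto
  have part: "(\<lambda>l. f (b # l)) \<in> supp_len (length w)" for b
    using Cons.prems(2) supp_len_part by simp
  have IH: "monodromy q w False False k (\<lambda>l. f (b # l)) l' = diag q w l' k * f (b # l')" for k
  proof (rule Cons.IH[OF l(2) part])
    fix m assume m: "bidx l' < bidx m"
    show "f (b # m) = 0"
    proof (cases "length m = length w")
      case True
      then show ?thesis using m l by (intro Cons.prems(3)) auto
    qed (use supp_lenD[OF part] in blast)
  qed
  have e: "q powi (- a - 2) = inverse (q^2) * inverse (q powi a)" "q powi (- a) = inverse (q powi a)"
    using q by (simp_all add: power_int_diff power_int_minus field_simps)
  show ?case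
  proof (cases b)
    case True
    then have "l = True # l'" using l by simp
    then show ?thesis using IH True e by (simp add: monodromy_step_simps algebra_simps)
  next
    case False
    have "f (True # m) = 0" for m
    proof (cases "length m = length w")
      case True
      then show ?thesis using bidx_less[of l'] l False by (intro Cons.prems(3)) auto
    qed (use supp_lenD[OF part] in blast)
    then have "(\<lambda>m. f (True # m)) = (\<lambda>_. 0)" by auto
    moreover have "l = False # l'" using l False by simp
    ultimately show ?thesis using IH False e
      by (simp add: monodromy_step_simps linear_op_zero[OF linear_op_monodromy] algebra_simps)
  qed
qed simp

text \<open>A chain for U and \<open>triv\<close> is also a chain for the coefficients of A(z) and
  the character alpha. It is compared with the coordinate flag, an invariant series for these
  coefficients on whose steps they act by the diagonal entries.\<close>

lemma reach_le_diag:
  assumes q: "q \<noteq> 0" "\<And>k::nat. k > 0 \<Longrightarrow> q ^ k \<noteq> 1"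
    and reach: "reach (wact q w) triv {\<lambda>_. 0} S t" and S: "S \<subseteq> supp_len (length w)"
  shows "t \<le> card {l. length l = length w \<and> (\<forall>k. diag q w l (int k) = alpha q (\<lambda>k. qdet_coeff q w (int k)) k)}"
    (is "t \<le> card ?L")
proof -
  let ?n = "length w"
  let ?\<alpha> = "alpha q (\<lambda>k. qdet_coeff q w (int k))"
  let ?A = "\<lambda>k::nat. monodromy q w False False (int k)"
  let ?D = "flag bidx {l. length l = ?n}"
  \<comment> \<open>The tracking lemma with S' = S.\<close>
  have inv: "inv_subsp ?A T" if T: "inv_subsp (wact q w) T" "T \<subseteq> supp_len ?n" for T
  proof -
    have "(\<lambda>l. wact q w g f l - triv g * f l) \<in> T" if "f \<in> T" for f g
      by (rule subsp_diff_scale[OF inv_subsp_subsp[OF T(1)] inv_subsp_act[OF T(1) that] that])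
    then show ?thesis
      using monodromy_tracks[OF q T(1) order_refl T(2)] inv_subsp_subsp[OF T(1)] by (auto simp: inv_subsp_def tracks_def)
  qed
  have "reach ?A ?\<alpha> {\<lambda>_. 0} S t" using reach S
  proof (induction rule: reach.induct)
    case start
    then show ?case using inv by (auto intro: reach.start)
  next
    case (widen S t S')
    then show ?case using inv by (auto intro: reach.widen)
  next
    case (step S t S')
    have sub: "S \<subset> S'" and tr: "\<And>g f. f \<in> S' \<Longrightarrow> (\<lambda>l. wact q w g f l - triv g * f l) \<in> S"
      using step(3) by (auto simp: char_step_def)
    have "tracks S S' (?A k) (?\<alpha> k)" for k
      using monodromy_tracks[OF q reach_inv_subsp[OF step(1)] _ step.prems tr] sub by auto
    then have "char_step ?A ?\<alpha> S S'" using sub by (auto simp: char_step_def tracks_def)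
    then show ?case using step inv sub by (intro reach.step[of _ _ _ S]) auto
  qed
  moreover have "inv_subsp ?A (?D i)" if i: "i \<le> 2 ^ ?n" for i
    unfolding inv_subsp_def
  proof (intro conjI allI ballI subsp_flag)
    fix k f assume f: "f \<in> ?D i"
    then have fX: "f \<in> supp_len ?n" unfolding supp_len_flag using flag_mono[OF i] by blast
    show "?A k f \<in> ?D i" unfolding flag_def mem_Collect_eq
    proof (intro allI impI, rule ccontr)
      fix l assume l: "?A k f l \<noteq> 0" "\<not> (length l = ?n \<and> bidx l < i)"
      then have len: "length l = ?n" by (metis supp_lenD monodromy_supp_len fX)
      then have "f m = 0" if "bidx l \<le> bidx m" for m using f l(2) that by (force simp: flag_def)
      then show False using l(1) monodromy_triangular[OF q(1) len fX] by simp
    qed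
  qed
  ultimately have "t \<le> card {i. i < 2 ^ ?n \<and> char_step ?A ?\<alpha> (?D i) (?D (Suc i))}"
    using S flag_simple_step[OF bij_betw_bidx]
    by (intro reach_le_simple_series[of ?A ?D "2 ^ ?n" ?\<alpha> S]) (auto simp: flag_0 linear_op_monodromy supp_len_flag)
  also have "\<dots> \<le> card (bidx ` ?L)"
  proof (intro card_mono subsetI)
    fix i assume "i \<in> {i. i < 2 ^ ?n \<and> char_step ?A ?\<alpha> (?D i) (?D (Suc i))}"
    then have i: "i < 2 ^ ?n" "char_step ?A ?\<alpha> (?D i) (?D (Suc i))" by auto
    obtain l where l: "length l = ?n" "bidx l = i"
      using bij_betw_bidx[of ?n] i(1) unfolding bij_betw_def by (metis (mono_tags, lifting) imageE lessThan_iff mem_Collect_eq)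
    \<comment> \<open>The basis vector at l spans the i-th step of the flag, so its diagonal entry
      is the scalar by which A acts on this step.\<close>
    define f :: "bool list \<Rightarrow> complex" where "f m = (if m = l then 1 else 0)" for m
    have f: "f \<in> ?D (Suc i)" "f \<in> supp_len ?n" using l by (auto simp: f_def flag_def supp_len_def)
    have "diag q w l (int k) = ?\<alpha> k" for k
    proof -
      have "(\<lambda>m. ?A k f m - ?\<alpha> k * f m) \<in> ?D i" using i(2) f by (auto simp: char_step_def)
      then have "?A k f l - ?\<alpha> k * f l = 0" using l unfolding flag_def by auto
      moreover have "?A k f l = diag q w l (int k) * f l"
        by (rule monodromy_triangular[OF q(1) l(1) f(2)]) (auto simp: f_def)
      ultimately show ?thesis by (simp add: f_def)
    qed
    then show "i \<in> bidx ` ?L" using l by auto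
  next
    show "finite (bidx ` ?L)" using finite_bool_lists[of ?n] by (auto intro: finite_subset)
  qed
  also have "\<dots> \<le> card ?L" by (rule card_image_le) (auto intro: finite_subset[OF _ finite_bool_lists[of ?n]])
  finally show ?thesis .
qed

subsection \<open>Comparing eigenvalues\<close>

definition linprod :: "complex \<Rightarrow> int multiset \<Rightarrow> complex poly" where
  "linprod q M = (\<Prod>e\<in>#M. [:1, - (q powi e):])"

lemma powi_inj:
  assumes "q \<noteq> 0" "\<And>k::nat. k > 0 \<Longrightarrow> q ^ k \<noteq> (1::complex)" "q powi a = q powi b"
  shows "a = b"
proof -
  have *: "a \<le> b" if ab: "q powi a = q powi b" for a b
  proof (rule ccontr)
    assume "\<not> a \<le> b"
    moreover have "q powi (a - b) = 1" using assms(1) ab by (simp add: power_int_diff)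
    ultimately have "q ^ nat (a - b) = 1" by (simp add: power_int_def)
    then show False using assms(2)[of "nat (a - b)"] \<open>\<not> a \<le> b\<close> by simp
  qed
  show ?thesis using *[of a b] *[of b a] assms(3) by simp
qed

text \<open>The roots are the $q^{-e}$, and e can be recovered from $q^e$ because q is not a root of
  unity; common linear factors are cancelled one by one.\<close>

lemma linprod_inj:
  assumes q: "q \<noteq> 0" "\<And>k::nat. k > 0 \<Longrightarrow> q ^ k \<noteq> (1::complex)"
  shows "linprod q M = linprod q N \<Longrightarrow> M = N"
proof (induction M arbitrary: N)
  case empty
  have "N = {#}"
  proof (rule ccontr)
    assume "N \<noteq> {#}"
    then obtain e N' where "N = add_mset e N'" by (cases N) auto
    then have "linprod q N = [:1, - (q powi e):] * linprod q N'" by (simp add: linprod_def)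
    then have "poly (linprod q N) (inverse (q powi e)) = 0" using q by simp
    then show False using empty[symmetric] by (simp add: linprod_def)
  qed
  then show ?case by simp
next
  case (add e M)
  have "poly (linprod q N) (inverse (q powi e)) = 0"
    unfolding add.prems[symmetric] using q by (simp add: linprod_def)
  then have "0 \<in># image_mset (\<lambda>e'. 1 - q powi e' / q powi e) N"
    by (simp add: linprod_def poly_prod_mset prod_mset_zero_iff field_simps)
  then obtain e' where e': "e' \<in># N" "1 - q powi e' / q powi e = 0" by auto
  then have "q powi e' = q powi e" using q by (simp add: field_simps)
  then have "e' = e" using powi_inj[OF q] by blast
  then obtain N' where N': "N = add_mset e N'" using e' by (metis mset_add)
  have "[:1, - (q powi e):] * linprod q M = [:1, - (q powi e):] * linprod q N'"
    using add.prems by (simp add: N' linprod_def)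
  then have "linprod q M = linprod q N'" by (subst (asm) mult_cancel_left) auto
  then show ?case using add.IH N' by simp
qed

definition diag_exps :: "int list \<Rightarrow> bool list \<Rightarrow> int multiset" where
  "diag_exps w l = mset (map (\<lambda>(a, b). if b then - a else - a - 2) (zip w l))"

lemma linprod_add_mset: "linprod q (add_mset e M) = [:1, - (q powi e):] * linprod q M"
  and linprod_union: "linprod q (M + N) = linprod q M * linprod q N"
  and linprod_empty: "linprod q {#} = 1"
  by (simp_all add: linprod_def)

lemma coeff_linear_mult: fixes c :: complex shows "coeff ([:1, - c:] * p) n = coeff p n - (if n = 0 then 0 else c * coeff p (n - 1))"
  by (cases n) auto

lemma diag_coeff:
  "length l = length w \<Longrightarrow> diag q w l k = (if k < 0 then 0 else coeff (linprod q (diag_exps w l)) (nat k))"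
proof (induction l w arbitrary: k rule: list_induct2)
  case Nil
  then show ?case by (auto simp: diag_exps_def linprod_empty)
next
  case (Cons b l a w)
  have "diag_exps (a # w) (b # l) = add_mset (if b then - a else - a - 2) (diag_exps w l)"
    by (simp add: diag_exps_def)
  then show ?case using Cons
    by (simp only: linprod_add_mset coeff_linear_mult) (auto simp: nat_diff_distrib)
qed

text \<open>Adding 2 to all exponents amounts to replacing z by q^2 z.\<close>

lemma coeff_linprod_shift:
  assumes "q \<noteq> 0"
  shows "coeff (linprod q (image_mset (\<lambda>e. e + 2) M)) n = q ^ (2 * n) * coeff (linprod q M) n"
proof (induction M arbitrary: n)
  case empty
  then show ?case by (cases n) (simp_all add: linprod_empty)
next
  case (add e M)
  show ?case unfolding image_mset_add_mset linprod_add_mset coeff_linear_mult add using assms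
    by (cases n) (auto simp: power_int_add field_simps power2_eq_square)
qed

definition qdet_exps :: "int list \<Rightarrow> int multiset" where
  "qdet_exps w = mset (map (\<lambda>a. 2 - a) w) + mset (map (\<lambda>a. - a - 2) w)"

lemma qdet_coeff_eq:
  assumes "q \<noteq> 0"
  shows "qdet_coeff q w k = (if k < 0 then 0 else coeff (linprod q (qdet_exps w)) (nat k))"
proof (induction w arbitrary: k)
  case Nil
  then show ?case by (auto simp: qdet_exps_def linprod_empty)
next
  case (Cons a w)
  have "qdet_exps (a # w) = add_mset (2 - a) (add_mset (- a - 2) (qdet_exps w))"
    by (simp add: qdet_exps_def)
  moreover have "q powi (2 - a) = q^2 * inverse (q powi a)" "q powi (- a - 2) = inverse (q^2) * inverse (q powi a)"
    using assms by (simp_all add: power_int_diff power_int_minus field_simps)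
  ultimately have "coeff (linprod q (qdet_exps (a # w))) n = coeff (linprod q (qdet_exps w)) n
      - (if n = 0 then 0 else (q^2 + inverse (q^2)) * inverse (q powi a) * coeff (linprod q (qdet_exps w)) (n - 1))
      + (if n < 2 then 0 else inverse (q powi a) ^ 2 * coeff (linprod q (qdet_exps w)) (n - 2))" for n
    using assms
    by (simp only: linprod_add_mset coeff_linear_mult, cases "n = 0"; cases "n = 1")
      (simp_all add: field_simps eval_nat_numeral)
  then show ?case using Cons by (auto simp: nat_diff_distrib)
qed

abbreviation occ :: "int list \<Rightarrow> bool list \<Rightarrow> int \<Rightarrow> bool \<Rightarrow> int" where
  "occ w l c b \<equiv> int (count_list (zip w l) (c, b))"

lemma count_diag_exps:
  "length l = length w \<Longrightarrow> int (count (diag_exps w l) (- c)) = occ w l (c - 2) False + occ w l c True"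
  by (induction l w rule: list_induct2) (auto simp: diag_exps_def)

lemma count_diag_exps_shift:
  "length l = length w \<Longrightarrow> int (count (image_mset (\<lambda>e. e + 2) (diag_exps w l)) (- c)) = occ w l c False + occ w l (c + 2) True"
  by (induction l w rule: list_induct2) (auto simp: diag_exps_def)

lemma count_qdet_exps:
  "length l = length w \<Longrightarrow> int (count (qdet_exps w) (- c))
    = occ w l (c + 2) False + occ w l (c + 2) True + occ w l (c - 2) False + occ w l (c - 2) True"
  by (induction l w rule: list_induct2) (auto simp: qdet_exps_def)

text \<open>The functional equation of alpha turns into an identity of multisets of exponents.
  Comparing the multiplicities of -c shows that the defect h of the balance satisfies h (c + 2) = h
  c, and h vanishes beyond the letters.\<close>

lemma diag_eq_alpha_balanced:
  assumes q: "q \<noteq> 0" "\<And>k::nat. k > 0 \<Longrightarrow> q ^ k \<noteq> (1::complex)"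
    and l: "length l = length w"
    and eq: "\<And>k. diag q w l (int k) = alpha q (\<lambda>k. qdet_coeff q w (int k)) k"
  shows "occ w l c False = occ w l (c - 2) True"
proof -
  let ?\<alpha> = "alpha q (\<lambda>k. qdet_coeff q w (int k))"
  let ?M = "diag_exps w l" let ?M' = "image_mset (\<lambda>e. e + 2) ?M"
  have c: "coeff (linprod q ?M) k = ?\<alpha> k" for k using eq[of k] by (simp add: diag_coeff[OF l])
  have "coeff (linprod q (?M + ?M')) k = coeff (linprod q (qdet_exps w)) k" for k
  proof -
    have w1: "1 + q ^ (2 * k) \<noteq> 0" if "k > 0"
    proof
      assume "1 + q ^ (2 * k) = 0"
      then have "q ^ (2 * k) = -1" by (simp add: eq_neg_iff_add_eq_0 add.commute)
      then have "(q ^ (2 * k)) ^ 2 = 1" by simp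
      then show False using q(2)[of "2 * k * 2"] that by (simp only: power_mult[symmetric])
    qed
    have a0: "?\<alpha> 0 = 1" by (subst alpha.simps) simp
    have "coeff (linprod q (?M + ?M')) k = (\<Sum>i\<le>k. ?\<alpha> i * (q ^ (2 * (k - i)) * ?\<alpha> (k - i)))"
      by (simp add: linprod_union coeff_mult coeff_linprod_shift[OF q(1)] c)
    also have "\<dots> = qdet_coeff q w (int k)"
    proof (cases "k = 0")
      case True
      have "qdet_coeff q w 0 = 1" using c[of 0] a0 
        by (simp add: qdet_coeff_eq[OF q(1)] qdet_exps_def linprod_def poly_0_coeff_0[symmetric] poly_prod_mset multiset.map_comp comp_def)
      then show ?thesis using True a0 by simp
    next
      case False
      then have I: "{..k} = insert 0 (insert k {1..<k})" by auto
      have "(1 + q ^ (2 * k)) * ?\<alpha> k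
          = qdet_coeff q w (int k) - (\<Sum>j\<in>{1..<k}. q ^ (2 * (k - j)) * (?\<alpha> j * ?\<alpha> (k - j)))"
        using w1 False by (subst alpha.simps) simp
      then show ?thesis unfolding I using False a0 by (simp add: algebra_simps)
    qed
    finally show ?thesis by (simp add: qdet_coeff_eq[OF q(1)])
  qed
  \<comment> \<open>Here ?M belongs to alpha(z), ?M' to alpha(q^2 z) and the right-hand side to the
    determinant; equal polynomials have equal multisets of exponents.\<close>
  then have "?M + ?M' = qdet_exps w" by (intro linprod_inj[OF q]) (simp_all add: poly_eq_iff)
  then have "int (count ?M (- c)) + int (count ?M' (- c)) = int (count (qdet_exps w) (- c))" for c
    by (metis count_union of_nat_add)
  then have rel: "occ w l c True + occ w l c False = occ w l (c + 2) False + occ w l (c - 2) True" for c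
    using count_diag_exps[OF l, of c] count_diag_exps_shift[OF l, of c] count_qdet_exps[OF l, of c]
    by (smt (verit))
  define h where "h c = occ w l c False - occ w l (c - 2) True" for c
  have step: "h (c + 2) = h c" for c using rel[of c] by (simp add: h_def)
  have hn: "h (c + 2 * int m) = h c" for m
    by (induction m) (use step[of "c + 2 * int _"] in \<open>auto simp: algebra_simps\<close>)
  \<comment> \<open>Large enough that c + 2m - 2, and with it c + 2m, exceeds every letter.\<close>
  define m where "m = nat (\<bar>c\<bar> + 2 + (\<Sum>a\<leftarrow>w. \<bar>a\<bar>))"
  have big: "c' \<le> (\<Sum>a\<leftarrow>w. \<bar>a\<bar>)" if "(c', b) \<in> set (zip w l)" for c' b
  proof -
    have "c' \<in> set w" using that by (rule set_zip_leftD)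
    then have "\<bar>c'\<bar> \<le> (\<Sum>a\<leftarrow>w. \<bar>a\<bar>)"
    proof (induction w)
      case (Cons a w)
      have "0 \<le> (\<Sum>a\<leftarrow>w. \<bar>a\<bar>)" by (induction w) auto
      then show ?case using Cons by auto
    qed simp
    then show ?thesis by simp
  qed
  have s0: "(\<Sum>a\<leftarrow>w. \<bar>a\<bar>) \<ge> 0" by (intro sum_list_nonneg) auto
  have "c + 2 * int m - 2 > (\<Sum>a\<leftarrow>w. \<bar>a\<bar>)" using s0 unfolding m_def by simp
  then have "h (c + 2 * int m) = 0" unfolding h_def using big
    by (smt (verit) count_list_0_iff of_nat_0)
  then show ?thesis using hn[of m] by (simp add: h_def)
qed


section \<open>Homomorphisms and exchangeable modules\<close>

definition reaches ::
    "('g \<Rightarrow> ('i \<Rightarrow> complex) \<Rightarrow> 'i \<Rightarrow> complex) \<Rightarrow> ('g \<Rightarrow> complex) \<Rightarrow> ('i \<Rightarrow> complex) set \<Rightarrow> nat \<Rightarrow> bool" where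
  "reaches \<rho> \<epsilon> X t \<longleftrightarrow> (\<exists>t'\<ge>t. reach \<rho> \<epsilon> {\<lambda>_. 0} X t')"

definition hom_on ::
    "('i \<Rightarrow> complex) set \<Rightarrow> ('g \<Rightarrow> ('i \<Rightarrow> complex) \<Rightarrow> 'i \<Rightarrow> complex) \<Rightarrow> ('j \<Rightarrow> complex) set \<Rightarrow>
     ('g \<Rightarrow> ('j \<Rightarrow> complex) \<Rightarrow> 'j \<Rightarrow> complex) \<Rightarrow> (('i \<Rightarrow> complex) \<Rightarrow> 'j \<Rightarrow> complex) \<Rightarrow> bool" where
  "hom_on X \<rho> Y \<sigma> \<phi> \<longleftrightarrow> linear_op \<phi> \<and> (\<forall>f\<in>X. \<phi> f \<in> Y) \<and> (\<forall>g. \<forall>f\<in>X. \<phi> (\<rho> g f) = \<sigma> g (\<phi> f))"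

lemma hom_onD:
  assumes "hom_on X \<rho> Y \<sigma> \<phi>"
  shows "linear_op \<phi>" "f \<in> X \<Longrightarrow> \<phi> f \<in> Y" "f \<in> X \<Longrightarrow> \<phi> (\<rho> g f) = \<sigma> g (\<phi> f)"
  using assms by (auto simp: hom_on_def)

lemma inv_subsp_zero: "(\<And>g. linear_op (\<rho> g)) \<Longrightarrow> inv_subsp \<rho> {\<lambda>_. 0}"
  by (auto simp: inv_subsp_def subsp_zero_singleton linear_op_zero)

section \<open>Transport of chains along homomorphisms\<close>

lemma inv_subsp_image:
  assumes \<phi>: "hom_on X \<rho> Y \<sigma> \<phi>" and S: "inv_subsp \<rho> S" "S \<subseteq> X"
  shows "inv_subsp \<sigma> (\<phi> ` S)"
  unfolding inv_subsp_def subsp_def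
proof (intro conjI allI ballI)
  note s = inv_subsp_subsp[OF S(1)] and lin = hom_onD(1)[OF \<phi>]
  show "(\<lambda>_. 0) \<in> \<phi> ` S" using subsp_zero[OF s] linear_op_zero[OF lin] by (metis imageI)
  fix f assume "f \<in> \<phi> ` S"
  then obtain f' where f: "f = \<phi> f'" "f' \<in> S" by auto
  show "(\<lambda>i. c * f i) \<in> \<phi> ` S" for c
    unfolding f(1) linear_op_scale[OF lin, symmetric] using subsp_scale[OF s f(2)] by (rule imageI)
  show "\<sigma> g f \<in> \<phi> ` S" for g
  proof -
    have "f' \<in> X" using f S by auto
    then show ?thesis
      unfolding f(1) hom_onD(3)[OF \<phi> \<open>f' \<in> X\<close>, symmetric] by (intro imageI inv_subsp_act[OF S(1) f(2)])
  qed
  fix g assume "g \<in> \<phi> ` S"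
  then obtain g' where g: "g = \<phi> g'" "g' \<in> S" by auto
  show "(\<lambda>i. f i + g i) \<in> \<phi> ` S"
    unfolding f(1) g(1) linear_op_add[OF lin, symmetric] using subsp_add[OF s f(2) g(2)] by (rule imageI)
qed

lemma inv_subsp_vimage:
  assumes \<phi>: "hom_on X \<rho> Y \<sigma> \<phi>" and X: "inv_subsp \<rho> X" and S: "inv_subsp \<sigma> S"
  shows "inv_subsp \<rho> (X \<inter> \<phi> -` S)"
proof -
  note x = inv_subsp_subsp[OF X] and s = inv_subsp_subsp[OF S] and lin = hom_onD(1)[OF \<phi>]
  show ?thesis unfolding inv_subsp_def subsp_def
  proof (intro conjI allI ballI)
    show "(\<lambda>_. 0) \<in> X \<inter> \<phi> -` S" using subsp_zero[OF x] subsp_zero[OF s] linear_op_zero[OF lin] by simp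
    fix f assume f: "f \<in> X \<inter> \<phi> -` S"
    show "(\<lambda>i. c * f i) \<in> X \<inter> \<phi> -` S" for c
      using f subsp_scale[OF x, of f] subsp_scale[OF s, of "\<phi> f"] by (simp add: linear_op_scale[OF lin])
    show "\<rho> g f \<in> X \<inter> \<phi> -` S" for g
      using f inv_subsp_act[OF X, of f] inv_subsp_act[OF S, of "\<phi> f"] by (simp add: hom_onD(3)[OF \<phi>])
    fix g assume g: "g \<in> X \<inter> \<phi> -` S"
    show "(\<lambda>i. f i + g i) \<in> X \<inter> \<phi> -` S"
      using f g subsp_add[OF x, of f g] subsp_add[OF s, of "\<phi> f" "\<phi> g"] by (simp add: linear_op_add[OF lin])
  qed
qed

lemma char_step_image:
  assumes \<phi>: "hom_on X \<rho> Y \<sigma> \<phi>" and S': "S' \<subseteq> X" "inv_subsp \<rho> S'"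
    and step: "char_step \<rho> \<epsilon> S S'" and ne: "\<phi> ` S \<noteq> \<phi> ` S'"
  shows "char_step \<sigma> \<epsilon> (\<phi> ` S) (\<phi> ` S')"
  unfolding char_step_def
proof (intro conjI allI ballI)
  note lin = hom_onD(1)[OF \<phi>]
  show "\<phi> ` S \<subset> \<phi> ` S'" using step ne by (auto simp: char_step_def)
  fix g f assume "f \<in> \<phi> ` S'"
  then obtain f' where f: "f = \<phi> f'" "f' \<in> S'" by auto
  then have "f' \<in> X" using S' by auto
  have "(\<lambda>i. \<sigma> g f i - \<epsilon> g * f i) = \<phi> (\<lambda>i. \<rho> g f' i - \<epsilon> g * f' i)"
    by (simp add: f(1) hom_onD(3)[OF \<phi> \<open>f' \<in> X\<close>] linear_op_diff[OF lin] linear_op_scale[OF lin])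
  then show "(\<lambda>i. \<sigma> g f i - \<epsilon> g * f i) \<in> \<phi> ` S" using step f by (auto simp: char_step_def)
qed

lemma char_step_vimage:
  assumes \<phi>: "hom_on X \<rho> Y \<sigma> \<phi>" and X: "inv_subsp \<rho> X"
    and step: "char_step \<sigma> \<epsilon> S S'" and ne: "X \<inter> \<phi> -` S \<noteq> X \<inter> \<phi> -` S'"
  shows "char_step \<rho> \<epsilon> (X \<inter> \<phi> -` S) (X \<inter> \<phi> -` S')"
  unfolding char_step_def
proof (intro conjI allI ballI)
  note x = inv_subsp_subsp[OF X] and lin = hom_onD(1)[OF \<phi>]
  show "X \<inter> \<phi> -` S \<subset> X \<inter> \<phi> -` S'" using step ne by (auto simp: char_step_def)
  fix g f assume f: "f \<in> X \<inter> \<phi> -` S'"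
  have "(\<lambda>i. \<rho> g f i - \<epsilon> g * f i) \<in> X"
    using f by (intro subsp_diff_scale[OF x] inv_subsp_act[OF X]) auto
  moreover have "\<phi> (\<lambda>i. \<rho> g f i - \<epsilon> g * f i) = (\<lambda>i. \<sigma> g (\<phi> f) i - \<epsilon> g * \<phi> f i)"
    using f by (simp add: hom_onD(3)[OF \<phi>] linear_op_diff[OF lin] linear_op_scale[OF lin])
  ultimately show "(\<lambda>i. \<rho> g f i - \<epsilon> g * f i) \<in> X \<inter> \<phi> -` S"
    using f step by (auto simp: char_step_def)
qed

text \<open>Surjectivity keeps the preimage of a character step strict; in
  \<open>reach_image\<close> injectivity does the same for images.\<close>

lemma reach_vimage:
  assumes \<phi>: "hom_on X \<rho> Y \<sigma> \<phi>" and X: "inv_subsp \<rho> X" and surj: "Y \<subseteq> \<phi> ` X"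
    and "reach \<sigma> \<epsilon> T\<^sub>0 T t" "T \<subseteq> Y"
  shows "reach \<rho> \<epsilon> (X \<inter> \<phi> -` T\<^sub>0) (X \<inter> \<phi> -` T) t"
  using assms(4,5)
proof (induction rule: reach.induct)
  case start
  then show ?case by (intro reach.start inv_subsp_vimage[OF \<phi> X])
next
  case (widen S t S')
  have "S \<subseteq> Y" using widen.hyps(3) widen.prems by (rule order_trans)
  then show ?case using widen.hyps
    by (intro reach.widen[OF widen.IH inv_subsp_vimage[OF \<phi> X]]) auto
next
  case (step S t S')
  obtain y where "y \<in> S'" "y \<notin> S" using step(3) by (auto simp: char_step_def)
  then obtain x where "x \<in> X" "\<phi> x = y" using surj step.prems by blast
  then have "X \<inter> \<phi> -` S \<noteq> X \<inter> \<phi> -` S'" using \<open>y \<in> S'\<close> \<open>y \<notin> S\<close> by auto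
  moreover have "S \<subseteq> Y" using step by (auto simp: char_step_def)
  ultimately show ?case
    by (intro reach.step[OF step.IH inv_subsp_vimage[OF \<phi> X step.hyps(2)] char_step_vimage[OF \<phi> X step.hyps(3)]])
qed

lemma reach_image:
  assumes \<phi>: "hom_on X \<rho> Y \<sigma> \<phi>" and inj: "inj_on \<phi> X"
    and "reach \<rho> \<epsilon> T\<^sub>0 T t" "T \<subseteq> X"
  shows "reach \<sigma> \<epsilon> (\<phi> ` T\<^sub>0) (\<phi> ` T) t"
  using assms(3,4)
proof (induction rule: reach.induct)
  case start
  then show ?case by (intro reach.start inv_subsp_image[OF \<phi>])
next
  case (widen S t S')
  have "S \<subseteq> X" using widen.hyps(3) widen.prems by (rule order_trans)
  then show ?case using widen.hyps widen.prems
    by (intro reach.widen[OF widen.IH inv_subsp_image[OF \<phi>]]) auto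
next
  case (step S t S')
  have SS: "S \<subset> S'" "S \<subseteq> X" using step by (auto simp: char_step_def)
  then have "\<phi> ` S \<noteq> \<phi> ` S'" using inj step.prems by (auto dest: inj_on_image_eq_iff)
  then show ?case
    by (intro reach.step[OF step.IH[OF SS(2)] inv_subsp_image[OF \<phi> step.hyps(2) step.prems]
        char_step_image[OF \<phi> step.prems step.hyps(2,3)]])
qed

text \<open>A chain of the submodule Z is carried into X and continued by the preimages of a chain
  of Y. These start at the kernel of \<phi>, where the first part ends.\<close>

lemma reaches_extension:
  assumes \<phi>: "hom_on X \<rho> Y \<sigma> \<phi>" and X: "inv_subsp \<rho> X" and surj: "Y \<subseteq> \<phi> ` X"
    and \<psi>: "hom_on Z \<tau> X \<rho> \<psi>" and inj: "inj_on \<psi> Z" and ker: "X \<inter> \<phi> -` {\<lambda>_. 0} = \<psi> ` Z"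
    and Y: "reaches \<sigma> \<epsilon> Y t" and Z: "reaches \<tau> \<epsilon> Z u"
  shows "reaches \<rho> \<epsilon> X (u + t)"
proof -
  obtain t' u' where r: "t \<le> t'" "u \<le> u'" "reach \<sigma> \<epsilon> {\<lambda>_. 0} Y t'" "reach \<tau> \<epsilon> {\<lambda>_. 0} Z u'"
    using Y Z by (auto simp: reaches_def)
  have 1: "reach \<rho> \<epsilon> (\<psi> ` {\<lambda>_. 0}) (\<psi> ` Z) u'" by (rule reach_image[OF \<psi> inj r(4)]) simp
  have 2: "reach \<rho> \<epsilon> (X \<inter> \<phi> -` {\<lambda>_. 0}) (X \<inter> \<phi> -` Y) t'" by (rule reach_vimage[OF \<phi> X surj r(3)]) simp
  have "X \<inter> \<phi> -` Y = X" using hom_onD(2)[OF \<phi>] by auto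
  then have "reach \<rho> \<epsilon> {\<lambda>_. 0} X (u' + t')"
    using reach_trans[OF 2[unfolded ker] 1] ker linear_op_zero[OF hom_onD(1)[OF \<psi>]] by simp
  then show ?thesis unfolding reaches_def using r by (meson add_mono)
qed

lemma reaches_quotient:
  assumes \<phi>: "hom_on X \<rho> Y \<sigma> \<phi>" and X: "inv_subsp \<rho> X" and surj: "Y \<subseteq> \<phi> ` X"
    and lin: "\<And>g. linear_op (\<rho> g)" "\<And>g. linear_op (\<sigma> g)" and Y: "reaches \<sigma> \<epsilon> Y t"
  shows "reaches \<rho> \<epsilon> X t"
proof -
  obtain t' where r: "t \<le> t'" "reach \<sigma> \<epsilon> {\<lambda>_. 0} Y t'" using Y by (auto simp: reaches_def)
  have 2: "reach \<rho> \<epsilon> (X \<inter> \<phi> -` {\<lambda>_. 0}) (X \<inter> \<phi> -` Y) t'" by (rule reach_vimage[OF \<phi> X surj r(2)]) simp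
  have "reach \<rho> \<epsilon> {\<lambda>_. 0} (X \<inter> \<phi> -` {\<lambda>_. 0}) 0"
    using linear_op_zero[OF hom_onD(1)[OF \<phi>]] subsp_zero[OF inv_subsp_subsp[OF X]]
    by (intro reach.widen[OF reach.start] inv_subsp_zero inv_subsp_vimage[OF \<phi> X] lin) auto
  then have "reach \<rho> \<epsilon> {\<lambda>_. 0} (X \<inter> \<phi> -` Y) (0 + t')" using 2 by (rule reach_trans[rotated])
  moreover have "X \<inter> \<phi> -` Y = X" using hom_onD(2)[OF \<phi>] by auto
  ultimately show ?thesis unfolding reaches_def using r by auto
qed

text \<open>Two modules related as below have the same composition factors: each is an extension of
  the same two modules, with the roles of submodule and quotient interchanged. An isomorphism is
  the special case in which one of the two maps is zero.\<close>

definition exchangeable ::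
    "('i \<Rightarrow> complex) set \<Rightarrow> ('g \<Rightarrow> ('i \<Rightarrow> complex) \<Rightarrow> 'i \<Rightarrow> complex) \<Rightarrow> ('j \<Rightarrow> complex) set \<Rightarrow>
     ('g \<Rightarrow> ('j \<Rightarrow> complex) \<Rightarrow> 'j \<Rightarrow> complex) \<Rightarrow> bool" where
  "exchangeable X \<rho> Y \<sigma> \<longleftrightarrow> (\<exists>\<phi> \<psi>. hom_on X \<rho> Y \<sigma> \<phi> \<and> hom_on Y \<sigma> X \<rho> \<psi> \<and>
     X \<inter> \<phi> -` {\<lambda>_. 0} = \<psi> ` Y \<and> Y \<inter> \<psi> -` {\<lambda>_. 0} = \<phi> ` X)"

lemma exchangeable_sym: "exchangeable X \<rho> Y \<sigma> \<Longrightarrow> exchangeable Y \<sigma> X \<rho>"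
  unfolding exchangeable_def by (elim exE conjE) (intro exI conjI; assumption)

text \<open>A chain S of X is split into the images of S under \<phi>, a chain of the submodule
  \<phi> X of Y, and the preimages of S under \<psi>, a chain from \<phi> X = ker \<psi> up to Y.
  Every character step survives in at least one of the two parts.\<close>

lemma exchangeable_reaches:
  assumes ex: "exchangeable X \<rho> Y \<sigma>" and X: "inv_subsp \<rho> X" and Y: "inv_subsp \<sigma> Y"
    and lin: "\<And>g. linear_op (\<rho> g)" "\<And>g. linear_op (\<sigma> g)"
    and r: "reaches \<rho> \<epsilon> X t"
  shows "reaches \<sigma> \<epsilon> Y t"
proof -
  obtain \<phi> \<psi> where \<phi>: "hom_on X \<rho> Y \<sigma> \<phi>" and \<psi>: "hom_on Y \<sigma> X \<rho> \<psi>"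
    and ker\<phi>: "X \<inter> \<phi> -` {\<lambda>_. 0} = \<psi> ` Y" and ker\<psi>: "Y \<inter> \<psi> -` {\<lambda>_. 0} = \<phi> ` X"
    using ex unfolding exchangeable_def by (elim exE conjE)
  note vi = inv_subsp_vimage[OF \<psi> Y] and im = inv_subsp_image[OF \<phi>]
  have main: "\<exists>t1 t2. t \<le> t1 + t2 \<and> reach \<sigma> \<epsilon> {\<lambda>_. 0} (\<phi> ` S) t1 \<and> reach \<sigma> \<epsilon> (\<phi> ` X) (Y \<inter> \<psi> -` S) t2"
    if "reach \<rho> \<epsilon> {\<lambda>_. 0} S t" "S \<subseteq> X" for S t
    using that
  proof (induction rule: reach.induct)
    case start
    have "reach \<sigma> \<epsilon> {\<lambda>_. 0} (\<phi> ` {\<lambda>_. 0}) 0"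
      using linear_op_zero[OF hom_onD(1)[OF \<phi>]] inv_subsp_zero[of \<sigma>, OF lin(2)] by (simp add: reach.start)
    moreover have "reach \<sigma> \<epsilon> (\<phi> ` X) (Y \<inter> \<psi> -` {\<lambda>_. 0}) 0"
      unfolding ker\<psi> by (intro reach.start im X) simp
    ultimately show ?case by auto
  next
    case (widen S t S')
    then obtain t1 t2 where t: "t \<le> t1 + t2" "reach \<sigma> \<epsilon> {\<lambda>_. 0} (\<phi> ` S) t1" "reach \<sigma> \<epsilon> (\<phi> ` X) (Y \<inter> \<psi> -` S) t2"
      by auto
    have "reach \<sigma> \<epsilon> {\<lambda>_. 0} (\<phi> ` S') t1" using widen by (intro reach.widen[OF t(2)] im) auto
    moreover have "reach \<sigma> \<epsilon> (\<phi> ` X) (Y \<inter> \<psi> -` S') t2" using widen by (intro reach.widen[OF t(3)] vi) auto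
    ultimately show ?case using t by blast
  next
    case (step S t S')
    have SS: "S \<subset> S'" "S \<subseteq> X" using step by (auto simp: char_step_def)
    with step obtain t1 t2 where t: "t \<le> t1 + t2" "reach \<sigma> \<epsilon> {\<lambda>_. 0} (\<phi> ` S) t1" "reach \<sigma> \<epsilon> (\<phi> ` X) (Y \<inter> \<psi> -` S) t2"
      by auto
    show ?case
    proof (cases "\<phi> ` S = \<phi> ` S'")
      case False
      have "reach \<sigma> \<epsilon> {\<lambda>_. 0} (\<phi> ` S') (Suc t1)"
        using step by (intro reach.step[OF t(2)] im char_step_image[OF \<phi> _ _ _ False]) auto
      moreover have "reach \<sigma> \<epsilon> (\<phi> ` X) (Y \<inter> \<psi> -` S') t2"
        using step SS by (intro reach.widen[OF t(3)] vi) auto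
      ultimately show ?thesis using t(1) by (metis Suc_le_mono add_Suc)
    next
      case True
      \<comment> \<open>If the images agree, some x in S' outside S differs from an element of S by
        an element of ker \<phi>, hence by some \<psi> z. This z makes the step of the preimages
        strict.\<close>
      obtain x where x: "x \<in> S'" "x \<notin> S" using SS by auto
      then obtain y where y: "y \<in> S" "\<phi> x = \<phi> y" using True by (metis imageE imageI)
      have "(\<lambda>i. x i - y i) \<in> X \<inter> \<phi> -` {\<lambda>_. 0}"
        using x y step.prems SS inv_subsp_subsp[OF X]
        by (auto simp: linear_op_diff[OF hom_onD(1)[OF \<phi>]] intro!: subsp_diff)
      then obtain z where z: "z \<in> Y" "\<psi> z = (\<lambda>i. x i - y i)" unfolding ker\<phi> by (metis imageE)
      have "\<psi> z \<in> S'" unfolding z(2)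
        using x y SS step(2) by (intro subsp_diff inv_subsp_subsp[of \<rho>]) auto
      moreover have "\<psi> z \<notin> S"
      proof
        assume "\<psi> z \<in> S"
        then have "(\<lambda>i. \<psi> z i + y i) \<in> S"
          using y reach_inv_subsp[OF step(1)] by (intro subsp_add inv_subsp_subsp[of \<rho>]) auto
        then show False using x z by simp
      qed
      ultimately have "z \<in> Y \<inter> \<psi> -` S'" "z \<notin> Y \<inter> \<psi> -` S" using z(1) by auto
      then have "Y \<inter> \<psi> -` S \<noteq> Y \<inter> \<psi> -` S'" by metis
      then have "reach \<sigma> \<epsilon> (\<phi> ` X) (Y \<inter> \<psi> -` S') (Suc t2)"
        using step by (intro reach.step[OF t(3)] vi char_step_vimage[OF \<psi> Y]) auto
      then show ?thesis using t True by (metis add_Suc_right Suc_le_mono)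
    qed
  qed
  obtain t' where t': "t \<le> t'" "reach \<rho> \<epsilon> {\<lambda>_. 0} X t'" using r by (auto simp: reaches_def)
  from main[OF t'(2) order_refl] obtain t1 t2 where
    t: "t' \<le> t1 + t2" "reach \<sigma> \<epsilon> {\<lambda>_. 0} (\<phi> ` X) t1" "reach \<sigma> \<epsilon> (\<phi> ` X) (Y \<inter> \<psi> -` X) t2" by auto
  have "Y \<inter> \<psi> -` X = Y" using hom_onD(2)[OF \<psi>] by auto
  then have "reach \<sigma> \<epsilon> {\<lambda>_. 0} Y (t1 + t2)" using reach_trans[OF t(3,2)] by simp
  then show ?thesis unfolding reaches_def using t' t by (meson order_trans)
qed

subsection \<open>Exchanging letters\<close>

text \<open>The map id \<otimes> \<phi>, where the first factor is a two-dimensional letter.\<close>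

definition cons_map :: "op \<Rightarrow> op" where
  "cons_map \<phi> f l = (case l of [] \<Rightarrow> 0 | b # l \<Rightarrow> \<phi> (\<lambda>l. f (b # l)) l)"

lemma cons_map_simps [simp]:
  "cons_map \<phi> f [] = 0" "cons_map \<phi> f (b # l) = \<phi> (\<lambda>l. f (b # l)) l"
  by (simp_all add: cons_map_def)

lemma linear_op_cons_map: "linear_op \<phi> \<Longrightarrow> linear_op (cons_map \<phi>)"
  unfolding linear_op_def by (intro conjI allI ext) (simp_all add: cons_map_def split: list.split)

lemma supp_len_SucI: "f [] = 0 \<Longrightarrow> (\<And>b. (\<lambda>l. f (b # l)) \<in> supp_len n) \<Longrightarrow> f \<in> supp_len (Suc n)"
proof (rule supp_lenI)
  fix l :: "bool list"
  assume "f [] = 0" "\<And>b. (\<lambda>l. f (b # l)) \<in> supp_len n" "length l \<noteq> Suc n"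
  then show "f l = 0" by (cases l) (auto simp: supp_len_def)
qed

text \<open>Tensoring with a letter is exact: kernels and images are formed separately for each
  value of the first sign.\<close>

lemma exchangeable_tens:
  assumes ex: "exchangeable (supp_len n) \<rho> (supp_len n) \<sigma>"
  shows "exchangeable (supp_len (Suc n)) (tens q x \<rho>) (supp_len (Suc n)) (tens q x \<sigma>)"
proof -
  have hom: "hom_on (supp_len (Suc n)) (tens q x \<rho>) (supp_len (Suc n)) (tens q x \<sigma>) (cons_map \<phi>)"
    if \<phi>: "hom_on (supp_len n) \<rho> (supp_len n) \<sigma> \<phi>" for \<rho> \<sigma> \<phi>
    unfolding hom_on_def
  proof (intro conjI allI ballI linear_op_cons_map hom_onD(1)[OF \<phi>])
    fix f assume f: "f \<in> supp_len (Suc n)"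
    then have p: "(\<lambda>l. f (b # l)) \<in> supp_len n" for b by (rule supp_len_part)
    have f0: "f [] = 0" using supp_lenD[OF f, of "[]"] by simp
    show "cons_map \<phi> f \<in> supp_len (Suc n)"
      using hom_onD(2)[OF \<phi> p] by (intro supp_len_SucI) auto
    note L = hom_onD(1)[OF \<phi>]
    show "cons_map \<phi> (tens q x \<rho> g f) = tens q x \<sigma> g (cons_map \<phi> f)" for g
      by (intro fun_eq_boolI; cases g)
        (simp_all add: tens_simps linear_op_add[OF L] linear_op_scale[OF L] hom_onD(3)[OF \<phi> p])
  qed
  have ker: "supp_len (Suc n) \<inter> cons_map \<phi> -` {\<lambda>_. 0} = cons_map \<psi> ` supp_len (Suc n)"
    if \<psi>: "hom_on (supp_len n) \<sigma> (supp_len n) \<rho> \<psi>"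
      and ker: "supp_len n \<inter> \<phi> -` {\<lambda>_. 0} = \<psi> ` supp_len n" for \<phi> \<psi> \<rho> \<sigma>
  proof (intro equalityI subsetI)
    fix f assume "f \<in> supp_len (Suc n) \<inter> cons_map \<phi> -` {\<lambda>_. 0}"
    then have f: "f \<in> supp_len (Suc n)" "cons_map \<phi> f = (\<lambda>_. 0)" by auto
    have "\<phi> (\<lambda>l. f (b # l)) = (\<lambda>_. 0)" for b
      using fun_cong[OF f(2), of "b # _"] by auto
    then have "(\<lambda>l. f (b # l)) \<in> \<psi> ` supp_len n" for b
      using supp_len_part[OF f(1)] unfolding ker[symmetric] by simp
    then obtain h where h: "h b \<in> supp_len n" "(\<lambda>l. f (b # l)) = \<psi> (h b)" for b
      unfolding image_iff by metis
    define g where "g l = (case l of [] \<Rightarrow> 0 | b # l \<Rightarrow> h b l)" for l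
    have "g \<in> supp_len (Suc n)" using h(1) by (intro supp_len_SucI) (auto simp: g_def)
    moreover have "cons_map \<psi> g = f"
      using supp_lenD[OF f(1), of "[]"] h(2) by (intro fun_eq_boolI) (simp_all add: g_def fun_eq_iff)
    ultimately show "f \<in> cons_map \<psi> ` supp_len (Suc n)" by blast
  next
    fix f assume "f \<in> cons_map \<psi> ` supp_len (Suc n)"
    then obtain g where g: "g \<in> supp_len (Suc n)" "f = cons_map \<psi> g" by auto
    have "\<psi> (\<lambda>l. g (b # l)) \<in> supp_len n \<inter> \<phi> -` {\<lambda>_. 0}" for b
      unfolding ker using supp_len_part[OF g(1)] by blast
    then have *: "\<psi> (\<lambda>l. g (b # l)) \<in> supp_len n" "\<phi> (\<psi> (\<lambda>l. g (b # l))) = (\<lambda>_. 0)" for b by auto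
    have "f \<in> supp_len (Suc n)" unfolding g(2) using * by (intro supp_len_SucI) auto
    moreover have "cons_map \<phi> f = (\<lambda>_. 0)"
      unfolding g(2) by (intro fun_eq_boolI) (simp_all add: *)
    ultimately show "f \<in> supp_len (Suc n) \<inter> cons_map \<phi> -` {\<lambda>_. 0}" by simp
  qed
  from ex obtain \<phi> \<psi> where "hom_on (supp_len n) \<rho> (supp_len n) \<sigma> \<phi>" "hom_on (supp_len n) \<sigma> (supp_len n) \<rho> \<psi>"
    "supp_len n \<inter> \<phi> -` {\<lambda>_. 0} = \<psi> ` supp_len n" "supp_len n \<inter> \<psi> -` {\<lambda>_. 0} = \<phi> ` supp_len n"
    unfolding exchangeable_def by (elim exE conjE)
  then show ?thesis unfolding exchangeable_def
    by (intro exI[of _ "cons_map \<phi>"] exI[of _ "cons_map \<psi>"] conjI hom ker)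
qed

definition rmat :: "complex \<Rightarrow> complex \<Rightarrow> complex \<Rightarrow> op" where
  "rmat q z y f l = (case l of b # c # l \<Rightarrow>
      if b = c then (q * y - inverse q * z) * f (b # c # l)
      else if c then (q - inverse q) * z * f (False # True # l) + (y - z) * f (True # False # l)
      else (y - z) * f (False # True # l) + (q - inverse q) * y * f (True # False # l)
    | _ \<Rightarrow> 0)"

lemma rmat_simps [simp]:
  "rmat q z y f [] = 0" "rmat q z y f [b] = 0"
  "rmat q z y f (False # False # l) = (q * y - inverse q * z) * f (False # False # l)"
  "rmat q z y f (True # True # l) = (q * y - inverse q * z) * f (True # True # l)"
  "rmat q z y f (False # True # l) = (q - inverse q) * z * f (False # True # l) + (y - z) * f (True # False # l)"
  "rmat q z y f (True # False # l) = (y - z) * f (False # True # l) + (q - inverse q) * y * f (True # False # l)"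
  by (simp_all add: rmat_def)

lemma fun_eq_boolI2:
  assumes "f [] = g []" "\<And>b. f [b] = g [b]" "\<And>l. f (False # False # l) = g (False # False # l)"
    "\<And>l. f (False # True # l) = g (False # True # l)" "\<And>l. f (True # False # l) = g (True # False # l)"
    "\<And>l. f (True # True # l) = g (True # True # l)"
  shows "f = g"
proof (rule ext)
  fix l :: "bool list"
  consider "l = []" | b where "l = [b]" | b c l' where "l = b # c # l'" by (cases l; cases "tl l") auto
  then show "f l = g l"
  proof cases
    case 3
    then show ?thesis using assms by (cases b; cases c) auto
  qed (use assms in auto)
qed

lemma linear_op_rmat: "linear_op (rmat q z y)"
  unfolding linear_op_def by (intro conjI allI fun_eq_boolI2) (simp_all add: algebra_simps)

lemma rmat_supp_len: "f \<in> supp_len (Suc (Suc n)) \<Longrightarrow> rmat q z y f \<in> supp_len (Suc (Suc n))"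
  using supp_lenD[of f] by (intro supp_lenI) (auto simp: rmat_def split: list.split)

lemma hom_on_rmat:
  assumes q: "q \<noteq> 0" and zy: "z \<noteq> 0" "y \<noteq> 0" and lin: "\<And>g. linear_op (\<rho> g)"
  shows "hom_on (supp_len (Suc (Suc n))) (tens q z (tens q y \<rho>)) (supp_len (Suc (Suc n))) (tens q y (tens q z \<rho>)) (rmat q z y)"
  unfolding hom_on_def
proof (intro conjI allI ballI linear_op_rmat rmat_supp_len)
  fix g f assume f: "f \<in> supp_len (Suc (Suc n))"
  have f0: "f [] = 0" "f [b] = 0" for b using supp_lenD[OF f] by simp_all
  show "rmat q z y (tens q z (tens q y \<rho>) g f) = tens q y (tens q z \<rho>) g (rmat q z y f)"
    using q zy
    by (intro fun_eq_boolI2; cases g)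
      (simp_all add: tens_simps f0 tens_def[of _ _ _ _ _ "[_]"] linear_op_add[OF lin] linear_op_scale[OF lin] linear_op_diff[OF lin] split: if_splits,
        (simp_all add: field_simps)?)
qed

text \<open>In either order the two R-matrices compose to the scalar (q y - z/q)(q z - y/q). If it
  is nonzero they are isomorphisms. If z = q^2 y or y = q^2 z, they have ranks 1 and 3 on the two
  exchanged factors, and the kernel of each is the image of the other.\<close>

lemma exchangeable_swap:
  assumes q: "q \<noteq> 0" "\<And>k::nat. k > 0 \<Longrightarrow> q ^ k \<noteq> 1"
    and zy: "z \<noteq> 0" "y \<noteq> 0" and lin: "\<And>g. linear_op (\<rho> g)"
  shows "exchangeable (supp_len (Suc (Suc n))) (tens q z (tens q y \<rho>)) (supp_len (Suc (Suc n))) (tens q y (tens q z \<rho>))"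
proof -
  let ?X = "supp_len (Suc (Suc n))"
  have sl: "(\<lambda>l. case l of b # c # l' \<Rightarrow> F b c l' | _ \<Rightarrow> 0) \<in> ?X"
    if "\<And>b c l'. length l' \<noteq> n \<Longrightarrow> F b c l' = 0" for F
    by (rule supp_lenI) (auto simp: that split: list.split)
  have q2: "q^2 \<noteq> 1" "q^4 \<noteq> 1" using q(2)[of 2] q(2)[of 4] by auto
  have resonant: "exchangeable ?X (tens q z (tens q y \<rho>)) ?X (tens q y (tens q z \<rho>))"
    if z: "z = q^2 * y" and zy: "z \<noteq> 0" "y \<noteq> 0" for z y
    unfolding exchangeable_def
  proof (intro exI conjI)
    show "hom_on ?X (tens q z (tens q y \<rho>)) ?X (tens q y (tens q z \<rho>)) (rmat q z y)"
      by (rule hom_on_rmat) (use q zy lin in auto)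
    show "hom_on ?X (tens q y (tens q z \<rho>)) ?X (tens q z (tens q y \<rho>)) (rmat q y z)"
      by (rule hom_on_rmat) (use q zy lin in auto)
    have d: "y * (q^2 - 1) \<noteq> 0" using zy q2 by simp
    have e: "q * z - inverse q * y \<noteq> 0" 
    proof
      assume "q * z - inverse q * y = 0"
      then have "y * (q^4 - 1) = 0" using q(1) unfolding z by (simp add: field_simps eval_nat_numeral)
      then show False using zy q2 by simp
    qed
    have r0: "q * y - inverse q * z = 0" using q(1) by (simp add: z field_simps power2_eq_square)
    have comp1: "rmat q z y (rmat q y z g) = (\<lambda>_. 0)" for g
      using q(1) by (intro fun_eq_boolI2) (simp_all add: r0, (simp_all add: z field_simps eval_nat_numeral)?)
    have comp2: "rmat q y z (rmat q z y g) = (\<lambda>_. 0)" for g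
      using q(1) by (intro fun_eq_boolI2) (simp_all add: r0, (simp_all add: z field_simps eval_nat_numeral)?)
    show "?X \<inter> rmat q z y -` {\<lambda>_. 0} = rmat q y z ` ?X"
    proof (intro equalityI subsetI)
      fix f assume "f \<in> ?X \<inter> rmat q z y -` {\<lambda>_. 0}"
      then have f: "f \<in> ?X" "rmat q z y f = (\<lambda>_. 0)" by auto
      have "y * (q^2 - 1) * (q * f (False # True # l) - f (True # False # l)) = rmat q z y f (False # True # l)" for l
        using q(1) by (simp add: z field_simps power2_eq_square)
      then have "q * f (False # True # l) - f (True # False # l) = 0" for l using d f(2) by simp
      then have rel: "f (True # False # l) = q * f (False # True # l)" for l by simp
      \<comment> \<open>On equal signs the map is a nonzero scalar. On the two mixed signs it has
        rank one, so the preimage may be placed on \<open>False # True\<close> alone;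
        \<open>rel\<close> then makes the other component correct.\<close>
      define g where "g l = (case l of b # c # l' \<Rightarrow> if b = c then f (b # c # l') / (q * z - inverse q * y)
          else if c then f (False # True # l') * q / (y * (q^2 - 1)) else 0 | _ \<Rightarrow> 0)" for l
      have "g \<in> ?X" unfolding g_def by (rule sl) (auto simp: supp_lenD[OF f(1)])
      moreover have "rmat q y z g = f"
      proof (intro fun_eq_boolI2)
        show "rmat q y z g (False # True # l) = f (False # True # l)" for l
          using q(1) d zy by (simp add: g_def z field_simps power2_eq_square)
        show "rmat q y z g (True # False # l) = f (True # False # l)" for l
          using q(1) d zy by (simp add: g_def z rel field_simps power2_eq_square)
      qed (use supp_lenD[OF f(1)] e in \<open>simp_all add: g_def\<close>)
      ultimately show "f \<in> rmat q y z ` ?X" by blast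
    qed (use comp1 rmat_supp_len in auto)
    show "?X \<inter> rmat q y z -` {\<lambda>_. 0} = rmat q z y ` ?X"
    proof (intro equalityI subsetI)
      fix f assume "f \<in> ?X \<inter> rmat q y z -` {\<lambda>_. 0}"
      then have f: "f \<in> ?X" "rmat q y z f = (\<lambda>_. 0)" by auto
      have "y * (q^2 - 1) * (f (False # True # l) + q * f (True # False # l)) = rmat q y z f (True # False # l)" for l
        using q(1) by (simp add: z field_simps power2_eq_square)
      then have "f (False # True # l) + q * f (True # False # l) = 0" for l using d f(2) by simp
      then have rel: "f (False # True # l) = - (q * f (True # False # l))" for l by (simp add: eq_neg_iff_add_eq_0)
      have f0: "f (False # False # l) = 0" "f (True # True # l) = 0" for l
        using fun_cong[OF f(2), of "False # False # l"] fun_cong[OF f(2), of "True # True # l"] e by simp_all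
      \<comment> \<open>The map of rank one: a preimage supported on \<open>True # False\<close>
        suffices, and its coefficient there is y - z = - y (q^2 - 1).\<close>
      define g where "g l = (case l of b # c # l' \<Rightarrow> if b \<and> \<not> c then - f (False # True # l') / (y * (q^2 - 1)) else 0 | _ \<Rightarrow> 0)" for l
      have "g \<in> ?X" unfolding g_def by (rule sl) (auto simp: supp_lenD[OF f(1)])
      moreover have "rmat q z y g = f"
      proof (intro fun_eq_boolI2)
        show "rmat q z y g (False # True # l) = f (False # True # l)" for l
          using q(1) d zy by (simp add: g_def z field_simps power2_eq_square)
        show "rmat q z y g (True # False # l) = f (True # False # l)" for l
          using q(1) d zy by (simp add: g_def z rel field_simps power2_eq_square)
      qed (use supp_lenD[OF f(1)] f0 in \<open>simp_all add: g_def\<close>)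
      ultimately show "f \<in> rmat q z y ` ?X" by blast
    qed (use comp2 rmat_supp_len in auto)
  qed
  show ?thesis
  proof (cases "z = q^2 * y \<or> y = q^2 * z")
    case True
    then show ?thesis using resonant[of z y] resonant[of y z] zy exchangeable_sym by blast
  next
    case False
    \<comment> \<open>Unitarity of the R-matrix: the scalar of the two compositions, nonzero in the
      present case.\<close>
    define c where "c = (q * y - inverse q * z) * (q * z - inverse q * y)"
    have "q * y - inverse q * z \<noteq> 0" "q * z - inverse q * y \<noteq> 0"
      using False q(1) by (auto simp: field_simps power2_eq_square)
    then have c: "c \<noteq> 0" unfolding c_def by simp
    have inv: "rmat q z y (rmat q y z f) = (\<lambda>l. c * f l)" "rmat q y z (rmat q z y f) = (\<lambda>l. c * f l)"
      if f: "f \<in> ?X" for f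
      using supp_lenD[OF f] q(1)
      by (intro fun_eq_boolI2, simp_all add: c_def, (simp_all add: field_simps)?)+
    have sc: "(\<lambda>l. d * f l) \<in> ?X" if "f \<in> ?X" for d f using that by (auto simp: supp_len_def)
    have z0: "(\<lambda>_. 0) \<in> ?X" by (simp add: supp_len_def)
    show ?thesis unfolding exchangeable_def
    proof (intro exI conjI)
      show "hom_on ?X (tens q z (tens q y \<rho>)) ?X (tens q y (tens q z \<rho>)) (rmat q z y)"
        by (rule hom_on_rmat) (use q zy lin in auto)
      show "hom_on ?X (tens q y (tens q z \<rho>)) ?X (tens q z (tens q y \<rho>)) (\<lambda>f l. 0)"
        using linear_op_zero[OF linear_op_tens[OF linear_op_tens[OF lin]]] z0
        by (simp add: hom_on_def linear_op_def)
      show "?X \<inter> rmat q z y -` {\<lambda>_. 0} = (\<lambda>f l. 0) ` ?X"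
      proof (intro equalityI subsetI)
        fix f assume "f \<in> ?X \<inter> rmat q z y -` {\<lambda>_. 0}"
        then have "f \<in> ?X" "rmat q z y f = (\<lambda>_. 0)" by auto
        then have "(\<lambda>l. c * f l) = (\<lambda>_. 0)" using inv(2)[of f] linear_op_zero[OF linear_op_rmat] by simp
        then have "f = (\<lambda>_. 0)" using c by (simp add: fun_eq_iff)
        then show "f \<in> (\<lambda>f l. 0) ` ?X" using z0 by auto
      qed (use z0 linear_op_zero[OF linear_op_rmat] in auto)
      show "?X \<inter> (\<lambda>f l. 0) -` {\<lambda>_. 0} = rmat q z y ` ?X"
      proof (intro equalityI subsetI)
        fix f assume "f \<in> ?X \<inter> (\<lambda>f l. 0) -` {\<lambda>_. 0}"
        then have f: "f \<in> ?X" by auto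
        have "f = rmat q z y (rmat q y z (\<lambda>l. inverse c * f l))" using c inv(1)[OF sc[OF f]] by (simp add: mult.assoc[symmetric])
        then show "f \<in> rmat q z y ` ?X" using rmat_supp_len[OF sc[OF f]] by (rule image_eqI)
      qed (use rmat_supp_len in auto)
    qed
  qed
qed


section \<open>String modules\<close>

definition qint :: "complex \<Rightarrow> complex \<Rightarrow> complex" where
  "qint q s = (s - inverse s) / (q - inverse q)"

text \<open>The tensor product of the evaluation module with basis \<open>v 0, \<dots>, v k\<close> attached to the string
  \<open>a, a + 2, \<dots>, a + 2 (k - 1)\<close> with the module \<open>\<rho>\<close>. Quantum integers are given by the powers of \<open>q\<close>
  they depend on: the action on \<open>v i\<close> is \<open>F1 v\<^sub>i = [k - i] v\<^sub>i\<^sub>+\<^sub>1\<close> and \<open>E1 v\<^sub>i = [i] v\<^sub>i\<^sub>-\<^sub>1\<close>.\<close>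

definition strmod :: "complex \<Rightarrow> int \<Rightarrow> nat \<Rightarrow> (U_gen \<Rightarrow> op) \<Rightarrow>
    U_gen \<Rightarrow> (nat \<times> bool list \<Rightarrow> complex) \<Rightarrow> nat \<times> bool list \<Rightarrow> complex" where
  "strmod q a k \<rho> g f p = (let i = fst p; l = snd p; \<zeta> = q powi a * q ^ k / q;
      h = (\<lambda>j l. f (j, l)) in case g of
      K \<Rightarrow> q ^ k / q ^ (2 * i) * \<rho> K (h i) l
    | K_inv \<Rightarrow> q ^ (2 * i) / q ^ k * \<rho> K_inv (h i) l
    | E1 \<Rightarrow> qint q (q ^ Suc i) * \<rho> K (h (Suc i)) l + \<rho> E1 (h i) l
    | F0 \<Rightarrow> inverse \<zeta> * qint q (q ^ Suc i) * h (Suc i) l + q ^ k / q ^ (2 * i) * \<rho> F0 (h i) l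
    | F1 \<Rightarrow> (if i = 0 then 0 else qint q (q ^ Suc k / q ^ i) * h (i - 1) l) + q ^ (2 * i) / q ^ k * \<rho> F1 (h i) l
    | E0 \<Rightarrow> (if i = 0 then 0 else \<zeta> * qint q (q ^ Suc k / q ^ i) * \<rho> K_inv (h (i - 1)) l) + \<rho> E0 (h i) l)"

definition strspace :: "nat \<Rightarrow> nat \<Rightarrow> (nat \<times> bool list \<Rightarrow> complex) set" where
  "strspace k n = {f. (\<forall>i. (\<lambda>l. f (i, l)) \<in> supp_len n) \<and> (\<forall>i>k. \<forall>l. f (i, l) = 0)}"

lemma linear_op_divide: "linear_op T \<Longrightarrow> T (\<lambda>i. f i / c) = (\<lambda>i. T f i / c)"
  using linear_op_scale[of T "inverse c" f] by (simp add: divide_inverse mult.commute)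

lemma linear_op_minus: "linear_op T \<Longrightarrow> T (\<lambda>i. - f i) = (\<lambda>i. - T f i)"
  using linear_op_scale[of T "-1" f] by simp

lemma linear_op_strmod:
  assumes lin: "\<And>g. linear_op (\<rho> g)"
  shows "linear_op (strmod q a k \<rho> g)"
  unfolding linear_op_def
  by (intro conjI allI ext; cases g)
    (simp_all add: strmod_def Let_def linear_op_add[OF lin] linear_op_scale[OF lin] algebra_simps add_divide_distrib)

lemma subsp_supp_len: "subsp (supp_len n)"
  unfolding supp_len_flag by (rule subsp_flag)

lemma subsp_strspace: "subsp (strspace k n)"
  using subsp_add[OF subsp_supp_len] subsp_scale[OF subsp_supp_len] subsp_zero[OF subsp_supp_len]
  by (auto simp: subsp_def strspace_def)

text \<open>The action is written without a cutoff at $v_k$. It is built into the coefficient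
  [k + 1 - i] of F1 and E0, which vanishes at i = k + 1; at larger i the entry i - 1 is already
  outside the support.\<close>

lemma inv_subsp_strspace:
  assumes q: "q \<noteq> 0" and lin: "\<And>g. linear_op (\<rho> g)" and inv: "\<And>g f. f \<in> supp_len n \<Longrightarrow> \<rho> g f \<in> supp_len n"
  shows "inv_subsp (strmod q a k \<rho>) (strspace k n)"
  unfolding inv_subsp_def
proof (intro conjI allI ballI subsp_strspace)
  fix g f assume f: "f \<in> strspace k n"
  have p: "(\<lambda>l. f (i, l)) \<in> supp_len n" for i using f by (simp add: strspace_def)
  have big: "f (i, l) = 0" if "i > k" for i l using f that by (simp add: strspace_def)
  have z: "\<rho> g (\<lambda>l. f (i, l)) l = 0" if "length l \<noteq> n" for g i l
    using supp_lenD[OF inv[OF p] that] .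
  have b: "(\<lambda>l. f (i, l)) = (\<lambda>_. 0)" if "i > k" for i using big[OF that] by auto
  have b1: "qint q (q ^ Suc k / q ^ i) * f (i - 1, l) = 0" if "i > k" for i l
  proof (cases "i = Suc k")
    case True then show ?thesis using q by (simp add: qint_def)
  qed (use that in \<open>simp add: big\<close>)
  have b2: "qint q (q ^ Suc k / q ^ i) * \<rho> g (\<lambda>l. f (i - 1, l)) l = 0" if "i > k" for g i l
  proof (cases "i = Suc k")
    case True then show ?thesis using q by (simp add: qint_def)
  qed (use that in \<open>simp add: b linear_op_zero[OF lin]\<close>)
  show "strmod q a k \<rho> g f \<in> strspace k n" unfolding strspace_def mem_Collect_eq
  proof (intro conjI allI impI supp_lenI)
    fix i and l :: "bool list" assume "length l \<noteq> n"
    then show "strmod q a k \<rho> g f (i, l) = 0"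
      using z supp_lenD[OF p, of l] by (cases g) (simp_all add: strmod_def Let_def)
  next
    fix i l assume i: "k < i"
    then show "strmod q a k \<rho> g f (i, l) = 0"
      using b1[OF i] b2[OF i] by (cases g) (simp_all add: strmod_def Let_def b linear_op_zero[OF lin] big)
  qed
qed

definition part_map :: "op \<Rightarrow> (nat \<times> bool list \<Rightarrow> complex) \<Rightarrow> nat \<times> bool list \<Rightarrow> complex" where
  "part_map \<phi> f p = \<phi> (\<lambda>l. f (fst p, l)) (snd p)"

text \<open>Tensoring with the string module is exact for the same reason as with a letter:
  everything is formed separately for each basis vector of the string.\<close>

lemma exchangeable_strmod:
  assumes ex: "exchangeable (supp_len n) \<rho> (supp_len n) \<sigma>"
  shows "exchangeable (strspace k n) (strmod q a k \<rho>) (strspace k n) (strmod q a k \<sigma>)"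
proof -
  have hom: "hom_on (strspace k n) (strmod q a k \<rho>) (strspace k n) (strmod q a k \<sigma>) (part_map \<phi>)"
    if \<phi>: "hom_on (supp_len n) \<rho> (supp_len n) \<sigma> \<phi>" for \<rho> \<sigma> \<phi>
    unfolding hom_on_def
  proof (intro conjI allI ballI)
    note L = hom_onD(1)[OF \<phi>]
    show "linear_op (part_map \<phi>)" unfolding linear_op_def
      by (intro conjI allI ext) (simp_all add: part_map_def linear_op_add[OF L] linear_op_scale[OF L])
    fix f assume f: "f \<in> strspace k n"
    then have p: "(\<lambda>l. f (i, l)) \<in> supp_len n" for i by (simp add: strspace_def)
    have big: "(\<lambda>l. f (i, l)) = (\<lambda>_. 0)" if "i > k" for i using f that by (auto simp: strspace_def)
    show "part_map \<phi> f \<in> strspace k n"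
      using hom_onD(2)[OF \<phi> p] by (auto simp: strspace_def part_map_def big linear_op_zero[OF L])
    show "part_map \<phi> (strmod q a k \<rho> g f) = strmod q a k \<sigma> g (part_map \<phi> f)" for g
    proof (rule ext)
      fix p :: "nat \<times> bool list"
      show "part_map \<phi> (strmod q a k \<rho> g f) p = strmod q a k \<sigma> g (part_map \<phi> f) p"
        by (cases g; cases "fst p = 0")
          (simp_all add: part_map_def strmod_def Let_def linear_op_add[OF L] linear_op_scale[OF L] linear_op_divide[OF L] hom_onD(3)[OF \<phi> p])
    qed
  qed
  have ker: "strspace k n \<inter> part_map \<phi> -` {\<lambda>_. 0} = part_map \<psi> ` strspace k n"
    if \<phi>: "hom_on (supp_len n) \<rho> (supp_len n) \<sigma> \<phi>" and \<psi>: "hom_on (supp_len n) \<sigma> (supp_len n) \<rho> \<psi>"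
      and ker: "supp_len n \<inter> \<phi> -` {\<lambda>_. 0} = \<psi> ` supp_len n"
    for \<phi> \<psi> and \<rho> \<sigma> :: "U_gen \<Rightarrow> op"
  proof (intro equalityI subsetI)
    fix f assume "f \<in> strspace k n \<inter> part_map \<phi> -` {\<lambda>_. 0}"
    then have f: "f \<in> strspace k n" "part_map \<phi> f = (\<lambda>_. 0)" by auto
    have "\<phi> (\<lambda>l. f (i, l)) = (\<lambda>_. 0)" for i
      using fun_cong[OF f(2), of "(i, _)"] by (auto simp: part_map_def)
    then have "(\<lambda>l. f (i, l)) \<in> \<psi> ` supp_len n" for i
      using f(1) unfolding ker[symmetric] by (simp add: strspace_def)
    then obtain h where h: "h i \<in> supp_len n" "(\<lambda>l. f (i, l)) = \<psi> (h i)" for i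
      unfolding image_iff by metis
    define g where "g p = (if fst p \<le> k then h (fst p) (snd p) else 0)" for p
    have gl: "(\<lambda>l. g (i, l)) = (if i \<le> k then h i else (\<lambda>_. 0))" for i by (auto simp: g_def)
    have "g \<in> strspace k n" using h(1) subsp_zero[OF subsp_supp_len] by (auto simp: strspace_def gl) (simp add: g_def)
    moreover have "part_map \<psi> g = f"
    proof (rule ext)
      fix p :: "nat \<times> bool list"
      show "part_map \<psi> g p = f p"
        using f(1) fun_cong[OF h(2)[of "fst p"], of "snd p"] linear_op_zero[OF hom_onD(1)[OF \<psi>]]
        by (cases p) (auto simp: part_map_def gl strspace_def)
    qed
    ultimately show "f \<in> part_map \<psi> ` strspace k n" by blast
  next
    fix f assume "f \<in> part_map \<psi> ` strspace k n"
    then obtain g where g: "g \<in> strspace k n" "f = part_map \<psi> g" by auto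
    then have gp: "(\<lambda>l. g (i, l)) \<in> supp_len n" for i by (simp add: strspace_def)
    have "\<psi> (\<lambda>l. g (i, l)) \<in> supp_len n \<inter> \<phi> -` {\<lambda>_. 0}" for i
      unfolding ker using gp by blast
    then have *: "\<phi> (\<psi> (\<lambda>l. g (i, l))) = (\<lambda>_. 0)" for i by auto
    have "f \<in> strspace k n" unfolding g(2) using hom_onD(2)[OF hom[OF \<psi>] g(1)] .
    moreover have "part_map \<phi> f = (\<lambda>_. 0)"
      unfolding g(2) part_map_def fst_conv snd_conv * by simp
    ultimately show "f \<in> strspace k n \<inter> part_map \<phi> -` {\<lambda>_. 0}" by simp
  qed
  from ex obtain \<phi> \<psi> where "hom_on (supp_len n) \<rho> (supp_len n) \<sigma> \<phi>" "hom_on (supp_len n) \<sigma> (supp_len n) \<rho> \<psi>"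
    "supp_len n \<inter> \<phi> -` {\<lambda>_. 0} = \<psi> ` supp_len n" "supp_len n \<inter> \<psi> -` {\<lambda>_. 0} = \<phi> ` supp_len n"
    unfolding exchangeable_def by (elim exE conjE)
  then show ?thesis unfolding exchangeable_def
    by (intro exI[of _ "part_map \<phi>"] exI[of _ "part_map \<psi>"] conjI hom ker)
qed

subsection \<open>Resolving a string and a letter\<close>

definition merge_map :: "complex \<Rightarrow> (nat \<times> bool list \<Rightarrow> complex) \<Rightarrow> nat \<times> bool list \<Rightarrow> complex" where
  "merge_map q f p = q ^ fst p * f (fst p, False # snd p) + (if fst p = 0 then 0 else f (fst p - 1, True # snd p))"

definition split_map :: "complex \<Rightarrow> (nat \<times> bool list \<Rightarrow> complex) \<Rightarrow> nat \<times> bool list \<Rightarrow> complex" where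
  "split_map q f p = (case snd p of [] \<Rightarrow> 0
    | b # l \<Rightarrow> if b then - (q ^ Suc (fst p)) * f (fst p, l) else if fst p = 0 then 0 else f (fst p - 1, l))"

lemma merge_map_simps: "merge_map q f (0, l) = f (0, False # l)"
  "merge_map q f (Suc i, l) = q * q ^ i * f (Suc i, False # l) + f (i, True # l)"
  by (simp_all add: merge_map_def)

lemma split_map_simps: "split_map q f (i, []) = 0" "split_map q f (0, False # l) = 0"
  "split_map q f (Suc i, False # l) = f (i, l)" "split_map q f (i, True # l) = - (q * q ^ i * f (i, l))"
  by (simp_all add: split_map_def)

lemma strmod_simps:
  "strmod q a k \<rho> K f (i, l) = q ^ k / (q ^ i * q ^ i) * \<rho> K (\<lambda>l. f (i, l)) l"
  "strmod q a k \<rho> K_inv f (i, l) = q ^ i * q ^ i / q ^ k * \<rho> K_inv (\<lambda>l. f (i, l)) l"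
  "strmod q a k \<rho> E1 f (i, l) = qint q (q * q ^ i) * \<rho> K (\<lambda>l. f (Suc i, l)) l + \<rho> E1 (\<lambda>l. f (i, l)) l"
  "strmod q a k \<rho> F0 f (i, l) = inverse (q powi a * q ^ k / q) * qint q (q * q ^ i) * f (Suc i, l) + q ^ k / (q ^ i * q ^ i) * \<rho> F0 (\<lambda>l. f (i, l)) l"
  "strmod q a k \<rho> F1 f (0, l) = 1 / q ^ k * \<rho> F1 (\<lambda>l. f (0, l)) l"
  "strmod q a k \<rho> F1 f (Suc i, l) = qint q (q ^ k / q ^ i) * f (i, l) + (q * q) * (q ^ i * q ^ i) / q ^ k * \<rho> F1 (\<lambda>l. f (Suc i, l)) l"
  "strmod q a k \<rho> E0 f (0, l) = \<rho> E0 (\<lambda>l. f (0, l)) l"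
  "strmod q a k \<rho> E0 f (Suc i, l) = (q powi a * q ^ k / q) * qint q (q ^ k / q ^ i) * \<rho> K_inv (\<lambda>l. f (i, l)) l + \<rho> E0 (\<lambda>l. f (Suc i, l)) l"
  if "q \<noteq> 0"
  using that by (simp_all add: strmod_def Let_def power_add mult_2)

lemma powi_double_nat: "(q::complex) \<noteq> 0 \<Longrightarrow> q powi (a + 2 * int k) = q powi a * (q ^ k * q ^ k)"
proof -
  assume q: "q \<noteq> 0"
  have "q powi (a + 2 * int k) = q powi a * q powi (int (2 * k))"
    using q by (subst power_int_add[symmetric]) simp_all
  also have "q powi (int (2 * k)) = q ^ k * q ^ k" unfolding power_int_of_nat by (simp add: mult_2 power_add)
  finally show ?thesis .
qed

lemma hom_on_merge:
  assumes q: "q \<noteq> 0" "q^2 \<noteq> 1" and lin: "\<And>g. linear_op (\<rho> g)"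
    and inv: "\<And>g f. f \<in> supp_len n \<Longrightarrow> \<rho> g f \<in> supp_len n"
  shows "hom_on (strspace k (Suc n)) (strmod q a k (tens q (q powi (a + 2 * int k)) \<rho>))
    (strspace (Suc k) n) (strmod q a (Suc k) \<rho>) (merge_map q)"
  unfolding hom_on_def
proof (intro conjI allI ballI)
  show lm: "linear_op (merge_map q)" unfolding linear_op_def
    by (intro conjI allI ext) (simp_all add: merge_map_def algebra_simps)
  fix f assume f: "f \<in> strspace k (Suc n)"
  have fz: "f (i, l) = 0" if "i > k \<or> length l \<noteq> Suc n" for i l
    using f that by (auto simp: strspace_def dest: supp_lenD)
  have m: "merge_map q f (i, l) = 0" if "i > Suc k \<or> length l \<noteq> n" for i l
    using that fz[of i "False # l"] fz[of "i - 1" "True # l"] by (cases i) (auto simp: merge_map_simps)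
  show "merge_map q f \<in> strspace (Suc k) n"
    unfolding strspace_def mem_Collect_eq by (intro conjI allI impI supp_lenI m) simp_all
  fix g
  have qq: "q * q \<noteq> 1" "q powi a \<noteq> 0" "q powi (a + 2 * int k) = q powi a * (q ^ k * q ^ k)"
    using q powi_double_nat[OF q(1)] by (simp_all add: power2_eq_square)
  have ne: "q ^ j \<noteq> 0" for j using q by simp
  \<comment> \<open>The common denominator of the quantum integers is kept as an atom until the
    other fractions are cleared.\<close>
  define D where "D = q - inverse q"
  have D: "D \<noteq> 0" using q by (simp add: D_def field_simps power2_eq_square)
  have qd: "qint q s = (s - inverse s) / D" for s by (simp add: qint_def D_def)
  show "merge_map q (strmod q a k (tens q (q powi (a + 2 * int k)) \<rho>) g f) = strmod q a (Suc k) \<rho> g (merge_map q f)"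
  proof (rule ext, clarify)
    fix i l
    show "merge_map q (strmod q a k (tens q (q powi (a + 2 * int k)) \<rho>) g f) (i, l) = strmod q a (Suc k) \<rho> g (merge_map q f) (i, l)"
      using q qq ne D
      by (cases g; cases i; cases "i - 1") (simp_all add: strmod_simps merge_map_simps tens_simps linear_op_add[OF lin] linear_op_scale[OF lin],
        (simp_all add: qd field_simps)?, (simp_all add: D_def field_simps)?)
  qed
qed

lemma hom_on_split:
  assumes q: "q \<noteq> 0" "q^2 \<noteq> 1" and lin: "\<And>g. linear_op (\<rho> g)"
  shows "hom_on (strspace k n) (strmod q a k \<rho>)
    (strspace (Suc k) (Suc n)) (strmod q a (Suc k) (tens q (q powi (a + 2 * int (Suc k))) \<rho>)) (split_map q)"
  unfolding hom_on_def
proof (intro conjI allI ballI)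
  show lm: "linear_op (split_map q)" unfolding linear_op_def
    by (intro conjI allI ext) (simp_all add: split_map_def algebra_simps split: list.split)
  fix f assume f: "f \<in> strspace k n"
  have fz: "f (i, l) = 0" if "i > k \<or> length l \<noteq> n" for i l
    using f that by (auto simp: strspace_def dest: supp_lenD)
  have m: "split_map q f (i, l) = 0" if "i > Suc k \<or> length l \<noteq> Suc n" for i l
    using that fz[of i "tl l"] fz[of "i - 1" "tl l"] by (cases i; cases l; cases "hd l") (auto simp: split_map_simps)
  show "split_map q f \<in> strspace (Suc k) (Suc n)"
    unfolding strspace_def mem_Collect_eq by (intro conjI allI impI supp_lenI m) simp_all
  fix g
  have qq: "q * q \<noteq> 1" "q powi a \<noteq> 0" "q powi (a + 2 * int (Suc k)) = q powi a * (q * q * (q ^ k * q ^ k))"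
    using q powi_double_nat[OF q(1), of a "Suc k"] by (simp_all add: power2_eq_square del: of_nat_Suc)
  have ne: "q ^ j \<noteq> 0" for j using q by simp
  define D where "D = q - inverse q"
  have D: "D \<noteq> 0" using q by (simp add: D_def field_simps power2_eq_square)
  have qd: "qint q s = (s - inverse s) / D" for s by (simp add: qint_def D_def)
  show "split_map q (strmod q a k \<rho> g f) = strmod q a (Suc k) (tens q (q powi (a + 2 * int (Suc k))) \<rho>) g (split_map q f)"
  proof (rule ext, clarify)
    fix i and l :: "bool list"
    consider "l = []" | l' where "l = False # l'" | l' where "l = True # l'" by (cases l; cases "hd l") auto
    then show "split_map q (strmod q a k \<rho> g f) (i, l) = strmod q a (Suc k) (tens q (q powi (a + 2 * int (Suc k))) \<rho>) g (split_map q f) (i, l)"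
    proof cases
      case 1
      then show ?thesis using q qq ne D
        by (cases g; cases i; cases "i - 1") (simp_all add: strmod_simps split_map_simps tens_simps linear_op_zero[OF lin] linear_op_minus[OF lin] linear_op_scale[OF lin],
          (simp_all add: qd field_simps)?, (simp_all add: D_def field_simps)?)
    next
      case (2 l')
      then show ?thesis using q qq ne D
        by (cases g; cases i; cases "i - 1") (simp_all add: strmod_simps split_map_simps tens_simps linear_op_zero[OF lin] linear_op_minus[OF lin] linear_op_scale[OF lin],
          (simp_all add: qd field_simps)?, (simp_all add: D_def field_simps)?)
    next
      case (3 l')
      then show ?thesis using q qq ne D
        by (cases g; cases i; cases "i - 1") (simp_all add: strmod_simps split_map_simps tens_simps linear_op_zero[OF lin] linear_op_minus[OF lin] linear_op_scale[OF lin],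
          (simp_all add: qd field_simps)?, (simp_all add: D_def field_simps)?)
    qed
  qed
qed


section \<open>The lower bound\<close>

lemma merge_surj: "strspace (Suc k) n \<subseteq> merge_map q ` strspace k (Suc n)"
proof
  fix h assume h: "h \<in> strspace (Suc k) n"
  have hz: "h (i, l) = 0" if "i > Suc k \<or> length l \<noteq> n" for i l
    using h that by (auto simp: strspace_def dest: supp_lenD)
  define f where "f p = (case snd p of [] \<Rightarrow> 0 | b # l \<Rightarrow>
    if b then h (Suc (fst p), l) else if fst p = 0 then h (0, l) else 0)" for p
  have "f \<in> strspace k (Suc n)" unfolding strspace_def
    using hz by (auto simp: f_def intro!: supp_lenI split: list.split)
  moreover have "merge_map q f = h"
  proof (rule ext, clarify)
    fix i l show "merge_map q f (i, l) = h (i, l)" by (cases i) (simp_all add: merge_map_simps f_def)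
  qed
  ultimately show "h \<in> merge_map q ` strspace k (Suc n)" by blast
qed

lemma split_inj: "inj_on (split_map q) X"
proof (rule inj_onI, rule ext, clarify)
  fix f g i l assume "split_map q f = split_map q g"
  then have "split_map q f (Suc i, False # l) = split_map q g (Suc i, False # l)" by simp
  then show "f (i, l) = g (i, l)" by (simp add: split_map_simps)
qed

lemma merge_ker: 
  assumes q: "q \<noteq> 0"
  shows "strspace (Suc k) (Suc n) \<inter> merge_map q -` {\<lambda>_. 0} = split_map q ` strspace k n"
proof (intro equalityI subsetI)
  fix f assume "f \<in> strspace (Suc k) (Suc n) \<inter> merge_map q -` {\<lambda>_. 0}"
  then have f: "f \<in> strspace (Suc k) (Suc n)" "merge_map q f = (\<lambda>_. 0)" by auto
  have fz: "f (i, l) = 0" if "i > Suc k \<or> length l \<noteq> Suc n" for i l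
    using f(1) that by (auto simp: strspace_def dest: supp_lenD)
  have r: "f (0, False # l) = 0" "q * q ^ i * f (Suc i, False # l) + f (i, True # l) = 0" for i l
    using fun_cong[OF f(2), of "(0, l)"] fun_cong[OF f(2), of "(Suc i, l)"] by (simp_all add: merge_map_simps)
  \<comment> \<open>An element of the kernel is determined by its components at
    \<open>False\<close>, and that at index 0 vanishes; shifting the index by one gives the
    preimage.\<close>
  define g where "g p = f (Suc (fst p), False # snd p)" for p
  have "g \<in> strspace k n" unfolding strspace_def using fz by (auto simp: g_def intro!: supp_lenI)
  moreover have "split_map q g = f"
  proof (rule ext, clarify)
    fix i and l :: "bool list"
    consider "l = []" | l' where "l = False # l'" | l' where "l = True # l'" by (cases l; cases "hd l") auto
    then show "split_map q g (i, l) = f (i, l)"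
    proof cases
      case 1 then show ?thesis using fz by (simp add: split_map_simps)
    next
      case 2 then show ?thesis using r by (cases i) (simp_all add: split_map_simps g_def)
    next
      case (3 l')
      then show ?thesis using r(2)[of i l'] by (simp add: split_map_simps g_def add_eq_0_iff)
    qed
  qed
  ultimately show "f \<in> split_map q ` strspace k n" by blast
next
  fix f assume "f \<in> split_map q ` strspace k n"
  then obtain g where g: "g \<in> strspace k n" "f = split_map q g" by auto
  have gz: "g (i, l) = 0" if "i > k \<or> length l \<noteq> n" for i l
    using g(1) that by (auto simp: strspace_def dest: supp_lenD)
  have m: "split_map q g (i, l) = 0" if "i > Suc k \<or> length l \<noteq> Suc n" for i l
    using that gz[of i "tl l"] gz[of "i - 1" "tl l"] by (cases i; cases l; cases "hd l") (auto simp: split_map_simps)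
  have "f \<in> strspace (Suc k) (Suc n)" unfolding strspace_def g(2) mem_Collect_eq
    by (intro conjI allI impI supp_lenI m) simp_all
  moreover have "merge_map q f = (\<lambda>_. 0)" unfolding g(2)
  proof (rule ext, clarify)
    fix i l show "merge_map q (split_map q g) (i, l) = 0"
      by (cases i) (simp_all add: merge_map_simps split_map_simps)
  qed
  ultimately show "f \<in> strspace (Suc k) (Suc n) \<inter> merge_map q -` {\<lambda>_. 0}" by simp
qed

abbreviation reaches_str :: "complex \<Rightarrow> int \<Rightarrow> nat \<Rightarrow> int list \<Rightarrow> nat \<Rightarrow> bool" where
  "reaches_str q a k w t \<equiv> reaches (strmod q a k (wact q w)) triv (strspace k (length w)) t"

lemma inv_subsp_str: "q \<noteq> 0 \<Longrightarrow> inv_subsp (strmod q a k (wact q w)) (strspace k (length w))"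
  by (intro inv_subsp_strspace linear_op_wact wact_supp_len)

text \<open>For k = 0 the string module is trivial and the letter a itself becomes a string of
  length 1. The bound is pulled back along the surjection \<open>merge_map q\<close>.\<close>

lemma resolve_first:
  assumes q: "q \<noteq> 0" "q^2 \<noteq> 1" and r: "reaches_str q a (Suc 0) w t"
  shows "reaches_str q a 0 (a # w) t"
proof -
  have "hom_on (strspace 0 (Suc (length w))) (strmod q a 0 (wact q (a # w))) (strspace (Suc 0) (length w))
      (strmod q a (Suc 0) (wact q w)) (merge_map q)"
    using hom_on_merge[where \<rho> = "wact q w" and a = a and k = 0, OF q linear_op_wact wact_supp_len] by (simp add: wact_Cons)
  moreover have "inv_subsp (strmod q a 0 (wact q (a # w))) (strspace 0 (Suc (length w)))"
    using inv_subsp_str[OF q(1), of a 0 "a # w"] by (simp only: list.size add_0_right add_Suc_right)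
  ultimately have "reaches (strmod q a 0 (wact q (a # w))) triv (strspace 0 (Suc (length w))) t"
    by (rule reaches_quotient[OF _ _ merge_surj linear_op_strmod[OF linear_op_wact] linear_op_strmod[OF linear_op_wact] r])
  then show ?thesis by (simp only: list.size add_0_right add_Suc_right)
qed

text \<open>The exact sequence with a string of length k + 1 in the middle: the kernel contributes u
  and has length k, the quotient contributes t and has length k + 2.\<close>

lemma resolve:
  assumes q: "q \<noteq> 0" "q^2 \<noteq> 1" and r: "reaches_str q a (Suc (Suc k)) w t" "reaches_str q a k w u"
    and c: "c = a + 2 * int (Suc k)"
  shows "reaches_str q a (Suc k) (c # w) (u + t)"
proof -
  have 1: "hom_on (strspace (Suc k) (Suc (length w))) (strmod q a (Suc k) (wact q (c # w))) (strspace (Suc (Suc k)) (length w))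
      (strmod q a (Suc (Suc k)) (wact q w)) (merge_map q)"
    using hom_on_merge[where \<rho> = "wact q w" and a = a and k = "Suc k", OF q linear_op_wact wact_supp_len] by (simp only: wact_Cons c)
  have 2: "hom_on (strspace k (length w)) (strmod q a k (wact q w)) (strspace (Suc k) (Suc (length w)))
      (strmod q a (Suc k) (wact q (c # w))) (split_map q)"
    using hom_on_split[where \<rho> = "wact q w" and a = a and k = k and n = "length w", OF q linear_op_wact] by (simp only: wact_Cons c)
  show ?thesis
    using reaches_extension[OF 1 _ merge_surj 2 split_inj merge_ker[OF q(1)] r] inv_subsp_str[OF q(1), of a "Suc k" "c # w"]
    by (simp only: list.size add_0_right add_Suc_right)
qed

lemma exchangeable_word_swap:
  assumes q: "q \<noteq> 0" "\<And>k::nat. k > 0 \<Longrightarrow> q ^ k \<noteq> 1"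
  shows "exchangeable (supp_len (length (u @ a # b # v))) (wact q (u @ a # b # v))
    (supp_len (length (u @ b # a # v))) (wact q (u @ b # a # v))"
proof (induction u)
  case Nil
  show ?case using exchangeable_swap[OF q, of "q powi a" "q powi b" "wact q v" "length v"] q(1)
    by (simp add: wact_Cons linear_op_wact)
next
  case (Cons c u)
  then show ?case using exchangeable_tens[of "length (u @ a # b # v)"] by (simp add: wact_Cons)
qed

lemma reaches_str_swap:
  assumes q: "q \<noteq> 0" "\<And>k::nat. k > 0 \<Longrightarrow> q ^ k \<noteq> 1"
    and r: "reaches_str q a' k (u @ a # b # v) t"
  shows "reaches_str q a' k (u @ b # a # v) t"
proof (rule exchangeable_reaches[OF _ inv_subsp_str inv_subsp_str _ _ r])
  show "exchangeable (strspace k (length (u @ a # b # v))) (strmod q a' k (wact q (u @ a # b # v)))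
     (strspace k (length (u @ b # a # v))) (strmod q a' k (wact q (u @ b # a # v)))"
    using exchangeable_strmod[of "length (u @ a # b # v)"] exchangeable_word_swap[OF q, of u a b v] by simp
qed (use q(1) in \<open>simp_all add: linear_op_strmod linear_op_wact\<close>)

lemma reaches_str_move:
  assumes q: "q \<noteq> 0" "\<And>k::nat. k > 0 \<Longrightarrow> q ^ k \<noteq> 1"
  shows "reaches_str q a k (c # u @ v) t \<Longrightarrow> reaches_str q a k (u @ c # v) t"
proof (induction u arbitrary: v rule: rev_induct)
  case (snoc d u)
  have "reaches_str q a k (u @ c # d # v) t" using snoc.IH[of "d # v"] snoc.prems by simp
  from reaches_str_swap[OF q this] show ?case by simp
qed simp

text \<open>The number of sign sequences whose monomial has exponent u c at $Y_c$: a letter c with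
  sign \<open>False\<close> contributes $Y_c$, a letter c - 2 with sign \<open>True\<close>
  contributes $Y_c^{-1}$.\<close>

definition balanced_count :: "int list \<Rightarrow> (int \<Rightarrow> int) \<Rightarrow> nat" where
  "balanced_count w u = card {l. length l = length w \<and> (\<forall>c. occ w l c False - occ w l (c - 2) True = u c)}"

lemma balanced_count_Nil: "balanced_count [] u = (if u = (\<lambda>_. 0) then 1 else 0)"
proof -
  have "{l :: bool list. length l = length ([] :: int list) \<and> (\<forall>c. occ [] l c False - occ [] l (c - 2) True = u c)}
      = (if u = (\<lambda>_. 0) then {[]} else {})" by (auto simp: fun_eq_iff)
  then show ?thesis by (simp add: balanced_count_def)
qed

text \<open>Distinguish the sign of the first letter. With \<open>False\<close> it supplies one
  $Y_a$; with \<open>True\<close> it supplies $Y_{a+2}^{-1}$, and the rest has to provide one more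
  $Y_{a+2}$.\<close>

lemma balanced_count_Cons:
  "balanced_count (a # w) u = balanced_count w (\<lambda>c. u c - (if c = a then 1 else 0))
    + balanced_count w (\<lambda>c. u c + (if c = a + 2 then 1 else 0))"
proof -
  let ?S = "\<lambda>w u. {l. length l = length w \<and> (\<forall>c. occ w l c False - occ w l (c - 2) True = u c)}"
  let ?u = "\<lambda>c. u c - (if c = a then 1 else 0)" and ?v = "\<lambda>c. u c + (if c = a + 2 then 1 else 0)"
  have key: "occ (a # w) (b # l) c False - occ (a # w) (b # l) (c - 2) True = u c
      \<longleftrightarrow> occ w l c False - occ w l (c - 2) True = (if b then ?v c else ?u c)" for b l c
    by (cases b; cases "c = a"; cases "c = a + 2") auto
  have "?S (a # w) u = (#) False ` ?S w ?u \<union> (#) True ` ?S w ?v"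
  proof (intro equalityI subsetI)
    fix l assume l: "l \<in> ?S (a # w) u"
    then obtain b l' where bl: "l = b # l'" "length l' = length w" by (cases l) auto
    have "\<forall>c. occ w l' c False - occ w l' (c - 2) True = (if b then ?v c else ?u c)"
      using l unfolding bl(1) mem_Collect_eq key by blast
    then show "l \<in> (#) False ` ?S w ?u \<union> (#) True ` ?S w ?v" using bl by (cases b) auto
  next
    fix l assume "l \<in> (#) False ` ?S w ?u \<union> (#) True ` ?S w ?v"
    then obtain b l' where bl: "l = b # l'" "length l' = length w"
      and "\<forall>c. occ w l' c False - occ w l' (c - 2) True = (if b then ?v c else ?u c)"
      by fastforce
    then show "l \<in> ?S (a # w) u" unfolding bl(1) mem_Collect_eq key by simp
  qed
  moreover have "finite (?S w u)" for u using finite_bool_lists[of "length w"] by (auto intro: finite_subset[rotated])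
  moreover have "((#) False ` A) \<inter> ((#) True ` B) = {}" for A B by auto
  ultimately show ?thesis
    unfolding balanced_count_def by (simp add: card_Un_disjoint card_image)
qed

lemma balanced_count_move: "balanced_count (u @ c # v) U = balanced_count (c # u @ v) U"
proof (induction u arbitrary: U)
  case (Cons d u)
  have "balanced_count ((d # u) @ c # v) U
    = balanced_count (c # u @ v) (\<lambda>c. U c - (if c = d then 1 else 0))
    + balanced_count (c # u @ v) (\<lambda>c. U c + (if c = d + 2 then 1 else 0))"
    by (simp add: balanced_count_Cons[of d] Cons)
  also have "\<dots> = balanced_count (c # (d # u) @ v) U"
    by (simp add: balanced_count_Cons algebra_simps)
  finally show ?case .
qed simp

primrec string_weight :: "int \<Rightarrow> nat \<Rightarrow> int \<Rightarrow> int" where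
  string_weight_0: "string_weight a 0 = (\<lambda>_. 0)"
| string_weight_Suc: "string_weight a (Suc k) = (\<lambda>c. string_weight a k c + (if c = a + 2 * int (Suc k) then 1 else 0))"

lemma string_weight_beyond: "c > a + 2 * int k \<Longrightarrow> string_weight a k c = 0"
  by (induction k) auto

lemma string_weight_top: "string_weight a (Suc k) (a + 2 * int (Suc k)) = 1"
  by (simp add: string_weight_beyond)

lemma occ_zero: "c \<notin> set w \<Longrightarrow> occ w l c b = 0"
  by (auto simp: count_list_0_iff dest: set_zip_leftD)

text \<open>A positive exponent at c can only be supplied by a letter c, a negative one only by a
  letter c - 2.\<close>

lemma balanced_count_eq_0:
  assumes "U c \<noteq> 0" "U c > 0 \<Longrightarrow> c \<notin> set w" "U c < 0 \<Longrightarrow> c - 2 \<notin> set w"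
  shows "balanced_count w U = 0"
proof -
  have "occ w l c False - occ w l (c - 2) True \<noteq> U c" for l
  proof (cases "U c > 0")
    case True
    then show ?thesis using assms(2) occ_zero[of c w l False] by simp
  next
    case False
    then show ?thesis using assms(1,3) occ_zero[of "c - 2" w l True] by simp
  qed
  then have "{l. length l = length w \<and> (\<forall>c. occ w l c False - occ w l (c - 2) True = U c)} = {}" by blast
  then show ?thesis unfolding balanced_count_def by (simp only: card.empty)
qed

lemma reaches_0: "inv_subsp \<rho> X \<Longrightarrow> (\<And>g. linear_op (\<rho> g)) \<Longrightarrow> reaches \<rho> \<epsilon> X 0"
  unfolding reaches_def using subsp_zero[OF inv_subsp_subsp[of \<rho> X]]
  by (intro exI[of _ 0] conjI reach.widen[OF reach.start[OF inv_subsp_zero]]) auto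

lemma reach_cong:
  assumes eq: "\<And>g f. f \<in> X \<Longrightarrow> \<rho> g f = \<sigma> g f"
  shows "reach \<rho> \<epsilon> S\<^sub>0 S t \<Longrightarrow> S \<subseteq> X \<Longrightarrow> reach \<sigma> \<epsilon> S\<^sub>0 S t"
proof (induction rule: reach.induct)
  have inv: "inv_subsp \<sigma> S" if "inv_subsp \<rho> S" "S \<subseteq> X" for S
    using that eq by (auto simp: inv_subsp_def subset_iff)
  case start
  then show ?case by (intro reach.start inv)
next
  have inv: "inv_subsp \<sigma> S" if "inv_subsp \<rho> S" "S \<subseteq> X" for S
    using that eq by (auto simp: inv_subsp_def subset_iff)
  case (widen S t S')
  have "S \<subseteq> X" using widen.hyps(3) widen.prems by (rule order_trans)
  from reach.widen[OF widen.IH[OF this] inv[OF widen.hyps(2) widen.prems] widen.hyps(3)] show ?case .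
next
  have inv: "inv_subsp \<sigma> S" if "inv_subsp \<rho> S" "S \<subseteq> X" for S
    using that eq by (auto simp: inv_subsp_def subset_iff)
  case (step S t S')
  have "S \<subseteq> X" using step.hyps(3) step.prems by (auto simp: char_step_def)
  moreover have "char_step \<sigma> \<epsilon> S S'" using step.hyps(3) step.prems eq by (auto simp: char_step_def subset_iff)
  ultimately show ?case using reach.step[OF step.IH inv[OF step.hyps(2) step.prems]] by blast
qed

text \<open>The string of length 0 is the trivial module whatever its starting point, so a new
  string can be opened at any letter.\<close>

lemma strmod_0_indep:
  assumes q: "q \<noteq> 0" and f: "f \<in> strspace 0 n" and lin: "\<And>g. linear_op (\<rho> g)"
  shows "strmod q a 0 \<rho> g f = strmod q b 0 \<rho> g f"
proof (rule ext, clarify)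
  fix i l
  have z: "(\<lambda>l. f (Suc i, l)) = (\<lambda>_. 0)" for i using f by (simp add: strspace_def)
  have "f (Suc i, l) = 0" for i l using fun_cong[OF z] by simp
  then show "strmod q a 0 \<rho> g f (i, l) = strmod q b 0 \<rho> g f (i, l)"
    using q z linear_op_zero[OF lin] by (cases g; cases i; cases "i - 1") (simp_all add: strmod_simps qint_def)
qed

text \<open>Induction on the length of the word. One letter is moved to the front and absorbed by
  the string; resolving the module and distinguishing the sign of this letter in
  \<open>balanced_count\<close> give the same recursion.\<close>

theorem reaches_balanced_count:
  assumes q: "q \<noteq> 0" "\<And>k::nat. k > 0 \<Longrightarrow> q ^ k \<noteq> 1"
  shows "(\<And>c. c \<in> set w \<Longrightarrow> a \<le> c) \<Longrightarrow> reaches_str q a k w (balanced_count w (string_weight a k))"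
proof (induction "length w" arbitrary: w a k)
  case 0
  have q2: "q^2 \<noteq> 1" using q(2)[of 2] by simp
  have w: "w = []" using 0 by simp
  note inv = inv_subsp_str[OF q(1), of a k "[]"]
  note lin = linear_op_strmod[of "wact q []" q a k, OF linear_op_wact]
  show ?case
  proof (cases "k = 0")
    case False
    then obtain k' where "k = Suc k'" by (cases k) auto
    then have "string_weight a k (a + 2 * int (Suc k')) \<noteq> 0" using string_weight_top[of a k'] by simp
    then have "balanced_count w (string_weight a k) = 0" by (auto simp: w balanced_count_Nil)
    then show ?thesis using reaches_0[OF inv lin] by (simp only: w)
  next
    case True
    have "char_step (strmod q a k (wact q [])) triv {\<lambda>_. 0} (strspace k 0)"
      unfolding char_step_def
    proof (intro conjI allI ballI)
      have "(\<lambda>p. if p = (0, []) then 1 else 0) \<in> strspace k 0"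
        by (auto simp: strspace_def supp_len_def split: if_splits)
      moreover have "(\<lambda>p. if p = (0 :: nat, [] :: bool list) then 1 else (0::complex)) \<noteq> (\<lambda>_. 0)" by (metis one_neq_zero)
      ultimately show "{\<lambda>_. 0} \<subset> strspace k 0" using subsp_zero[OF subsp_strspace, of k 0] by auto
      fix g f assume f: "f \<in> strspace k 0"
      have z: "f (i, l) = 0" if "i > 0" for i l using f that True by (simp add: strspace_def)
      show "(\<lambda>i. strmod q a k (wact q []) g f i - triv g * f i) \<in> {\<lambda>_. 0}"
        unfolding singleton_iff
      proof (rule ext, clarify)
        fix i l
        show "strmod q a k (wact q []) g f (i, l) - triv g * f (i, l) = 0"
          using z q(1) True by (cases g; cases i; cases "i - 1") (simp_all add: strmod_simps triv_def qint_def)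
      qed
    qed
    then have "reach (strmod q a k (wact q [])) triv {\<lambda>_. 0} (strspace k 0) (Suc 0)"
      using inv unfolding list.size by (intro reach.step[OF reach.start[OF inv_subsp_zero[OF lin]]])
    then have "reaches (strmod q a k (wact q [])) triv (strspace k 0) 1" unfolding reaches_def by auto
    moreover have "balanced_count w (string_weight a k) = 1" by (simp add: w True balanced_count_Nil)
    ultimately show ?thesis by (simp only: w list.size)
  qed
next
  case (Suc n)
  have q2: "q^2 \<noteq> 1" using q(2)[of 2] by simp
  note lin = linear_op_strmod[of "wact q w" q, OF linear_op_wact]
  show ?case
  proof (cases k)
    case 0
    define a' where "a' = Min (set w)"
    have w0: "set w \<noteq> {}" using Suc(2) by auto
    then have a': "a' \<in> set w" "\<And>c. c \<in> set w \<Longrightarrow> a' \<le> c" by (auto simp: a'_def)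
    obtain u v where w: "w = u @ a' # v" using split_list[OF a'(1)] by auto
    have "reaches_str q a' (Suc 0) (u @ v) (balanced_count (u @ v) (string_weight a' (Suc 0)))"
      using Suc(2) a'(2) by (intro Suc(1)) (auto simp: w)
    then have "reaches_str q a' 0 w (balanced_count (u @ v) (string_weight a' (Suc 0)))"
      unfolding w by (intro reaches_str_move[OF q] resolve_first[OF q(1) q2]) auto
    moreover have "balanced_count w (string_weight a' 0) = balanced_count (u @ v) (string_weight a' (Suc 0))"
    proof -
      \<comment> \<open>Sign + at the smallest letter a' asks for a letter a' - 2 with sign -, which
        does not occur. So only the sign - counts, and it leaves the weight of a string of length
        1.\<close>
      have "balanced_count (u @ v) (\<lambda>c. 0 - (if c = a' then 1 else 0)) = 0"
        using a'(2)[of "a' - 2"] by (intro balanced_count_eq_0[of _ a']) (auto simp: w)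
      then show ?thesis
        by (simp add: w balanced_count_move balanced_count_Cons string_weight_0 string_weight_Suc)
    qed
    ultimately have "reaches_str q a' 0 w (balanced_count w (string_weight a 0))" by (simp add: string_weight_0)
    then obtain t' where t': "balanced_count w (string_weight a 0) \<le> t'"
      "reach (strmod q a' 0 (wact q w)) triv {\<lambda>_. 0} (strspace 0 (length w)) t'"
      unfolding reaches_def by blast
    have "strmod q a' 0 (wact q w) g f = strmod q a 0 (wact q w) g f" if "f \<in> strspace 0 (length w)" for g f
      by (rule strmod_0_indep[OF q(1) that linear_op_wact])
    from reach_cong[OF this t'(2) order_refl] show ?thesis unfolding reaches_def 0 using t'(1) by blast
  next
    case (Suc k')
    define c where "c = a + 2 * int k"
    show ?thesis
    proof (cases "c \<in> set w")
      case False
      \<comment> \<open>The required $Y_{a+2k}$ can only come from a letter a + 2k; without one the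
        count is 0 and the bound is empty.\<close>
      have "string_weight a k c = 1" using string_weight_top[of a k'] by (simp only: Suc c_def)
      then have "balanced_count w (string_weight a k) = 0" using False by (intro balanced_count_eq_0[of _ c]) auto
      then show ?thesis using reaches_0[OF inv_subsp_str[OF q(1)] lin] by simp
    next
      case True
      obtain u v where w: "w = u @ c # v" using split_list[OF True] by auto
      have IH: "reaches_str q a j (u @ v) (balanced_count (u @ v) (string_weight a j))" for j
        using Suc.hyps(2) Suc.prems by (intro Suc.hyps(1)) (auto simp: w)
      have "reaches_str q a k (c # u @ v) (balanced_count (u @ v) (string_weight a k') + balanced_count (u @ v) (string_weight a (Suc k)))"
        unfolding Suc by (rule resolve[OF q(1) q2 IH IH]) (simp add: c_def Suc)
      then have "reaches_str q a k w (balanced_count (u @ v) (string_weight a k') + balanced_count (u @ v) (string_weight a (Suc k)))"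
        unfolding w using reaches_str_move[OF q, where a = a and k = k and c = c and u = u and v = v] by blast
      moreover have "balanced_count w (string_weight a k)
        = balanced_count (u @ v) (string_weight a k') + balanced_count (u @ v) (string_weight a (Suc k))"
      proof -
        \<comment> \<open>Sign + at c removes the top of the string weight, sign - adds the next
          one: the strings of length k - 1 and k + 1 in the exact sequence.\<close>
        have "(\<lambda>d. string_weight a k d - (if d = c then 1 else 0)) = string_weight a k'"
          by (simp add: Suc string_weight_Suc c_def)
        moreover have "(\<lambda>d. string_weight a k d + (if d = c + 2 then 1 else 0)) = string_weight a (Suc k)"
          by (simp add: string_weight_Suc[of a k] c_def algebra_simps)
        ultimately show ?thesis by (simp add: w balanced_count_move balanced_count_Cons)
      qed
      ultimately show ?thesis by simp
    qed
  qed
qed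


section \<open>Trivial composition factors and their number\<close>

text \<open>Identifies the word with its tensor product with the string of length 0.\<close>

lemma reaches_word:
  assumes q: "q \<noteq> 0" and r: "reaches_str q a 0 w t"
  shows "reaches (wact q w) triv (supp_len (length w)) t"
proof -
  define \<phi> :: "(bool list \<Rightarrow> complex) \<Rightarrow> nat \<times> bool list \<Rightarrow> complex"
    where "\<phi> f p = (if fst p = 0 then f (snd p) else 0)" for f p
  have \<phi>: "\<phi> f (0, l) = f l" "\<phi> f (Suc i, l) = 0" for f i l by (simp_all add: \<phi>_def)
  have "hom_on (supp_len (length w)) (wact q w) (strspace 0 (length w)) (strmod q a 0 (wact q w)) \<phi>"
    unfolding hom_on_def
  proof (intro conjI allI ballI)
    show "linear_op \<phi>" by (auto simp: linear_op_def \<phi>_def)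
    fix f assume f: "f \<in> supp_len (length w)"
    show "\<phi> f \<in> strspace 0 (length w)"
      using supp_lenD[OF f] unfolding strspace_def mem_Collect_eq
      by (intro conjI allI impI supp_lenI) (simp_all add: \<phi>_def)
    show "\<phi> (wact q w g f) = strmod q a 0 (wact q w) g (\<phi> f)" for g
    proof (rule ext, clarify)
      fix i l
      show "\<phi> (wact q w g f) (i, l) = strmod q a 0 (wact q w) g (\<phi> f) (i, l)"
        using q linear_op_zero[OF linear_op_wact]
        by (cases g; cases i; cases "i - 1") (simp_all add: strmod_simps \<phi> qint_def)
    qed
  qed
  moreover have "inv_subsp (wact q w) (supp_len (length w))"
    by (auto simp: inv_subsp_def subsp_supp_len wact_supp_len)
  moreover have "strspace 0 (length w) \<subseteq> \<phi> ` supp_len (length w)"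
  proof
    fix h assume h: "h \<in> strspace 0 (length w)"
    have "\<phi> (\<lambda>l. h (0, l)) = h"
    proof (rule ext, clarify)
      fix i l show "\<phi> (\<lambda>l. h (0, l)) (i, l) = h (i, l)" using h by (cases i) (simp_all add: \<phi> strspace_def)
    qed
    moreover have "(\<lambda>l. h (0, l)) \<in> supp_len (length w)" using h by (simp add: strspace_def)
    ultimately show "h \<in> \<phi> ` supp_len (length w)" by (metis image_eqI)
  qed
  ultimately show ?thesis
    by (rule reaches_quotient[OF _ _ _ linear_op_wact linear_op_strmod[OF linear_op_wact] r])
qed

text \<open>The sandwich. A simple series is a chain, so the upper bound applies to it; the chain
  given by the lower bound has at most as many marked steps as the series has trivial
  factors.\<close>

theorem simple_series_char_steps:
  assumes q: "q \<noteq> 0" "\<And>k::nat. k > 0 \<Longrightarrow> q ^ k \<noteq> 1"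
    and D: "D 0 = {\<lambda>_. 0}" "D r = supp_len (length w)" "\<And>i. i \<le> r \<Longrightarrow> inv_subsp (wact q w) (D i)"
      "\<And>i. i < r \<Longrightarrow> simple_step (wact q w) (D i) (D (Suc i))"
  shows "card {i. i < r \<and> char_step (wact q w) triv (D i) (D (Suc i))} = balanced_count w (\<lambda>_. 0)"
proof (rule antisym)
  have "D i \<subseteq> D (Suc i)" if "i < r" for i using D(4)[OF that] by (auto simp: simple_step_def)
  then have "reach (wact q w) triv {\<lambda>_. 0} (supp_len (length w)) (card {i. i < r \<and> char_step (wact q w) triv (D i) (D (Suc i))})"
    using reach_of_series[of D r "wact q w" triv, OF D(1,3)] D(2) by simp
  from reach_le_diag[OF q this order_refl]
  show "card {i. i < r \<and> char_step (wact q w) triv (D i) (D (Suc i))} \<le> balanced_count w (\<lambda>_. 0)"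
  proof (rule order_trans)
    show "card {l. length l = length w \<and> (\<forall>k. diag q w l (int k) = alpha q (\<lambda>k. qdet_coeff q w (int k)) k)} \<le> balanced_count w (\<lambda>_. 0)"
      unfolding balanced_count_def
      using diag_eq_alpha_balanced[OF q] by (intro card_mono finite_subset[OF _ finite_bool_lists[of "length w"]]) auto
  qed
next
  \<comment> \<open>Inserting 0 covers the empty word.\<close>
  have "\<exists>a. \<forall>c\<in>set w. a \<le> c"
    by (rule exI[of _ "Min (insert 0 (set w))"]) simp
  then obtain a where a: "\<And>c. c \<in> set w \<Longrightarrow> a \<le> c" by blast
  have "reaches_str q a 0 w (balanced_count w (string_weight a 0))"
    by (rule reaches_balanced_count[OF q a])
  from reaches_word[OF q(1) this]
  have "reaches (wact q w) triv (supp_len (length w)) (balanced_count w (\<lambda>_. 0))" by simp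
  then obtain t where t: "balanced_count w (\<lambda>_. 0) \<le> t" "reach (wact q w) triv {\<lambda>_. 0} (supp_len (length w)) t"
    unfolding reaches_def by blast
  have "t \<le> card {i. i < r \<and> char_step (wact q w) triv (D i) (D (Suc i))}"
    using D t(2) by (intro reach_le_simple_series[where S = "supp_len (length w)"]) (simp_all add: linear_op_wact)
  then show "balanced_count w (\<lambda>_. 0) \<le> card {i. i < r \<and> char_step (wact q w) triv (D i) (D (Suc i))}"
    using t(1) by simp
qed

subsection \<open>Counting\<close>

lemma binom_Suc: "binom (Suc n) b = binom n (b - 1) + binom n b"
proof (cases "b \<le> 0")
  case False
  then obtain m where "nat b = Suc m" by (cases "nat b") auto
  moreover have "nat (b - 1) = m" using calculation by simp
  ultimately show ?thesis using False by (simp add: binom_def)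
qed (auto simp: binom_def)

lemma binom_0: "binom 0 b = (if b = 0 then 1 else 0)"
  by (cases "nat b") (auto simp: binom_def)

text \<open>For each letter c the P c positions with sign + are chosen independently among its
  occurrences; the induction over the word is Pascal's rule at the first letter. Outside C there are
  no positions, so P has to vanish there.\<close>

lemma card_occ:
  assumes "finite C"
  shows "set w \<subseteq> C \<Longrightarrow> card {l. length l = length w \<and> (\<forall>c. occ w l c False = P c)}
    = (if \<forall>c. c \<notin> C \<longrightarrow> P c = 0 then \<Prod>c\<in>C. binom (count_list w c) (P c) else 0)"
proof (induction w arbitrary: P)
  case Nil
  have "{l :: bool list. length l = length ([] :: int list) \<and> (\<forall>c. occ [] l c False = P c)} = (if \<forall>c. P c = 0 then {[]} else {})"
    by auto
  then have "card {l :: bool list. length l = length ([] :: int list) \<and> (\<forall>c. occ [] l c False = P c)} = (if \<forall>c. P c = 0 then 1 else 0)"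
    by simp
  also have "\<dots> = (if \<forall>c. c \<notin> C \<longrightarrow> P c = 0 then \<Prod>c\<in>C. binom (count_list [] c) (P c) else 0)"
    using assms by (auto simp: binom_0)
  finally show ?case .
next
  case (Cons a w)
  let ?S = "\<lambda>w P. {l. length l = length w \<and> (\<forall>c. occ w l c False = P c)}"
  let ?P = "P(a := P a - 1)"
  let ?B = "\<lambda>P. \<Prod>c\<in>C. binom (count_list w c) (P c)"
  have a: "a \<in> C" and w: "set w \<subseteq> C" using Cons.prems by auto
  have key: "(\<forall>c. occ (a # w) (b # l) c False = P c) \<longleftrightarrow> (\<forall>c. occ w l c False = (if b then P c else ?P c))" for b l
    by (cases b) auto
  have "?S (a # w) P = (#) False ` ?S w ?P \<union> (#) True ` ?S w P"
  proof (intro equalityI subsetI)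
    fix l assume l: "l \<in> ?S (a # w) P"
    then obtain b l' where bl: "l = b # l'" "length l' = length w" by (cases l) auto
    have "\<forall>c. occ w l' c False = (if b then P c else ?P c)"
      using l unfolding bl(1) mem_Collect_eq key by blast
    then show "l \<in> (#) False ` ?S w ?P \<union> (#) True ` ?S w P" using bl by (cases b) auto
  next
    fix l assume "l \<in> (#) False ` ?S w ?P \<union> (#) True ` ?S w P"
    then obtain b l' where bl: "l = b # l'" "length l' = length w"
      and "\<forall>c. occ w l' c False = (if b then P c else ?P c)" by fastforce
    then show "l \<in> ?S (a # w) P" unfolding bl(1) mem_Collect_eq key by simp
  qed
  moreover have "finite (?S w P)" for P using finite_bool_lists[of "length w"] by (auto intro: finite_subset[rotated])
  moreover have "((#) False ` A) \<inter> ((#) True ` B) = {}" for A B by auto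
  ultimately have "card (?S (a # w) P) = card (?S w ?P) + card (?S w P)"
    by (simp add: card_Un_disjoint card_image)
  also have "\<dots> = (if \<forall>c. c \<notin> C \<longrightarrow> P c = 0 then ?B ?P + ?B P else 0)"
    unfolding Cons.IH[OF w] using a by auto
  also have "?B ?P + ?B P = (\<Prod>c\<in>C. binom (count_list (a # w) c) (P c))"
  proof -
    have "?B ?P = binom (count_list w a) (P a - 1) * (\<Prod>c\<in>C - {a}. binom (count_list w c) (P c))"
      using a assms by (subst prod.remove[of _ a]) (auto intro!: prod.cong)
    moreover have "?B P = binom (count_list w a) (P a) * (\<Prod>c\<in>C - {a}. binom (count_list w c) (P c))"
      using a assms by (subst prod.remove[of _ a]) auto
    moreover have "(\<Prod>c\<in>C. binom (count_list (a # w) c) (P c))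
        = binom (Suc (count_list w a)) (P a) * (\<Prod>c\<in>C - {a}. binom (count_list w c) (P c))"
      using a assms by (subst prod.remove[of _ a]) (auto intro!: prod.cong)
    ultimately show ?thesis by (simp add: binom_Suc algebra_simps)
  qed
  finally show ?case .
qed

lemma m_num_eq_sum:
  assumes w: "\<And>c. c \<in> set w \<Longrightarrow> 0 \<le> c" and J: "r - 1 < 2 * int J"
  shows "m_num w r = (\<Sum>j<J. (- 1) ^ j * int (count_list w (r - 1 - 2 * int j)))"
  unfolding m_num_def
proof (rule sum.mono_neutral_left)
  show "{j. count_list w (r - 1 - 2 * int j) \<noteq> 0} \<subseteq> {..<J}"
  proof
    fix j assume "j \<in> {j. count_list w (r - 1 - 2 * int j) \<noteq> 0}"
    then have "r - 1 - 2 * int j \<in> set w" by (auto simp: count_list_0_iff)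
    then have "0 \<le> r - 1 - 2 * int j" by (rule w)
    then show "j \<in> {..<J}" using J by simp
  qed
qed auto

text \<open>Splitting off the term j = 0 of the alternating sum. Nonnegative letters allow both sums
  to be taken over explicit finite ranges.\<close>

lemma m_num_rec:
  assumes w: "\<And>c. c \<in> set w \<Longrightarrow> 0 \<le> c"
  shows "m_num w r = int (count_list w (r - 1)) - m_num w (r - 2)"
proof -
  define J where "J = nat \<bar>r\<bar>"
  have "m_num w r = (\<Sum>j<Suc J. (- 1) ^ j * int (count_list w (r - 1 - 2 * int j)))"
    by (rule m_num_eq_sum[OF w]) (simp_all add: J_def)
  also have "\<dots> = int (count_list w (r - 1)) - (\<Sum>j<J. (- 1) ^ j * int (count_list w (r - 2 - 1 - 2 * int j)))"
    by (subst sum.lessThan_Suc_shift) (simp add: sum_negf algebra_simps)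
  also have "(\<Sum>j<J. (- 1) ^ j * int (count_list w (r - 2 - 1 - 2 * int j))) = m_num w (r - 2)"
    by (rule m_num_eq_sum[symmetric, OF w]) (simp_all add: J_def)
  finally show ?thesis .
qed

lemma m_num_neg:
  assumes w: "\<And>c. c \<in> set w \<Longrightarrow> 0 \<le> c" and "r \<le> 0"
  shows "m_num w r = 0"
  using m_num_eq_sum[where r = r and J = 0, OF w] assms(2) by simp

lemma occ_total: "length l = length w \<Longrightarrow> occ w l c False + occ w l c True = int (count_list w c)"
  by (induction l w rule: list_induct2) auto

text \<open>If p_c counts the signs + at letter c, balance reads p_c = #(c - 2) - p_(c-2). This is
  the recursion of \<open>m_num\<close>, and both sides vanish for negative c.\<close>

lemma balanced_iff_m_num:
  assumes w: "\<And>c. c \<in> set w \<Longrightarrow> 0 \<le> c" and l: "length l = length w"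
  shows "(\<forall>c. occ w l c False - occ w l (c - 2) True = 0) \<longleftrightarrow> (\<forall>c. occ w l c False = m_num w (c - 1))"
proof
  assume bal: "\<forall>c. occ w l c False - occ w l (c - 2) True = 0"
  have neg: "occ w l c b = 0" if "c < 0" for c b using occ_zero[of c w l b] w[of c] that by force
  have "c < 2 * int m \<Longrightarrow> occ w l c False = m_num w (c - 1)" for c m
  proof (induction m arbitrary: c)
    case 0
    then show ?case using neg m_num_neg[where r = "c - 1", OF w] by simp
  next
    case (Suc m)
    then have "occ w l (c - 2) False = m_num w (c - 2 - 1)" by simp
    moreover have "occ w l c False = occ w l (c - 2) True" using bal by (metis eq_iff_diff_eq_0)
    moreover have "m_num w (c - 1) = int (count_list w (c - 2)) - m_num w (c - 2 - 1)"
      using m_num_rec[where r = "c - 1", OF w] by (simp add: algebra_simps)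
    ultimately show ?case using occ_total[OF l, of "c - 2"] by simp
  qed
  then have low: "c < 2 * int m \<Longrightarrow> occ w l c False = m_num w (c - 1)" for c m .
  show "\<forall>c. occ w l c False = m_num w (c - 1)"
  proof
    fix c show "occ w l c False = m_num w (c - 1)" by (rule low[of c "Suc (nat \<bar>c\<bar>)"]) simp
  qed
next
  assume eq: "\<forall>c. occ w l c False = m_num w (c - 1)"
  show "\<forall>c. occ w l c False - occ w l (c - 2) True = 0"
  proof
    fix c
    have "m_num w (c - 1) = int (count_list w (c - 2)) - m_num w (c - 2 - 1)"
      using m_num_rec[where r = "c - 1", OF w] by (simp add: algebra_simps)
    moreover have "occ w l c False = m_num w (c - 1)" "occ w l (c - 2) False = m_num w (c - 2 - 1)" using eq by blast+
    ultimately show "occ w l c False - occ w l (c - 2) True = 0" using occ_total[OF l, of "c - 2"] by simp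
  qed
qed

text \<open>Balance prescribes $m_{2k-1}$ signs + at the letter 2k. The factor k = 0 is 1 because
  $m_{-1} = 0$. The factor k = N + 1 belongs to no letter: it is 1 or 0 according to whether
  $m_{2N+1}$ vanishes, which is the condition for the prescription to be consistent.\<close>

theorem balanced_count_prod:
  assumes "set w \<subseteq> {2 * int k | k. k \<le> N}"
  shows "balanced_count w (\<lambda>_. 0) = (\<Prod>k = 1..N + 1. binom (count_list w (2 * int k)) (m_num w (2 * int k - 1)))"
proof -
  have w: "0 \<le> c" if "c \<in> set w" for c using assms that by auto
  let ?C = "(\<lambda>k. 2 * int k) ` {0..N + 1}"
  let ?P = "\<lambda>c. m_num w (c - 1)"
  have "balanced_count w (\<lambda>_. 0) = card {l. length l = length w \<and> (\<forall>c. occ w l c False = ?P c)}"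
    unfolding balanced_count_def using balanced_iff_m_num[OF w] by (intro arg_cong[where f = card] Collect_cong) blast
  also have "\<dots> = (if \<forall>c. c \<notin> ?C \<longrightarrow> ?P c = 0 then \<Prod>c\<in>?C. binom (count_list w c) (?P c) else 0)"
    using assms by (intro card_occ) auto
  also have "\<dots> = (\<Prod>c\<in>?C. binom (count_list w c) (?P c))"
  proof (cases "?P (2 * int (N + 1)) = 0")
    case True
    have notin: "count_list w c = 0" if "odd c \<or> c > 2 * int N" for c
      using assms that by (auto simp: count_list_0_iff)
    \<comment> \<open>At an even index the sum runs over counts of odd letters, which do not
      occur.\<close>
    have odd: "m_num w (2 * c) = 0" for c
    proof (cases "c \<le> 0")
      case False
      have "m_num w (2 * int m) = 0" for m
      proof (induction m)
        case 0
        then show ?case using m_num_neg[where r = 0, OF w] by simp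
      next
        case (Suc m)
        have "m_num w (2 * int (Suc m)) = int (count_list w (2 * int (Suc m) - 1)) - m_num w (2 * int (Suc m) - 2)"
          by (rule m_num_rec[OF w])
        also have "count_list w (2 * int (Suc m) - 1) = 0" by (rule notin) simp
        finally show ?case using Suc by simp
      qed
      from this[of "nat c"] show ?thesis using False by simp
    qed (use m_num_neg[OF w] in auto)
    \<comment> \<open>Above 2N the recursion merely changes the sign of $m_{2N+1}$, which is 0 in
      this case.\<close>
    have big: "?P (2 * int (N + 1 + m)) = 0" for m
    proof (induction m)
      case (Suc m)
      have "m_num w (2 * int (N + 1 + Suc m) - 1) = int (count_list w (2 * int (N + 1 + Suc m) - 1 - 1)) - m_num w (2 * int (N + 1 + Suc m) - 1 - 2)"
        by (rule m_num_rec[OF w])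
      also have "count_list w (2 * int (N + 1 + Suc m) - 1 - 1) = 0" by (rule notin) simp
      finally show ?case using Suc by (simp add: algebra_simps)
    qed (use True in simp)
    have "?P c = 0" if c: "c \<notin> ?C" for c
    proof (cases "even c")
      case True
      then obtain d where d: "c = 2 * d" by auto
      show ?thesis
      proof (cases "d \<le> 0")
        case True
        then show ?thesis using m_num_neg[OF w] d by simp
      next
        case False
        have "nat d > N + 1"
        proof (rule ccontr)
          assume "\<not> nat d > N + 1"
          then have "c \<in> ?C" using d False by (intro image_eqI[of _ _ "nat d"]) auto
          then show False using c by simp
        qed
        then obtain m where "nat d = N + 1 + m" by (metis less_imp_add_positive)
        moreover have "c = 2 * int (nat d)" using d False by simp
        ultimately have "c = 2 * int (N + 1 + m)" by (simp only:)
        then show ?thesis using big by simp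
      qed
    next
      case False
      then obtain d where "c - 1 = 2 * d" by (elim oddE) auto
      then show ?thesis using odd by simp
    qed
    then show ?thesis by simp
  next
    case False
    have "count_list w (2 * int (N + 1)) = 0" using assms by (auto simp: count_list_0_iff)
    then have "(\<Prod>c\<in>?C. binom (count_list w c) (?P c)) = 0"
      using False by (intro prod_zero) (auto simp: binom_0 intro!: bexI[of _ "N + 1"])
    then show ?thesis by simp
  qed
  also have "\<dots> = (\<Prod>k\<in>{0..N + 1}. binom (count_list w (2 * int k)) (?P (2 * int k)))"
    by (subst prod.reindex) (auto simp: inj_on_def)
  also have "{0..N + 1} = insert 0 {1..N + 1}" by auto
  also have "(\<Prod>k\<in>insert 0 {1..N + 1}. binom (count_list w (2 * int k)) (?P (2 * int k)))
      = (\<Prod>k = 1..N + 1. binom (count_list w (2 * int k)) (m_num w (2 * int k - 1)))"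
    using m_num_neg[where r = "- 1", OF w] by (subst prod.insert) (auto simp: binom_def)
  finally show ?thesis .
qed


section \<open>Subquotients on column vectors\<close>

definition vsub :: "nat \<Rightarrow> complex vec set \<Rightarrow> bool" where
  "vsub d W \<longleftrightarrow> W \<subseteq> carrier_vec d \<and> 0\<^sub>v d \<in> W \<and> (\<forall>x\<in>W. \<forall>y\<in>W. x + y \<in> W) \<and> (\<forall>c. \<forall>x\<in>W. c \<cdot>\<^sub>v x \<in> W)"

definition cs :: "complex vec set \<Rightarrow> complex vec \<Rightarrow> complex vec set" where
  "cs W x = (\<lambda>h. h + x) ` W"

lemma U_mod_of_rep_simps:
  "carrier (U_mod_of_rep R) = carrier_vec (rep_dim R)" "\<zero>\<^bsub>U_mod_of_rep R\<^esub> = 0\<^sub>v (rep_dim R)"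
  "x \<oplus>\<^bsub>U_mod_of_rep R\<^esub> y = x + y" "c \<odot>\<^bsub>U_mod_of_rep R\<^esub> x = c \<cdot>\<^sub>v x"
  "g \<rhd>\<^bsub>U_mod_of_rep R\<^esub> x = rep_mat R g *\<^sub>v x"
  by (simp_all add: U_mod_of_rep_def)

lemma module_U_mod_of_rep: "Module.module (class_ring :: complex ring) (U_mod_of_rep R)"
proof (rule moduleI)
  show "cring (class_ring :: complex ring)" using vec_module[where 'a = complex] by (rule Module.module.axioms)
  show "abelian_group (U_mod_of_rep R)"
  proof (rule abelian_groupI)
    fix x assume "x \<in> carrier (U_mod_of_rep R)"
    then show "\<exists>y\<in>carrier (U_mod_of_rep R). y \<oplus>\<^bsub>U_mod_of_rep R\<^esub> x = \<zero>\<^bsub>U_mod_of_rep R\<^esub>"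
      by (intro bexI[of _ "- x"]) (auto simp: U_mod_of_rep_simps)
  qed (auto simp: U_mod_of_rep_simps assoc_add_vec[of _ "rep_dim R"] comm_add_vec[of _ "rep_dim R"])
qed (auto simp: U_mod_of_rep_simps add_smult_distrib_vec smult_add_distrib_vec[of _ "rep_dim R"] smult_smult_assoc)

lemma submodule_U_mod_of_rep:
  "LinearCombinations.submodule (class_ring :: complex ring) W (U_mod_of_rep R) \<longleftrightarrow> vsub (rep_dim R) W"
  unfolding submodule_def vsub_def using module_U_mod_of_rep[of R]
  by (auto simp: U_mod_of_rep_simps)

locale subquotient_rep =
  fixes R :: U_rep and W W' :: "complex vec set"
  assumes W: "vsub (rep_dim R) W" and W': "vsub (rep_dim R) W'" and WW': "W \<subseteq> W'"
    and mat: "rep_mat R g \<in> carrier_mat (rep_dim R) (rep_dim R)"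
    and actW: "x \<in> W \<Longrightarrow> rep_mat R g *\<^sub>v x \<in> W" and actW': "x \<in> W' \<Longrightarrow> rep_mat R g *\<^sub>v x \<in> W'"
begin

abbreviation "d \<equiv> rep_dim R"
abbreviation "Q \<equiv> U_subquotient (U_mod_of_rep R) W' W"
abbreviation "ac g x \<equiv> rep_mat R g *\<^sub>v x"

lemma carr: "x \<in> W \<Longrightarrow> x \<in> carrier_vec d" "x \<in> W' \<Longrightarrow> x \<in> carrier_vec d"
  using W W' by (auto simp: vsub_def)

lemma dims: "x \<in> W \<Longrightarrow> dim_vec x = d" "x \<in> W' \<Longrightarrow> dim_vec x = d" "x \<in> carrier_vec d \<Longrightarrow> dim_vec x = d"
  using carr by auto

lemma closed:
  "0\<^sub>v d \<in> W" "x \<in> W \<Longrightarrow> y \<in> W \<Longrightarrow> x + y \<in> W" "x \<in> W \<Longrightarrow> c \<cdot>\<^sub>v x \<in> W"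
  "0\<^sub>v d \<in> W'" "x \<in> W' \<Longrightarrow> y \<in> W' \<Longrightarrow> x + y \<in> W'" "x \<in> W' \<Longrightarrow> c \<cdot>\<^sub>v x \<in> W'"
  using W W' by (auto simp: vsub_def)

lemma minus_closed: "x \<in> W \<Longrightarrow> y \<in> W \<Longrightarrow> x - y \<in> W" "x \<in> W' \<Longrightarrow> y \<in> W' \<Longrightarrow> x - y \<in> W'"
proof -
  have *: "x - y = x + (- 1) \<cdot>\<^sub>v y" if "x \<in> carrier_vec d" "y \<in> carrier_vec d" for x y :: "complex vec"
    using that by (intro eq_vecI) (auto simp: dims)
  show "x \<in> W \<Longrightarrow> y \<in> W \<Longrightarrow> x - y \<in> W" "x \<in> W' \<Longrightarrow> y \<in> W' \<Longrightarrow> x - y \<in> W'"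
    using * carr closed by auto
qed

lemma cs_eq: "x \<in> W' \<Longrightarrow> y \<in> W' \<Longrightarrow> cs W x = cs W y \<longleftrightarrow> x - y \<in> W"
proof
  assume xy: "x \<in> W'" "y \<in> W'" and eq: "cs W x = cs W y"
  have "x \<in> cs W x" unfolding cs_def using carr(2)[OF xy(1)] closed(1) by (intro image_eqI[of _ _ "0\<^sub>v d"]) auto
  then obtain h where h: "h \<in> W" "x = h + y" unfolding eq by (auto simp: cs_def)
  then have "x - y = h" using xy by (intro eq_vecI) (auto simp: dims)
  then show "x - y \<in> W" using h by simp
next
  have sub: "cs W x \<subseteq> cs W y" if xy: "x \<in> W'" "y \<in> W'" "x - y \<in> W" for x y
  proof
    fix z assume "z \<in> cs W x"
    then obtain h where h: "h \<in> W" "z = h + x" by (auto simp: cs_def)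
    have "z = (h + (x - y)) + y" unfolding h(2) using h(1) xy
      by (intro eq_vecI) (auto simp: dims)
    then show "z \<in> cs W y" unfolding cs_def using closed(2)[OF h(1) xy(3)] by blast
  qed
  assume xy: "x \<in> W'" "y \<in> W'" "x - y \<in> W"
  have "y - x = (- 1) \<cdot>\<^sub>v (x - y)" using xy by (intro eq_vecI) (auto simp: dims)
  then have "y - x \<in> W" using closed(3)[OF xy(3)] by simp
  then show "cs W x = cs W y" using sub xy by blast
qed

lemma cs_zero: "cs W (0\<^sub>v d) = W"
  unfolding cs_def using carr by force

lemma cs_eq_W: "x \<in> W' \<Longrightarrow> cs W x = W \<longleftrightarrow> x \<in> W"
  using cs_eq[of x "0\<^sub>v d"] closed(4) carr by (simp add: cs_zero)

lemma mem_cs: "x \<in> W' \<Longrightarrow> y \<in> cs W x \<Longrightarrow> y \<in> W' \<and> y - x \<in> W"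
proof -
  assume x: "x \<in> W'" and "y \<in> cs W x"
  then obtain h where h: "h \<in> W" "y = h + x" by (auto simp: cs_def)
  then have "y - x = h" using x by (intro eq_vecI) (auto simp: dims)
  then show ?thesis using h x WW' closed by auto
qed

lemma cs_self: "x \<in> W' \<Longrightarrow> x \<in> cs W x"
  unfolding cs_def using closed(1) carr by (intro image_eqI[of _ _ "0\<^sub>v d"]) auto

lemma Q_carrier: "carrier Q = cs W ` W'"
  by (auto simp: U_subquotient_def U_quotient_def A_RCOSETS_def' a_r_coset_def' U_mod_of_rep_simps cs_def)

lemma Q_zero: "\<zero>\<^bsub>Q\<^esub> = W"
  by (simp add: U_subquotient_def U_quotient_def)

lemma Q_add: "x \<in> W' \<Longrightarrow> y \<in> W' \<Longrightarrow> cs W x \<oplus>\<^bsub>Q\<^esub> cs W y = cs W (x + y)"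
proof -
  assume xy: "x \<in> W'" "y \<in> W'"
  have "cs W x \<oplus>\<^bsub>Q\<^esub> cs W y = (\<Union>h\<in>cs W x. \<Union>k\<in>cs W y. {h + k})"
    by (simp add: U_subquotient_def U_quotient_def set_add_def' U_mod_of_rep_simps)
  also have "\<dots> = cs W (x + y)"
  proof (intro equalityI subsetI)
    fix z assume "z \<in> (\<Union>h\<in>cs W x. \<Union>k\<in>cs W y. {h + k})"
    then obtain h k where hk: "h \<in> W" "k \<in> W" "z = (h + x) + (k + y)" by (auto simp: cs_def)
    have "z = (h + k) + (x + y)" unfolding hk(3) using hk xy by (intro eq_vecI) (auto simp: dims)
    then show "z \<in> cs W (x + y)" unfolding cs_def using closed(2)[OF hk(1,2)] by blast
  next
    fix z assume "z \<in> cs W (x + y)"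
    then obtain h where h: "h \<in> W" "z = h + (x + y)" by (auto simp: cs_def)
    have "z = (h + x) + y" unfolding h(2) using carr(1)[OF h(1)] carr(2)[OF xy(1)] carr(2)[OF xy(2)] by (simp add: assoc_add_vec[of _ d])
    moreover have "h + x \<in> cs W x" using h by (auto simp: cs_def)
    ultimately show "z \<in> (\<Union>h\<in>cs W x. \<Union>k\<in>cs W y. {h + k})" using cs_self[OF xy(2)] by blast
  qed
  finally show ?thesis .
qed

lemma Q_smult: "x \<in> W' \<Longrightarrow> c \<odot>\<^bsub>Q\<^esub> cs W x = cs W (c \<cdot>\<^sub>v x)"
proof -
  assume x: "x \<in> W'"
  have "cs W (c \<cdot>\<^sub>v y) = cs W (c \<cdot>\<^sub>v x)" if "y \<in> cs W x" for y
  proof -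
    from mem_cs[OF x that] have y: "y \<in> W'" "y - x \<in> W" by auto
    have "c \<cdot>\<^sub>v y - c \<cdot>\<^sub>v x = c \<cdot>\<^sub>v (y - x)" using x y by (intro eq_vecI) (auto simp: dims algebra_simps)
    then show ?thesis using closed x y by (subst cs_eq) auto
  qed
  then have "(\<Union>y\<in>cs W x. cs W (c \<cdot>\<^sub>v y)) = cs W (c \<cdot>\<^sub>v x)" using cs_self[OF x] by blast
  then show ?thesis
    by (simp add: U_subquotient_def U_quotient_def a_r_coset_def' U_mod_of_rep_simps cs_def UNION_singleton_eq_range)
qed

lemma ac_lin: "x \<in> W' \<Longrightarrow> y \<in> W' \<Longrightarrow> ac g (x + y) = ac g x + ac g y" "x \<in> W' \<Longrightarrow> ac g (c \<cdot>\<^sub>v x) = c \<cdot>\<^sub>v ac g x"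
  "x \<in> W' \<Longrightarrow> y \<in> W' \<Longrightarrow> ac g (x - y) = ac g x - ac g y"
  using mat[of g] carr by (auto simp: mult_add_distrib_mat_vec[of _ d d] mult_mat_vec[of _ d d] mult_minus_distrib_mat_vec[of _ d d])

lemma Q_act: "x \<in> W' \<Longrightarrow> g \<rhd>\<^bsub>Q\<^esub> cs W x = cs W (ac g x)"
proof -
  assume x: "x \<in> W'"
  have "cs W (ac g y) = cs W (ac g x)" if "y \<in> cs W x" for y
  proof -
    from mem_cs[OF x that] have y: "y \<in> W'" "y - x \<in> W" by auto
    then show ?thesis using actW[OF y(2), of g] actW' x by (subst cs_eq) (auto simp: ac_lin)
  qed
  then have "(\<Union>y\<in>cs W x. cs W (ac g y)) = cs W (ac g x)" using cs_self[OF x] by blast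
  then show ?thesis
    by (simp add: U_subquotient_def U_quotient_def a_r_coset_def' U_mod_of_rep_simps cs_def UNION_singleton_eq_range)
qed

lemma module_Q: "Module.module (class_ring :: complex ring) Q"
proof (rule moduleI)
  show "cring (class_ring :: complex ring)" using vec_module[where 'a = complex] by (rule Module.module.axioms)
  show "abelian_group Q"
  proof (rule abelian_groupI)
    fix x assume "x \<in> carrier Q"
    then obtain x' where x: "x = cs W x'" "x' \<in> W'" by (auto simp: Q_carrier)
    have "(- 1) \<cdot>\<^sub>v x' + x' = 0\<^sub>v d" using carr(2)[OF x(2)] by (intro eq_vecI) (auto simp: dims)
    then show "\<exists>y\<in>carrier Q. y \<oplus>\<^bsub>Q\<^esub> x = \<zero>\<^bsub>Q\<^esub>"
      using x closed by (intro bexI[of _ "cs W ((- 1) \<cdot>\<^sub>v x')"]) (auto simp: Q_carrier Q_zero Q_add cs_zero)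
    have "W \<oplus>\<^bsub>Q\<^esub> x = x" using Q_add[OF closed(4) x(2)] carr(2)[OF x(2)] by (simp add: cs_zero x(1))
    then show "\<zero>\<^bsub>Q\<^esub> \<oplus>\<^bsub>Q\<^esub> x = x" by (simp add: Q_zero)
    fix y assume "y \<in> carrier Q"
    then obtain y' where y: "y = cs W y'" "y' \<in> W'" by (auto simp: Q_carrier)
    show "x \<oplus>\<^bsub>Q\<^esub> y \<in> carrier Q" using x y closed by (auto simp: Q_add Q_carrier)
    show "x \<oplus>\<^bsub>Q\<^esub> y = y \<oplus>\<^bsub>Q\<^esub> x" using x y carr by (simp add: Q_add comm_add_vec[of x' d y'])
    fix z assume "z \<in> carrier Q"
    then obtain z' where z: "z = cs W z'" "z' \<in> W'" by (auto simp: Q_carrier)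
    show "x \<oplus>\<^bsub>Q\<^esub> y \<oplus>\<^bsub>Q\<^esub> z = x \<oplus>\<^bsub>Q\<^esub> (y \<oplus>\<^bsub>Q\<^esub> z)"
      using x y z carr closed by (simp add: Q_add assoc_add_vec[of x' d y' z'])
  qed (use cs_zero closed in \<open>auto simp: Q_zero Q_carrier\<close>)
next
  fix a b :: complex and x assume "x \<in> carrier Q"
  then obtain x' where x: "x = cs W x'" "x' \<in> W'" by (auto simp: Q_carrier)
  show "a \<odot>\<^bsub>Q\<^esub> x \<in> carrier Q" using x closed by (auto simp: Q_smult Q_carrier)
  show "(a \<oplus>\<^bsub>class_ring\<^esub> b) \<odot>\<^bsub>Q\<^esub> x = a \<odot>\<^bsub>Q\<^esub> x \<oplus>\<^bsub>Q\<^esub> b \<odot>\<^bsub>Q\<^esub> x"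
    using x closed by (simp add: Q_smult Q_add add_smult_distrib_vec)
  show "(a \<otimes>\<^bsub>class_ring\<^esub> b) \<odot>\<^bsub>Q\<^esub> x = a \<odot>\<^bsub>Q\<^esub> (b \<odot>\<^bsub>Q\<^esub> x)"
    using x closed by (simp add: Q_smult smult_smult_assoc)
  show "\<one>\<^bsub>class_ring\<^esub> \<odot>\<^bsub>Q\<^esub> x = x" using x by (simp add: Q_smult)
  fix y assume "y \<in> carrier Q"
  then obtain y' where y: "y = cs W y'" "y' \<in> W'" by (auto simp: Q_carrier)
  show "a \<odot>\<^bsub>Q\<^esub> (x \<oplus>\<^bsub>Q\<^esub> y) = a \<odot>\<^bsub>Q\<^esub> x \<oplus>\<^bsub>Q\<^esub> a \<odot>\<^bsub>Q\<^esub> y"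
    using x y closed carr by (simp add: Q_smult Q_add smult_add_distrib_vec[of x' d y'])
qed

definition between :: "complex vec set \<Rightarrow> bool" where
  "between S \<longleftrightarrow> vsub d S \<and> (\<forall>g. \<forall>x\<in>S. ac g x \<in> S) \<and> W \<subseteq> S \<and> S \<subseteq> W'"

text \<open>The correspondence of submodules: S between W and W' goes to its set of cosets, and a
  submodule of the quotient goes to the union of its cosets.\<close>

lemma U_simple_Q: "U_simple Q \<longleftrightarrow> W \<noteq> W' \<and> (\<forall>S. between S \<longrightarrow> S = W \<or> S = W')"
proof
  assume simple: "U_simple Q"
  show "W \<noteq> W' \<and> (\<forall>S. between S \<longrightarrow> S = W \<or> S = W')"
  proof (intro conjI allI impI)
    have "cs W x = W" if "x \<in> W" for x using that cs_eq_W[of x] WW' by auto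
    moreover have "carrier Q \<noteq> {W}" using simple by (simp add: U_simple_def Q_zero)
    ultimately show "W \<noteq> W'" using closed(1) by (auto simp: Q_carrier)
    fix S assume S: "between S"
    then have S': "S \<subseteq> W'" "W \<subseteq> S" "vsub d S" "\<And>g x. x \<in> S \<Longrightarrow> ac g x \<in> S" by (auto simp: between_def)
    have "U_submodule (cs W ` S) Q"
      unfolding U_submodule_def submodule_def
    proof (intro conjI allI ballI impI module_Q)
      show "cs W ` S \<subseteq> carrier Q" using S' by (auto simp: Q_carrier)
      show "\<zero>\<^bsub>Q\<^esub> \<in> cs W ` S" using S' cs_zero closed(1) by (auto simp: Q_zero)
      fix v assume "v \<in> cs W ` S"
      then obtain x where x: "v = cs W x" "x \<in> S" by auto
      then have xW: "x \<in> W'" using S' by auto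
      show "c \<odot>\<^bsub>Q\<^esub> v \<in> cs W ` S" for c using x S' by (auto simp: Q_smult[OF xW] vsub_def)
      show "g \<rhd>\<^bsub>Q\<^esub> v \<in> cs W ` S" for g using x S' by (auto simp: Q_act[OF xW])
      fix w assume "w \<in> cs W ` S"
      then obtain y where y: "w = cs W y" "y \<in> S" by auto
      then have yW: "y \<in> W'" using S' by auto
      show "v \<oplus>\<^bsub>Q\<^esub> w \<in> cs W ` S" using x y S' by (auto simp: Q_add[OF xW yW] vsub_def)
    qed
    then have "cs W ` S = {W} \<or> cs W ` S = carrier Q" using simple by (simp add: U_simple_def Q_zero)
    then show "S = W \<or> S = W'"
    proof
      assume "cs W ` S = {W}"
      have "S \<subseteq> W"
      proof
        fix x assume x: "x \<in> S"
        then have "cs W x = W" using \<open>cs W ` S = {W}\<close> by (metis imageI singletonD)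
        then show "x \<in> W" using cs_eq_W[of x] x S'(1) by auto
      qed
      then show ?thesis using S' by auto
    next
      assume eq: "cs W ` S = carrier Q"
      have "W' \<subseteq> S"
      proof
        fix x assume x: "x \<in> W'"
        then have "cs W x \<in> cs W ` S" unfolding eq Q_carrier by (rule imageI)
        then obtain s where s: "s \<in> S" "cs W x = cs W s" by (rule imageE) simp
        then have "x - s \<in> S" using cs_eq[OF x, of s] S' by auto
        moreover have "x = (x - s) + s" using carr x s S' by (intro eq_vecI) (auto simp: dims)
        ultimately show "x \<in> S" using s S'(3) unfolding vsub_def by metis
      qed
      then show ?thesis using S' by auto
    qed
  qed
next
  assume A: "W \<noteq> W' \<and> (\<forall>S. between S \<longrightarrow> S = W \<or> S = W')"
  show "U_simple Q" unfolding U_simple_def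
  proof (intro conjI allI impI)
    obtain x where x: "x \<in> W'" "x \<notin> W" using A WW' by auto
    then have "cs W x \<in> carrier Q" "cs W x \<noteq> W" using cs_eq_W by (auto simp: Q_carrier)
    then show "carrier Q \<noteq> {\<zero>\<^bsub>Q\<^esub>}" by (auto simp: Q_zero)
    fix T assume T: "U_submodule T Q"
    then have T': "T \<subseteq> cs W ` W'" "W \<in> T" "\<And>X Y. X \<in> T \<Longrightarrow> Y \<in> T \<Longrightarrow> X \<oplus>\<^bsub>Q\<^esub> Y \<in> T"
        "\<And>c X. X \<in> T \<Longrightarrow> c \<odot>\<^bsub>Q\<^esub> X \<in> T" "\<And>g X. X \<in> T \<Longrightarrow> g \<rhd>\<^bsub>Q\<^esub> X \<in> T"
      unfolding U_submodule_def submodule_def by (auto simp: Q_carrier Q_zero)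
    define S where "S = {x \<in> W'. cs W x \<in> T}"
    have "between S" unfolding between_def vsub_def
    proof (intro conjI allI ballI)
      show "S \<subseteq> carrier_vec d" using carr by (auto simp: S_def)
      show "0\<^sub>v d \<in> S" using closed T' cs_zero by (auto simp: S_def)
      show "W \<subseteq> S"
      proof
        fix x assume "x \<in> W"
        then show "x \<in> S" using cs_eq_W[of x] WW' T' by (auto simp: S_def)
      qed
      show "S \<subseteq> W'" by (auto simp: S_def)
      fix x assume x: "x \<in> S"
      show "c \<cdot>\<^sub>v x \<in> S" for c using x closed T'(4)[of "cs W x" c] Q_smult[of x c] by (auto simp: S_def)
      show "ac g x \<in> S" for g using x actW' T'(5)[of "cs W x" g] Q_act[of x g] by (auto simp: S_def)
      fix y assume y: "y \<in> S"
      show "x + y \<in> S" using x y closed T'(3)[of "cs W x" "cs W y"] Q_add[of x y] by (auto simp: S_def)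
    qed
    then have "S = W \<or> S = W'" using A by blast
    then show "T = {\<zero>\<^bsub>Q\<^esub>} \<or> T = carrier Q"
    proof
      assume "S = W"
      then have "T \<subseteq> {W}" using T'(1) cs_eq_W by (auto simp: S_def)
      then show ?thesis using T'(2) by (auto simp: Q_zero)
    next
      assume "S = W'"
      then have "cs W ` W' \<subseteq> T" by (auto simp: S_def)
      then show ?thesis using T'(1) by (auto simp: Q_carrier)
    qed
  qed
qed

section \<open>Trivial subquotients\<close>

abbreviation "T1 \<equiv> U_mod_of_rep trivial_rep"

lemma dim1: "rep_dim trivial_rep = 1"
  by (simp add: trivial_rep_def)

lemma triv_act: "y \<in> carrier_vec 1 \<Longrightarrow> rep_mat trivial_rep g *\<^sub>v y = triv g \<cdot>\<^sub>v y"
  by (cases g) (auto simp: trivial_rep_def triv_def)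

lemma isomorphic_trivial_imp:
  assumes "U_isomorphic Q T1" and x: "x \<in> W'"
  shows "ac g x - triv g \<cdot>\<^sub>v x \<in> W"
proof -
  obtain h where h: "h \<in> LinearCombinations.module_hom (class_ring :: complex ring) Q T1"
    "bij_betw h (carrier Q) (carrier T1)" "\<And>g X. X \<in> carrier Q \<Longrightarrow> h (g \<rhd>\<^bsub>Q\<^esub> X) = g \<rhd>\<^bsub>T1\<^esub> h X"
    using assms(1) unfolding U_isomorphic_def by blast
  have X: "cs W x \<in> carrier Q" "cs W (ac g x) \<in> carrier Q" "cs W (triv g \<cdot>\<^sub>v x) \<in> carrier Q"
    using x actW' closed by (auto simp: Q_carrier)
  have hX: "h (cs W x) \<in> carrier_vec 1"
    using h(1) X by (auto simp: LinearCombinations.module_hom_def U_mod_of_rep_simps dim1)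
  have "h (cs W (ac g x)) = triv g \<cdot>\<^sub>v h (cs W x)"
    using h(3)[OF X(1), of g] triv_act[OF hX] by (simp add: Q_act[OF x] U_mod_of_rep_simps)
  also have "\<dots> = h (triv g \<odot>\<^bsub>Q\<^esub> cs W x)"
    using h(1) X by (auto simp: LinearCombinations.module_hom_def U_mod_of_rep_simps)
  also have "\<dots> = h (cs W (triv g \<cdot>\<^sub>v x))" by (simp add: Q_smult[OF x])
  finally have "cs W (ac g x) = cs W (triv g \<cdot>\<^sub>v x)"
    using h(2) X unfolding bij_betw_def by (auto dest: inj_onD)
  then show ?thesis using cs_eq x actW' closed by auto
qed

text \<open>Where U acts by the trivial character every line is a submodule. A simple quotient is
  therefore the line through the class of any v outside W, and the coordinate along v is the
  isomorphism.\<close>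

lemma isomorphic_trivialI:
  assumes simple: "U_simple Q" and tr: "\<And>g x. x \<in> W' \<Longrightarrow> ac g x - triv g \<cdot>\<^sub>v x \<in> W"
  shows "U_isomorphic Q T1"
proof -
  from simple have ne: "W \<noteq> W'" and between: "\<And>S. between S \<Longrightarrow> S = W \<or> S = W'" by (auto simp: U_simple_Q)
  then obtain v where v: "v \<in> W'" "v \<notin> W" using WW' by auto
  have vc: "v \<in> carrier_vec d" by (rule carr(2)[OF v(1)])
  \<comment> \<open>The subspace W + \<complex> v, invariant because each generator acts on v by a
    scalar modulo W.\<close>
  define S where "S = {x \<in> W'. \<exists>c. x - c \<cdot>\<^sub>v v \<in> W}"
  have "between S" unfolding between_def vsub_def
  proof (intro conjI allI ballI)
    show "S \<subseteq> carrier_vec d" using carr by (auto simp: S_def)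
    have "0\<^sub>v d - 0 \<cdot>\<^sub>v v = 0\<^sub>v d" using vc by (intro eq_vecI) (auto simp: dims)
    then show "0\<^sub>v d \<in> S" using closed by (auto simp: S_def intro!: exI[of _ 0])
    show "W \<subseteq> S"
    proof
      fix x assume x: "x \<in> W"
      have "x - 0 \<cdot>\<^sub>v v = x" using vc carr(1)[OF x] by (intro eq_vecI) (auto simp: dims)
      then show "x \<in> S" using x WW' by (auto simp: S_def intro!: exI[of _ 0])
    qed
    show "S \<subseteq> W'" by (auto simp: S_def)
    fix x assume "x \<in> S"
    then obtain c where x: "x \<in> W'" "x - c \<cdot>\<^sub>v v \<in> W" by (auto simp: S_def)
    note xc = carr(2)[OF x(1)]
    show "e \<cdot>\<^sub>v x \<in> S" for e
    proof -
      have "e \<cdot>\<^sub>v x - (e * c) \<cdot>\<^sub>v v = e \<cdot>\<^sub>v (x - c \<cdot>\<^sub>v v)" using xc vc by (intro eq_vecI) (auto simp: dims algebra_simps)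
      then have "e \<cdot>\<^sub>v x - (e * c) \<cdot>\<^sub>v v \<in> W" using closed(3)[OF x(2)] by simp
      then show ?thesis unfolding S_def using x closed by blast
    qed
    show "ac g x \<in> S" for g
    proof -
      have "ac g x \<in> W'" by (rule actW'[OF x(1)])
      note gc = carr(2)[OF this]
      have "ac g x - (triv g * c) \<cdot>\<^sub>v v = (ac g x - triv g \<cdot>\<^sub>v x) + triv g \<cdot>\<^sub>v (x - c \<cdot>\<^sub>v v)"
        using gc xc vc by (intro eq_vecI) (auto simp: dims algebra_simps)
      then have "ac g x - (triv g * c) \<cdot>\<^sub>v v \<in> W" using closed(2)[OF tr[OF x(1)] closed(3)[OF x(2)]] by simp
      then show ?thesis unfolding S_def using \<open>ac g x \<in> W'\<close> by blast
    qed
    fix y assume "y \<in> S"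
    then obtain e where y: "y \<in> W'" "y - e \<cdot>\<^sub>v v \<in> W" by (auto simp: S_def)
    have "x + y - (c + e) \<cdot>\<^sub>v v = (x - c \<cdot>\<^sub>v v) + (y - e \<cdot>\<^sub>v v)"
      using xc carr(2)[OF y(1)] vc by (intro eq_vecI) (auto simp: dims algebra_simps)
    then have "x + y - (c + e) \<cdot>\<^sub>v v \<in> W" using closed(2)[OF x(2) y(2)] by simp
    then show "x + y \<in> S" unfolding S_def using x y closed by blast
  qed
  moreover have "v \<in> S"
  proof -
    have "v - 1 \<cdot>\<^sub>v v = 0\<^sub>v d" using vc by (intro eq_vecI) (auto simp: dims)
    then show ?thesis unfolding S_def using v closed(1) by (auto intro!: exI[of _ 1])
  qed
  ultimately have SW: "S = W'" using between v by blast
  have rep: "\<exists>c. X = cs W (c \<cdot>\<^sub>v v)" if X: "X \<in> carrier Q" for X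
  proof -
    obtain x where x: "X = cs W x" "x \<in> W'" using X by (auto simp: Q_carrier)
    then obtain c where "x - c \<cdot>\<^sub>v v \<in> W" using SW by (auto simp: S_def)
    then show ?thesis using cs_eq[OF x(2) closed(6)[OF v(1)]] x by blast
  qed
  have uniq: "c = e" if "cs W (c \<cdot>\<^sub>v v) = cs W (e \<cdot>\<^sub>v v)" for c e
  proof (rule ccontr)
    assume "c \<noteq> e"
    have "c \<cdot>\<^sub>v v - e \<cdot>\<^sub>v v \<in> W" using that cs_eq closed v by auto
    then have "inverse (c - e) \<cdot>\<^sub>v (c \<cdot>\<^sub>v v - e \<cdot>\<^sub>v v) \<in> W" by (rule closed)
    moreover have "inverse (c - e) \<cdot>\<^sub>v (c \<cdot>\<^sub>v v - e \<cdot>\<^sub>v v) = v"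
      using \<open>c \<noteq> e\<close> vc by (intro eq_vecI) (auto simp: dims field_simps)
    ultimately show False using v by simp
  qed
  \<comment> \<open>The coordinate along v, well defined on the quotient by \<open>rep\<close> and
    \<open>uniq\<close>.\<close>
  define h where "h X = vec 1 (\<lambda>_. THE c. X = cs W (c \<cdot>\<^sub>v v))" for X :: "complex vec set"
  have h: "h (cs W (c \<cdot>\<^sub>v v)) = vec 1 (\<lambda>_. c)" for c
    unfolding h_def using uniq by (metis (mono_tags, lifting) the_equality)
  note cv = closed(6)[OF v(1)]
  show ?thesis unfolding U_isomorphic_def
  proof (intro bexI[of _ h] conjI allI ballI)
    show "bij_betw h (carrier Q) (carrier T1)" unfolding bij_betw_def
    proof (intro conjI, rule inj_onI)
      fix X Y assume XY: "X \<in> carrier Q" "Y \<in> carrier Q" "h X = h Y"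
      obtain c e where ce: "X = cs W (c \<cdot>\<^sub>v v)" "Y = cs W (e \<cdot>\<^sub>v v)" using rep XY by blast
      then have "vec 1 (\<lambda>_. c) = vec 1 (\<lambda>_. e)" using XY(3) h by simp
      then have "c = e" by (metis index_vec less_one)
      then show "X = Y" using ce by simp
    next
      have "h X \<in> carrier T1" for X by (auto simp: h_def U_mod_of_rep_simps dim1)
      moreover have "y \<in> h ` carrier Q" if y: "y \<in> carrier T1" for y
      proof -
        from y have "y = vec 1 (\<lambda>_. y $ 0)" by (intro eq_vecI) (auto simp: U_mod_of_rep_simps dim1)
      then have "y = h (cs W ((y $ 0) \<cdot>\<^sub>v v))" using h by simp
      moreover have "cs W ((y $ 0) \<cdot>\<^sub>v v) \<in> carrier Q" using cv by (auto simp: Q_carrier)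
        ultimately show "y \<in> h ` carrier Q" by blast
      qed
      ultimately show "h ` carrier Q = carrier T1" by blast
    qed
    show "h \<in> LinearCombinations.module_hom (class_ring :: complex ring) Q T1"
      unfolding LinearCombinations.module_hom_def mem_Collect_eq
    proof (intro conjI allI impI funcsetI)
      fix X assume "X \<in> carrier Q"
      then show "h X \<in> carrier T1" by (auto simp: h_def U_mod_of_rep_simps dim1)
    next
      fix X Y assume XY: "X \<in> carrier Q \<and> Y \<in> carrier Q"
      then obtain c e where ce: "X = cs W (c \<cdot>\<^sub>v v)" "Y = cs W (e \<cdot>\<^sub>v v)" using rep by blast
      then show "h (X \<oplus>\<^bsub>Q\<^esub> Y) = h X \<oplus>\<^bsub>T1\<^esub> h Y"
        by (simp add: Q_add[OF cv cv] add_smult_distrib_vec[symmetric] h U_mod_of_rep_simps) (intro eq_vecI; simp)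
    next
      fix e :: complex and X assume "e \<in> carrier class_ring \<and> X \<in> carrier Q"
      then obtain c where c: "X = cs W (c \<cdot>\<^sub>v v)" using rep by blast
      then show "h (e \<odot>\<^bsub>Q\<^esub> X) = e \<odot>\<^bsub>T1\<^esub> h X"
        by (simp add: Q_smult[OF cv] smult_smult_assoc h U_mod_of_rep_simps) (intro eq_vecI; simp)
    qed
    fix g X assume "X \<in> carrier Q"
    then obtain c where c: "X = cs W (c \<cdot>\<^sub>v v)" using rep by blast
    have "g \<rhd>\<^bsub>Q\<^esub> X = cs W (triv g \<cdot>\<^sub>v (c \<cdot>\<^sub>v v))"
      unfolding c Q_act[OF cv] using tr[OF cv] actW'[OF cv] closed(6)[OF cv] by (subst cs_eq) auto
    then have "h (g \<rhd>\<^bsub>Q\<^esub> X) = vec 1 (\<lambda>_. triv g * c)" by (simp add: smult_smult_assoc h)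
    also have "\<dots> = triv g \<cdot>\<^sub>v vec 1 (\<lambda>_. c)" by (intro eq_vecI) (auto simp: dims)
    also have "\<dots> = g \<rhd>\<^bsub>T1\<^esub> h X" by (simp add: U_mod_of_rep_simps c h triv_act)
    finally show "h (g \<rhd>\<^bsub>Q\<^esub> X) = g \<rhd>\<^bsub>T1\<^esub> h X" .
  qed
qed

end


section \<open>Column vectors as functions on sign sequences\<close>

text \<open>The index \<open>bidx l\<close> reads the signs as binary digits with the head as
  leading digit. This is the index convention of \<open>kronecker\<close> when the first letter is
  the left factor.\<close>

definition to_fun :: "nat \<Rightarrow> complex vec \<Rightarrow> bool list \<Rightarrow> complex" where
  "to_fun n x l = (if length l = n then x $ bidx l else 0)"

lemma to_fun_app: "length l = n \<Longrightarrow> to_fun n x l = x $ bidx l"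
  by (simp add: to_fun_def)

lemma to_fun_bij: "bij_betw (to_fun n) (carrier_vec (2 ^ n)) (supp_len n)"
proof (rule bij_betw_imageI)
  show "inj_on (to_fun n) (carrier_vec (2 ^ n))"
  proof (rule inj_onI, rule eq_vecI)
    fix x y :: "complex vec" and i
    assume xy: "x \<in> carrier_vec (2 ^ n)" "y \<in> carrier_vec (2 ^ n)" "to_fun n x = to_fun n y"
    then show "dim_vec x = dim_vec y" by auto
    assume "i < dim_vec y"
    then have "i \<in> {..<2 ^ n}" using xy by auto
    then obtain l where l: "length l = n" "bidx l = i"
      unfolding bij_betw_imp_surj_on[OF bij_betw_bidx, of n, symmetric] by auto
    show "x $ i = y $ i" using fun_cong[OF xy(3), of l] l by (simp add: to_fun_def)
  qed
  show "to_fun n ` carrier_vec (2 ^ n) = supp_len n"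
  proof (intro equalityI subsetI)
    fix f assume "f \<in> to_fun n ` carrier_vec (2 ^ n)"
    then show "f \<in> supp_len n" by (auto simp: supp_len_def to_fun_def split: if_splits)
  next
    fix f assume f: "f \<in> supp_len n"
    define x where "x = vec (2 ^ n) (\<lambda>i. f (inv_into {l. length l = n} bidx i))"
    have "to_fun n x = f"
    proof
      fix l show "to_fun n x l = f l"
      proof (cases "length l = n")
        case True
        then have "inv_into {l. length l = n} bidx (bidx l) = l"
          using bij_betw_imp_inj_on[OF bij_betw_bidx, of n] by simp
        then show ?thesis using True bidx_less[of l] by (simp add: to_fun_def x_def)
      qed (use supp_lenD[OF f] in \<open>simp add: to_fun_def\<close>)
    qed
    moreover have "x \<in> carrier_vec (2 ^ n)" by (simp add: x_def)
    ultimately show "f \<in> to_fun n ` carrier_vec (2 ^ n)" by blast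
  qed
qed

lemma to_fun_linear:
  "y \<in> carrier_vec (2 ^ n) \<Longrightarrow> to_fun n (x + y) = (\<lambda>l. to_fun n x l + to_fun n y l)"
  "y \<in> carrier_vec (2 ^ n) \<Longrightarrow> to_fun n (x - y) = (\<lambda>l. to_fun n x l - to_fun n y l)"
  "y \<in> carrier_vec (2 ^ n) \<Longrightarrow> to_fun n (c \<cdot>\<^sub>v y) = (\<lambda>l. c * to_fun n y l)"
  "y \<in> carrier_vec (2 ^ n) \<Longrightarrow> to_fun n (- y) = (\<lambda>l. - to_fun n y l)"
  "to_fun n (0\<^sub>v (2 ^ n)) = (\<lambda>_. 0)"
  using bidx_less by (auto simp: to_fun_def fun_eq_iff)

lemma kronecker_carrier:
  "A \<in> carrier_mat m m \<Longrightarrow> B \<in> carrier_mat k k \<Longrightarrow> A \<otimes>\<^sub>m B \<in> carrier_mat (m * k) (m * k)"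
  by (auto simp: kronecker_def)

definition block :: "nat \<Rightarrow> nat \<Rightarrow> complex vec \<Rightarrow> complex vec" where
  "block m i x = vec m (\<lambda>j. x $ (i * m + j))"

text \<open>Block form for a 2 x 2 left factor: the index set splits into two halves of length m, on
  each of which the entry of A is constant.\<close>

lemma kronecker_mult_vec:
  assumes A: "A \<in> carrier_mat 2 2" and B: "B \<in> carrier_mat m m" and x: "x \<in> carrier_vec (2 * m)"
    and i: "i < 2" and j: "j < m"
  shows "((A \<otimes>\<^sub>m B) *\<^sub>v x) $ (i * m + j)
    = A $$ (i, 0) * (B *\<^sub>v block m 0 x) $ j + A $$ (i, 1) * (B *\<^sub>v block m 1 x) $ j"
proof -
  have ij: "i * m + j < 2 * m" using i j by (cases i) auto
  have dm: "(i * m + j) div m = i" "(i * m + j) mod m = j" using j by auto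
  have "((A \<otimes>\<^sub>m B) *\<^sub>v x) $ (i * m + j) = (\<Sum>c\<in>{0..<2 * m}. A $$ (i, c div m) * B $$ (j, c mod m) * x $ c)"
    using A B x ij dm by (simp add: kronecker_def scalar_prod_def)
  also have "{0..<2 * m} = {0..<m} \<union> {m..<2 * m}" by auto
  also have "(\<Sum>c\<in>{0..<m} \<union> {m..<2 * m}. A $$ (i, c div m) * B $$ (j, c mod m) * x $ c)
      = (\<Sum>c\<in>{0..<m}. A $$ (i, c div m) * B $$ (j, c mod m) * x $ c)
        + (\<Sum>c\<in>{m..<2 * m}. A $$ (i, c div m) * B $$ (j, c mod m) * x $ c)"
    by (rule sum.union_disjoint) auto
  also have "(\<Sum>c\<in>{m..<2 * m}. A $$ (i, c div m) * B $$ (j, c mod m) * x $ c)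
      = (\<Sum>c\<in>{0..<m}. A $$ (i, 1) * (B $$ (j, c) * x $ (m + c)))"
    by (rule sum.reindex_bij_witness[of _ "\<lambda>c. c + m" "\<lambda>c. c - m"]) (auto simp: div_add_self2 le_div_geq le_mod_geq)
  also have "(\<Sum>c\<in>{0..<m}. A $$ (i, c div m) * B $$ (j, c mod m) * x $ c) = (\<Sum>c\<in>{0..<m}. A $$ (i, 0) * (B $$ (j, c) * x $ c))"
    by (rule sum.cong) auto
  finally show ?thesis using B j by (simp add: block_def scalar_prod_def sum_distrib_left)
qed

lemma rep_dim_word: "rep_dim (word_rep q w) = 2 ^ length w"
  by (induction w) (simp_all add: trivial_rep_def tensor_rep_def eval_rep_def Let_def)

lemma rep_dim_eval: "rep_dim (eval_rep q a) = 2"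
  by (simp add: eval_rep_def Let_def)

lemma eval_rep_mat: "rep_mat (eval_rep q a) g \<in> carrier_mat 2 2"
  by (rule carrier_matI; cases g) (simp_all add: eval_rep_def Let_def mat_of_rows_list_def)

lemma word_rep_mat: "rep_mat (word_rep q w) g \<in> carrier_mat (2 ^ length w) (2 ^ length w)"
proof (induction w arbitrary: g)
  case Nil
  show ?case by (auto simp: trivial_rep_def)
next
  case (Cons a w)
  show ?case
    using kronecker_carrier[OF eval_rep_mat Cons] kronecker_carrier[OF one_carrier_mat Cons, of 2]
      kronecker_carrier[OF eval_rep_mat one_carrier_mat, of q a _ "2 ^ length w"]
    by (cases g) (simp_all add: tensor_rep_def Let_def rep_dim_word rep_dim_eval)
qed

lemma to_fun_block:
  "x \<in> carrier_vec (2 ^ Suc n) \<Longrightarrow> (\<lambda>l. to_fun (Suc n) x (b # l)) = to_fun n (block (2 ^ n) (if b then 1 else 0) x)"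
  using bidx_less by (auto simp: to_fun_def block_def fun_eq_iff)

text \<open>Identifies the matrices of \<open>word_rep\<close> with the operators
  \<open>wact\<close>, letter by letter.\<close>

lemma to_fun_act:
  "x \<in> carrier_vec (2 ^ length w) \<Longrightarrow> to_fun (length w) (rep_mat (word_rep q w) g *\<^sub>v x) = wact q w g (to_fun (length w) x)"
proof (induction w arbitrary: g x)
  case Nil
  show ?case using Nil by (cases g) (auto simp: trivial_rep_def to_fun_def fun_eq_iff scalar_prod_def)
next
  case (Cons a w)
  let ?n = "length w" let ?m = "2 ^ length w :: nat"
  let ?e = "rep_mat (eval_rep q a)" and ?\<sigma> = "rep_mat (word_rep q w)"
  let ?x = "to_fun (Suc ?n) x"
  have x: "x \<in> carrier_vec (2 * ?m)" using Cons.prems by simp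
  have bl: "block ?m i x \<in> carrier_vec ?m" for i by (simp add: block_def)
  have p0: "to_fun ?n (block ?m 0 x) = (\<lambda>l. ?x (False # l))" and p1: "to_fun ?n (block ?m 1 x) = (\<lambda>l. ?x (True # l))"
    using to_fun_block[of x ?n False] to_fun_block[of x ?n True] x by simp_all
  have B: "(?\<sigma> g *\<^sub>v block ?m i x) $ bidx l = wact q w g (to_fun ?n (block ?m i x)) l" if "length l = ?n" for g i l
    using fun_cong[OF Cons.IH[OF bl, of g i], of l] that by (simp add: to_fun_app)
  have J: "(1\<^sub>m ?m *\<^sub>v block ?m i x) $ bidx l = to_fun ?n (block ?m i x) l" if "length l = ?n" for i l
    using that bl by (simp add: to_fun_def)
  have I1: "bidx (b # l) = (if b then 1 else 0) * ?m + bidx l" if "length l = ?n" for b l using that by simp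
  \<comment> \<open>KA, KJ and KI treat the three shapes of terms in the coproducts: generator on
    both factors, identity on the right, identity on the left.\<close>
  have KA: "((?e h \<otimes>\<^sub>m ?\<sigma> g) *\<^sub>v x) $ bidx (b # l)
     = ?e h $$ (if b then 1 else 0, 0) * wact q w g (\<lambda>l. ?x (False # l)) l + ?e h $$ (if b then 1 else 0, 1) * wact q w g (\<lambda>l. ?x (True # l)) l"
    if l: "length l = ?n" for g h b l
    unfolding I1[OF l] using bidx_less[of l] l
    by (subst kronecker_mult_vec[OF eval_rep_mat word_rep_mat x]) (simp_all add: B p0 p1[unfolded One_nat_def])
  have KJ: "((?e h \<otimes>\<^sub>m 1\<^sub>m ?m) *\<^sub>v x) $ bidx (b # l)
     = ?e h $$ (if b then 1 else 0, 0) * ?x (False # l) + ?e h $$ (if b then 1 else 0, 1) * ?x (True # l)"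
    if l: "length l = ?n" for h b l
    unfolding I1[OF l] using bidx_less[of l] l
    by (subst kronecker_mult_vec[OF eval_rep_mat one_carrier_mat x]) (simp_all only: J[OF l] p0 p1, simp_all)
  have KI: "((1\<^sub>m 2 \<otimes>\<^sub>m ?\<sigma> g) *\<^sub>v x) $ bidx (b # l) = wact q w g (\<lambda>m. ?x (b # m)) l"
    if l: "length l = ?n" for g b l
    unfolding I1[OF l] using bidx_less[of l] l
    by (subst kronecker_mult_vec[OF one_carrier_mat word_rep_mat x]) (simp_all add: B p0 p1[unfolded One_nat_def])
  note car = kronecker_carrier[OF eval_rep_mat word_rep_mat] kronecker_carrier[OF one_carrier_mat word_rep_mat, of 2]
    kronecker_carrier[OF eval_rep_mat one_carrier_mat, of q a _ ?m]
  have add: "((A + A') *\<^sub>v x) $ bidx (b # l) = (A *\<^sub>v x) $ bidx (b # l) + (A' *\<^sub>v x) $ bidx (b # l)"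
    if "A \<in> carrier_mat (2 * ?m) (2 * ?m)" "A' \<in> carrier_mat (2 * ?m) (2 * ?m)" "length l = ?n" for A A' b l
    using that bidx_less[of "b # l"] by (simp add: add_mult_distrib_mat_vec[OF that(1,2) x] del: bidx.simps)
  have main: "(rep_mat (word_rep q (a # w)) g *\<^sub>v x) $ bidx (b # l) = tens q (q powi a) (wact q w) g ?x (b # l)"
    if l: "length l = ?n" for b l
  proof -
    have e: "?e K $$ (0, 0) = q" "?e K $$ (0, Suc 0) = 0" "?e K $$ (Suc 0, 0) = 0" "?e K $$ (Suc 0, Suc 0) = inverse q"
      "?e K_inv $$ (0, 0) = inverse q" "?e K_inv $$ (0, Suc 0) = 0" "?e K_inv $$ (Suc 0, 0) = 0" "?e K_inv $$ (Suc 0, Suc 0) = q"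
      "?e E1 $$ (0, 0) = 0" "?e E1 $$ (0, Suc 0) = 1" "?e E1 $$ (Suc 0, 0) = 0" "?e E1 $$ (Suc 0, Suc 0) = 0"
      "?e F1 $$ (0, 0) = 0" "?e F1 $$ (0, Suc 0) = 0" "?e F1 $$ (Suc 0, 0) = 1" "?e F1 $$ (Suc 0, Suc 0) = 0"
      "?e E0 $$ (0, 0) = 0" "?e E0 $$ (0, Suc 0) = 0" "?e E0 $$ (Suc 0, 0) = q powi a" "?e E0 $$ (Suc 0, Suc 0) = 0"
      "?e F0 $$ (0, 0) = 0" "?e F0 $$ (0, Suc 0) = inverse (q powi a)" "?e F0 $$ (Suc 0, 0) = 0" "?e F0 $$ (Suc 0, Suc 0) = 0"
      by (simp_all add: eval_rep_def Let_def mat_of_rows_list_def power_int_minus)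
    show ?thesis
      by (cases g; cases b)
        (simp_all add: tensor_rep_def Let_def rep_dim_word rep_dim_eval add[OF car(1) car(2) l] add[OF car(3) car(1) l]
          KA[OF l] KJ[OF l] KI[OF l] e tens_simps del: bidx.simps)
  qed
  show ?case unfolding wact_Cons
  proof
    fix l
    have "wact q (a # w) g (to_fun (length (a # w)) x) \<in> supp_len (length (a # w))"
      by (rule wact_supp_len) (simp add: supp_len_def to_fun_def)
    then have sl: "tens q (q powi a) (wact q w) g (to_fun (length (a # w)) x) \<in> supp_len (length (a # w))"
      by (simp only: wact_Cons)
    show "to_fun (length (a # w)) (rep_mat (word_rep q (a # w)) g *\<^sub>v x) l
      = tens q (q powi a) (wact q w) g (to_fun (length (a # w)) x) l"
    proof (cases "length l = length (a # w)")
      case True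
      then obtain b l' where l: "l = b # l'" "length l' = ?n" by (cases l) auto
      show ?thesis using main[OF l(2), of b] l by (simp add: to_fun_def[of _ "rep_mat _ _ *\<^sub>v _"] del: word_rep.simps bidx.simps)
    qed (use supp_lenD[OF sl] in \<open>simp add: to_fun_def\<close>)
  qed
qed


section \<open>Composition series of a word\<close>

abbreviation word_mod :: "complex \<Rightarrow> int list \<Rightarrow> complex vec U_mod" where
  "word_mod q w \<equiv> U_mod_of_rep (word_rep q w)"

lemma to_fun_eq_iff:
  "x \<in> carrier_vec (2 ^ n) \<Longrightarrow> y \<in> carrier_vec (2 ^ n) \<Longrightarrow> x = y \<longleftrightarrow> to_fun n x = to_fun n y"
  using bij_betw_imp_inj_on[OF to_fun_bij] by (metis inj_onD)

lemma word_mod_simps: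
  "carrier (word_mod q w) = carrier_vec (2 ^ length w)" "\<zero>\<^bsub>word_mod q w\<^esub> = 0\<^sub>v (2 ^ length w)"
  "x \<oplus>\<^bsub>word_mod q w\<^esub> y = x + y" "c \<odot>\<^bsub>word_mod q w\<^esub> x = c \<cdot>\<^sub>v x"
  by (simp_all add: U_mod_of_rep_simps rep_dim_word)

lemma word_mod_act:
  assumes "x \<in> carrier_vec (2 ^ length w)"
  shows "g \<rhd>\<^bsub>word_mod q w\<^esub> x \<in> carrier_vec (2 ^ length w)"
    "to_fun (length w) (g \<rhd>\<^bsub>word_mod q w\<^esub> x) = wact q w g (to_fun (length w) x)"
  using assms mult_mat_vec_carrier[OF word_rep_mat] to_fun_act by (auto simp: U_mod_of_rep_simps)

lemma word_mod_minus:
  assumes "x \<in> carrier_vec (2 ^ length w)" "y \<in> carrier_vec (2 ^ length w)"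
  shows "\<ominus>\<^bsub>word_mod q w\<^esub> y = - y" "x \<ominus>\<^bsub>word_mod q w\<^esub> y = x - y"
proof -
  interpret Module.module "class_ring :: complex ring" "word_mod q w" by (rule module_U_mod_of_rep)
  show *: "\<ominus>\<^bsub>word_mod q w\<^esub> y = - y"
    using assms by (intro M.minus_equality) (auto simp: word_mod_simps)
  show "x \<ominus>\<^bsub>word_mod q w\<^esub> y = x - y"
    unfolding a_minus_def * using assms by (simp add: word_mod_simps minus_add_uminus_vec[of _ "2 ^ length w"])
qed

lemma U_module_word:
  assumes q: "q \<noteq> 0" "q^2 \<noteq> 1"
  shows "U_module q (word_mod q w)"
proof -
  let ?M = "word_mod q w" and ?n = "length w" let ?C = "carrier_vec (2 ^ length w) :: complex vec set"
  note r = U_relsD[OF U_rels_wact[OF q], of w]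
  note L = linear_op_add[OF linear_op_wact] linear_op_scale[OF linear_op_wact] linear_op_diff[OF linear_op_wact]
  have act: "g \<rhd>\<^bsub>?M\<^esub> x \<in> ?C" if "x \<in> ?C" for g x by (rule word_mod_act(1)[OF that])
  have cl: "x + y \<in> ?C" "x - y \<in> ?C" "c \<cdot>\<^sub>v x \<in> ?C" "- x \<in> ?C" if "x \<in> ?C" "y \<in> ?C" for x y c using that by auto
  have kk: "wact q w K (wact q w E1 (wact q w K_inv f)) = (\<lambda>l. q\<^sup>2 * wact q w E1 f l)"
    "wact q w K (wact q w F1 (wact q w K_inv f)) = (\<lambda>l. inverse (q\<^sup>2) * wact q w F1 f l)"
    "wact q w K (wact q w E0 (wact q w K_inv f)) = (\<lambda>l. inverse (q\<^sup>2) * wact q w E0 f l)"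
    "wact q w K (wact q w F0 (wact q w K_inv f)) = (\<lambda>l. q\<^sup>2 * wact q w F0 f l)" for f
    by (simp_all add: r L)
  note S = word_mod_simps word_mod_minus word_mod_act(2) to_fun_linear act cl
  have eqI: "to_fun ?n x = to_fun ?n y \<Longrightarrow> x = y" if "x \<in> ?C" "y \<in> ?C" for x y
    using to_fun_eq_iff[OF that] by simp
  show ?thesis
  proof (rule U_module.intro, goal_cases)
    case 1
    show ?case by (rule module_U_mod_of_rep)
  next
    case (2 g)
    show ?case unfolding LinearCombinations.module_hom_def mem_Collect_eq
    proof (intro conjI allI impI funcsetI)
      fix x assume "x \<in> carrier ?M"
      then show "g \<rhd>\<^bsub>?M\<^esub> x \<in> carrier ?M" using act by (simp add: word_mod_simps)
    next
      fix x y assume "x \<in> carrier ?M \<and> y \<in> carrier ?M"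
      then show "g \<rhd>\<^bsub>?M\<^esub> (x \<oplus>\<^bsub>?M\<^esub> y) = g \<rhd>\<^bsub>?M\<^esub> x \<oplus>\<^bsub>?M\<^esub> g \<rhd>\<^bsub>?M\<^esub> y"
        by (intro eqI) (simp_all add: S L)
    next
      fix c :: complex and x assume "c \<in> carrier class_ring \<and> x \<in> carrier ?M"
      then show "g \<rhd>\<^bsub>?M\<^esub> (c \<odot>\<^bsub>?M\<^esub> x) = c \<odot>\<^bsub>?M\<^esub> g \<rhd>\<^bsub>?M\<^esub> x"
        by (intro eqI) (simp_all add: S L)
    qed
  next
    \<comment> \<open>The thirteenth axiom is \<open>serre\<close>; its rewrite rules are supplied
      separately for the four pairs.\<close>
    case (13 x a b)
    then have x: "x \<in> ?C" by (simp add: word_mod_simps)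
    from 13(2) consider "a = E0 \<and> b = E1" | "a = E1 \<and> b = E0" | "a = F0 \<and> b = F1" | "a = F1 \<and> b = F0" by auto
    then show ?case
      by cases (rule eqI; simp add: S x; simp add: r(15-18) algebra_simps)+
  qed (rule eqI; simp add: S; simp add: kk r(1,2,11-14))+
qed

definition vsets :: "nat \<Rightarrow> (bool list \<Rightarrow> complex) set \<Rightarrow> complex vec set" where
  "vsets n S = carrier_vec (2 ^ n) \<inter> to_fun n -` S"

lemma image_vsets:
  assumes "S \<subseteq> supp_len n"
  shows "to_fun n ` vsets n S = S"
proof (intro equalityI subsetI)
  fix f assume f: "f \<in> S"
  then have "f \<in> to_fun n ` carrier_vec (2 ^ n)"
    using assms bij_betw_imp_surj_on[OF to_fun_bij, of n] by auto
  then obtain x where "x \<in> carrier_vec (2 ^ n)" "f = to_fun n x" by auto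
  then show "f \<in> to_fun n ` vsets n S" using f by (auto simp: vsets_def)
qed (auto simp: vsets_def)

lemma vsets_image:
  assumes "W \<subseteq> carrier_vec (2 ^ n)"
  shows "vsets n (to_fun n ` W) = W"
proof (intro equalityI subsetI)
  fix x assume "x \<in> vsets n (to_fun n ` W)"
  then obtain y where "x \<in> carrier_vec (2 ^ n)" "y \<in> W" "to_fun n x = to_fun n y" by (auto simp: vsets_def)
  then show "x \<in> W" using to_fun_eq_iff[of x n y] assms by auto
qed (use assms in \<open>auto simp: vsets_def\<close>)

lemma vsets_submodule:
  assumes S: "inv_subsp (wact q w) S"
  shows "U_submodule (vsets (length w) S) (word_mod q w)"
  unfolding U_submodule_def submodule_U_mod_of_rep vsub_def rep_dim_word vsets_def
  using subsp_zero[OF inv_subsp_subsp[OF S]] subsp_add[OF inv_subsp_subsp[OF S]] subsp_scale[OF inv_subsp_subsp[OF S]]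
    inv_subsp_act[OF S] word_mod_act
  by (auto simp: to_fun_linear)

lemma image_inv_subsp:
  assumes W: "U_submodule W (word_mod q w)"
  shows "inv_subsp (wact q w) (to_fun (length w) ` W)" "W \<subseteq> carrier_vec (2 ^ length w)" "vsub (2 ^ length w) W"
    "x \<in> W \<Longrightarrow> rep_mat (word_rep q w) g *\<^sub>v x \<in> W"
proof -
  have v: "vsub (2 ^ length w) W" and a: "\<And>g x. x \<in> W \<Longrightarrow> rep_mat (word_rep q w) g *\<^sub>v x \<in> W"
    using W by (auto simp: U_submodule_def submodule_U_mod_of_rep rep_dim_word U_mod_of_rep_simps)
  then show v': "vsub (2 ^ length w) W" "x \<in> W \<Longrightarrow> rep_mat (word_rep q w) g *\<^sub>v x \<in> W" by auto
  show c: "W \<subseteq> carrier_vec (2 ^ length w)" using v by (simp add: vsub_def)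
  show "inv_subsp (wact q w) (to_fun (length w) ` W)"
    unfolding inv_subsp_def subsp_def
  proof (intro conjI allI ballI)
    show "(\<lambda>_. 0) \<in> to_fun (length w) ` W" using v to_fun_linear(5) unfolding vsub_def by (metis imageI)
    fix f assume "f \<in> to_fun (length w) ` W"
    then obtain x where x: "f = to_fun (length w) x" "x \<in> W" by auto
    have xc: "x \<in> carrier_vec (2 ^ length w)" using x c by auto
    show "(\<lambda>i. k * f i) \<in> to_fun (length w) ` W" for k
      unfolding x(1) to_fun_linear(3)[OF xc, symmetric] using v x by (auto simp: vsub_def)
    show "wact q w g f \<in> to_fun (length w) ` W" for g
      unfolding x(1) to_fun_act[OF xc, symmetric] using a x by auto
    fix g assume "g \<in> to_fun (length w) ` W"
    then obtain y where y: "g = to_fun (length w) y" "y \<in> W" by auto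
    have yc: "y \<in> carrier_vec (2 ^ length w)" using y c by auto
    show "(\<lambda>i. f i + g i) \<in> to_fun (length w) ` W"
      unfolding x(1) y(1) to_fun_linear(1)[OF yc, symmetric] using v x y by (auto simp: vsub_def)
  qed
qed

text \<open>\<open>to_fun\<close> matches the invariant subspaces on both sides, so the submodules
  between W and W' correspond to the invariant subspaces between their images.\<close>

lemma U_simple_iff_simple_step:
  assumes sub: "U_submodule W (word_mod q w)" "U_submodule W' (word_mod q w)" "W \<subseteq> W'"
  shows "U_simple (U_subquotient (word_mod q w) W' W)
    \<longleftrightarrow> simple_step (wact q w) (to_fun (length w) ` W) (to_fun (length w) ` W')"
proof -
  let ?t = "to_fun (length w)"
  note I = image_inv_subsp[OF sub(1)] and I' = image_inv_subsp[OF sub(2)]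
  interpret subquotient_rep "word_rep q w" W W'
    using I I' sub(3) word_rep_mat by unfold_locales (auto simp: rep_dim_word)
  have inj: "inj_on ?t W'" using bij_betw_imp_inj_on[OF to_fun_bij] I'(2) by (rule inj_on_subset)
  have ne: "?t ` W \<subset> ?t ` W' \<longleftrightarrow> W \<noteq> W'"
    using inj_on_image_eq_iff[OF inj sub(3) order_refl] sub(3) by blast
  show ?thesis unfolding U_simple_Q simple_step_def ne
  proof (intro conj_cong refl iffI allI impI)
    fix S assume A: "\<forall>S. between S \<longrightarrow> S = W \<or> S = W'"
      and S: "inv_subsp (wact q w) S \<and> ?t ` W \<subseteq> S \<and> S \<subseteq> ?t ` W'"
    have Sx: "S \<subseteq> supp_len (length w)"
      using S I'(2) bij_betw_imp_surj_on[OF to_fun_bij, of "length w"] by blast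
    note V = image_inv_subsp[OF vsets_submodule[OF conjunct1[OF S]]]
    have "vsets (length w) S \<subseteq> vsets (length w) (?t ` W')" "vsets (length w) (?t ` W) \<subseteq> vsets (length w) S"
      using S by (auto simp: vsets_def)
    then have "between (vsets (length w) S)"
      unfolding between_def vsets_image[OF I(2)] vsets_image[OF I'(2)] using V by (auto simp: rep_dim_word)
    then have "vsets (length w) S = W \<or> vsets (length w) S = W'" using A by blast
    then show "S = ?t ` W \<or> S = ?t ` W'" using image_vsets[OF Sx] by auto
  next
    fix S assume A: "\<forall>R. inv_subsp (wact q w) R \<and> ?t ` W \<subseteq> R \<and> R \<subseteq> ?t ` W' \<longrightarrow> R = ?t ` W \<or> R = ?t ` W'"
      and S: "between S"
    have "U_submodule S (word_mod q w)"
      using S unfolding between_def U_submodule_def submodule_U_mod_of_rep by (simp add: U_mod_of_rep_simps)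
    from image_inv_subsp(1)[OF this] have inv: "inv_subsp (wact q w) (?t ` S)" .
    have WS: "W \<subseteq> S" "S \<subseteq> W'" using S by (auto simp: between_def)
    from A inv image_mono[OF WS(1), of ?t] image_mono[OF WS(2), of ?t] have "?t ` S = ?t ` W \<or> ?t ` S = ?t ` W'" by blast
    then show "S = W \<or> S = W'"
      using inj_on_image_eq_iff[OF inj WS(2) sub(3)] inj_on_image_eq_iff[OF inj WS(2) order_refl] by blast
  qed
qed

text \<open>Simplicity matters for the direction from right to left: a character step alone may have
  a quotient that is a sum of several trivial modules.\<close>

lemma isomorphic_trivial_iff_char_step:
  assumes sub: "U_submodule W (word_mod q w)" "U_submodule W' (word_mod q w)" "W \<subseteq> W'"
    and simple: "U_simple (U_subquotient (word_mod q w) W' W)"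
  shows "U_isomorphic (U_subquotient (word_mod q w) W' W) (U_mod_of_rep trivial_rep)
    \<longleftrightarrow> char_step (wact q w) triv (to_fun (length w) ` W) (to_fun (length w) ` W')"
proof -
  let ?t = "to_fun (length w)"
  note I = image_inv_subsp[OF sub(1)] and I' = image_inv_subsp[OF sub(2)]
  interpret subquotient_rep "word_rep q w" W W'
    using I I' sub(3) word_rep_mat by unfold_locales (auto simp: rep_dim_word)
  have strict: "?t ` W \<subset> ?t ` W'"
    using simple unfolding U_simple_iff_simple_step[OF sub] by (simp add: simple_step_def)
  have key: "?t (rep_mat (word_rep q w) g *\<^sub>v x - triv g \<cdot>\<^sub>v x) = (\<lambda>l. wact q w g (?t x) l - triv g * ?t x l)"
    if "x \<in> W'" for g x
  proof -
    have xc: "x \<in> carrier_vec (2 ^ length w)" using that I'(2) by auto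
    then show ?thesis by (simp add: to_fun_linear to_fun_act)
  qed
  have inj: "inj_on ?t W'" using bij_betw_imp_inj_on[OF to_fun_bij] I'(2) by (rule inj_on_subset)
  have mem: "?t y \<in> ?t ` W \<longleftrightarrow> y \<in> W" if "y \<in> W'" for y using inj_on_image_mem_iff[OF inj that sub(3)] .
  have "char_step (wact q w) triv (?t ` W) (?t ` W') \<longleftrightarrow> (\<forall>g. \<forall>x\<in>W'. rep_mat (word_rep q w) g *\<^sub>v x - triv g \<cdot>\<^sub>v x \<in> W)"
    unfolding char_step_def using strict
    by (simp add: key[symmetric] mem minus_closed actW' closed)
  then show ?thesis using isomorphic_trivial_imp isomorphic_trivialI[OF simple] by blast
qed

lemma composition_series_count:
  assumes q: "q \<noteq> 0" "\<And>k::nat. k > 0 \<Longrightarrow> q ^ k \<noteq> 1"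
    and Ws: "composition_series q (word_mod q w) Ws"
  shows "card {i. Suc i < length Ws \<and> U_isomorphic (U_subquotient (word_mod q w) (Ws ! Suc i) (Ws ! i)) (U_mod_of_rep trivial_rep)}
    = balanced_count w (\<lambda>_. 0)"
proof -
  let ?t = "to_fun (length w)"
  define r where "r = length Ws - 1"
  have len: "length Ws = Suc r" using Ws by (simp add: composition_series_def r_def)
  have sub: "U_submodule (Ws ! i) (word_mod q w)" if "i \<le> r" for i
    using Ws that len by (simp add: composition_series_def)
  have step: "Ws ! i \<subseteq> Ws ! Suc i" "U_simple (U_subquotient (word_mod q w) (Ws ! Suc i) (Ws ! i))" if "i < r" for i
    using Ws that len by (simp_all add: composition_series_def)
  define D where "D i = ?t ` (Ws ! i)" for i
  have "Ws ! 0 = {0\<^sub>v (2 ^ length w)}" "Ws ! r = carrier_vec (2 ^ length w)"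
    using Ws len hd_conv_nth[of Ws] last_conv_nth[of Ws] by (auto simp: composition_series_def word_mod_simps)
  then have D: "D 0 = {\<lambda>_. 0}" "D r = supp_len (length w)"
    using bij_betw_imp_surj_on[OF to_fun_bij] by (simp_all add: D_def to_fun_linear(5))
  have inv: "inv_subsp (wact q w) (D i)" if "i \<le> r" for i
    unfolding D_def by (rule image_inv_subsp(1)[OF sub[OF that]])
  have simple: "simple_step (wact q w) (D i) (D (Suc i))" if "i < r" for i
    using U_simple_iff_simple_step[OF sub sub step(1)[OF that]] step(2)[OF that] that by (simp add: D_def)
  have "card {i. i < r \<and> char_step (wact q w) triv (D i) (D (Suc i))} = balanced_count w (\<lambda>_. 0)"
    by (rule simple_series_char_steps[OF q D inv simple])
  moreover have "{i. Suc i < length Ws \<and> U_isomorphic (U_subquotient (word_mod q w) (Ws ! Suc i) (Ws ! i)) (U_mod_of_rep trivial_rep)}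
      = {i. i < r \<and> char_step (wact q w) triv (D i) (D (Suc i))}"
    using isomorphic_trivial_iff_char_step[OF sub sub step] unfolding D_def len by auto
  ultimately show ?thesis by simp
qed

lemma composition_series_exists:
  assumes q: "q \<noteq> 0" "q^2 \<noteq> 1"
  shows "\<exists>Ws. composition_series q (word_mod q w) Ws"
proof -
  let ?n = "length w" and ?t = "to_fun (length w)"
  have X: "inv_subsp (wact q w) (supp_len ?n)" by (auto simp: inv_subsp_def subsp_supp_len wact_supp_len)
  have Z: "inv_subsp (wact q w) {\<lambda>_. 0}" by (rule inv_subsp_zero[OF linear_op_wact])
  obtain Ds where Ds: "Ds \<noteq> []" "hd Ds = {\<lambda>_. 0}" "last Ds = supp_len ?n"
    "\<forall>D\<in>set Ds. inv_subsp (wact q w) D \<and> D \<subseteq> supp_len ?n"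
    "\<forall>i. Suc i < length Ds \<longrightarrow> simple_step (wact q w) (Ds ! i) (Ds ! Suc i)"
    using simple_series_exists[OF bij_betw_bidx X equalityD1[OF supp_len_flag] Z] subsp_zero[OF subsp_supp_len] by auto
  define Ws where "Ws = map (vsets ?n) Ds"
  have "composition_series q (word_mod q w) Ws"
    unfolding composition_series_def
  proof (intro conjI allI impI ballI U_module_word q)
    show "Ws \<noteq> []" using Ds by (simp add: Ws_def)
    have "vsets ?n {\<lambda>_. 0} = vsets ?n (?t ` {0\<^sub>v (2 ^ ?n)})" by (simp add: to_fun_linear(5))
    also have "\<dots> = {0\<^sub>v (2 ^ ?n)}" by (rule vsets_image) simp
    finally show "hd Ws = {\<zero>\<^bsub>word_mod q w\<^esub>}" using Ds by (simp add: Ws_def hd_map word_mod_simps)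
    have "vsets ?n (supp_len ?n) = vsets ?n (?t ` carrier_vec (2 ^ ?n))"
      using bij_betw_imp_surj_on[OF to_fun_bij] by simp
    also have "\<dots> = carrier_vec (2 ^ ?n)" by (rule vsets_image) simp
    finally show "last Ws = carrier (word_mod q w)" using Ds by (simp add: Ws_def last_map word_mod_simps)
    show sub: "U_submodule W (word_mod q w)" if "W \<in> set Ws" for W
      using that Ds by (auto simp: Ws_def intro: vsets_submodule)
    fix i assume i: "Suc i < length Ws"
    then have st: "simple_step (wact q w) (Ds ! i) (Ds ! Suc i)" using Ds by (simp add: Ws_def)
    have eq: "Ws ! i = vsets ?n (Ds ! i)" "Ws ! Suc i = vsets ?n (Ds ! Suc i)" using i by (simp_all add: Ws_def)
    show le: "Ws ! i \<subseteq> Ws ! Suc i" unfolding eq using st by (auto simp: simple_step_def vsets_def)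
    have "Ds ! i \<subseteq> supp_len ?n" "Ds ! Suc i \<subseteq> supp_len ?n" using Ds(4) i by (simp_all add: Ws_def)
    then have "?t ` (Ws ! i) = Ds ! i" "?t ` (Ws ! Suc i) = Ds ! Suc i" unfolding eq by (simp_all add: image_vsets)
    then show "U_simple (U_subquotient (word_mod q w) (Ws ! Suc i) (Ws ! i))"
      using U_simple_iff_simple_step[OF sub sub le] st i by simp
  qed
  then show ?thesis ..
qed

theorem proposition5p11:
  fixes q :: complex and w :: "int list" and n N :: nat
  assumes "q \<noteq> 0" and "\<And>k::nat. k > 0 \<Longrightarrow> q ^ k \<noteq> 1"
    and "length w = 2 * n"
    and "set w \<subseteq> {2 * int k | k. k \<le> N}"
  shows "h_char q w =
    (\<Prod>k = 1..N + 1. binom (count_list w (2 * int k)) (m_num w (2 * int k - 1)))"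
proof -
  have q2: "q^2 \<noteq> 1" using assms(2)[of 2] by simp
  obtain Ws where "composition_series q (word_mod q w) Ws"
    using composition_series_exists[OF assms(1) q2] by blast
  \<comment> \<open>The series just obtained provides existence for the definite description;
    uniqueness holds because every composition series gives the same count.\<close>
  then have "h_char q w = balanced_count w (\<lambda>_. 0)"
    unfolding h_char_def JH_multiplicity_def
    using composition_series_count[OF assms(1,2)] by (intro the_equality) auto
  then show ?thesis using balanced_count_prod[OF assms(4)] by simp
qed

end
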